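(* Let $\Gamma$ be a compact Lie group acting linearly and orthogonally on $\mathbb{R}^n$ (i.e. $\mathbb{R}^n$ is an orthogonal representation of $\Gamma$), let $\Omega\subset\mathbb{R}^n$ be an open $\Gamma$-invariant set, let $U:\Omega\to\mathbb{R}$ be a $\Gamma$-invariant function of class $C^2$, and let $q_0\in\Omega$ be a critical point of $U$. Assume that (1) the isotropy group $\Gamma_{q_0}=\{\gamma\in\Gamma:\gamma q_0=q_0\}$ is trivial; (2) $\dim\ker\nabla^2U(q_0)=\dim\Gamma(q_0)$, where $\Gamma(q_0)=\{\gamma q_0:\gamma\in\Gamma\}$; (3) the Hessian $\nabla^2U(q_0)$ has at least one positive eigenvalue. Then for every open neighborhood $\mathcal{O}\subset\Omega$ of the orbit $\Gamma(q_0)$ there is a $\Gamma$-orbit of non-stationary periodic solutions of the system $\ddot q(t)=-\nabla U(q(t))$ in $\mathcal{O}$, i.e. there is a non-constant periodic solution $q:\mathbb{R}\to\Omega$ of this system such that $\gamma q(t)\in\mathcal{O}$ for all $\gamma\in\Gamma$ and $t\in\mathbb{R}$. Moreover, write $\sigma(\nabla^2U(q_0))\cap(0,+\infty)=\{\beta_1^2,\ldots,\beta_m^2\}$ with $\beta_1>\cdots>\beta_m>0$, and suppose that $j_0\in\{1,\ldots,m\}$ is such that $\beta_1/\beta_{j_0},\ldots,\beta_{j_0-1}/\beta_{j_0}\notin\mathbb{N}$. Then the periodic solutions above can be found with minimal period close to $2\pi/\beta_{j_0}$: for every open neighborhood $\mathcal{O}\subset\Omega$ of $\Gamma(q_0)$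 and every $\delta>0$ there is a non-constant periodic solution $q$ of $\ddot q(t)=-\nabla U(q(t))$ with $\gamma q(t)\in\mathcal{O}$ for all $\gamma\in\Gamma$, $t\in\mathbb{R}$, whose minimal period $T$ satisfies $|T-2\pi/\beta_{j_0}|<\delta$.
   Context: $\sigma(A)$ denotes the spectrum of a symmetric matrix $A$. If $q$ is a solution of the system then so is $\gamma q$ for every $\gamma\in\Gamma$; the orbit of a solution $q$ is $\{\gamma q:\gamma\in\Gamma\}$. *)

theory Defs
  imports "HOL-Analysis.Analysis" "HOL-Algebra.Group_Action"
begin

section \<open>Manifolds and Lie groups\<close>

text \<open>
  Manifolds of dimension \<open>d\<close> are modelled on \<^const>\<open>Euclidean_space\<close> \<open>d\<close>, the space of sequences
  \<open>x :: nat \<Rightarrow> real\<close> with \<open>x i = 0\<close> for \<open>i \<ge> d\<close>. The type class \<^class>\<open>euclidean_space\<close>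
  would exclude \<open>d = 0\<close>, that is, discrete (finite) groups.
\<close>

definition chart :: "'a topology \<Rightarrow> nat \<Rightarrow> 'a set \<times> ('a \<Rightarrow> nat \<Rightarrow> real) \<Rightarrow> bool" where
  "chart X d = (\<lambda>(W, \<phi>). openin X W \<and> openin (Euclidean_space d) (\<phi> ` W) \<and>
     homeomorphic_map (subtopology X W) (subtopology (Euclidean_space d) (\<phi> ` W)) \<phi>)"

text \<open>
  The dimension is unique (by invariance of dimension) when \<open>X\<close> is nonempty and locally Euclidean.
\<close>

definition locally_euclidean :: "nat \<Rightarrow> 'a topology \<Rightarrow> bool" where
  "locally_euclidean d X \<longleftrightarrow> (\<forall>x\<in>topspace X. \<exists>W \<phi>. chart X d (W, \<phi>) \<and> x \<in> W)"

definition manifold_dim :: "'a topology \<Rightarrow> nat" where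
  "manifold_dim X = (THE d. locally_euclidean d X)"

text \<open>\<open>C_on k d f S\<close>: all partial derivatives of \<open>f\<close> up to order \<open>k\<close> exist and are continuous
  on the open subset \<open>S\<close> of \<^const>\<open>Euclidean_space\<close> \<open>d\<close>.\<close>

primrec C_on :: "nat \<Rightarrow> nat \<Rightarrow> ((nat \<Rightarrow> real) \<Rightarrow> real) \<Rightarrow> (nat \<Rightarrow> real) set \<Rightarrow> bool" where
  "C_on 0 d f S \<longleftrightarrow> continuous_map (subtopology (Euclidean_space d) S) euclideanreal f"
| "C_on (Suc k) d f S \<longleftrightarrow> continuous_map (subtopology (Euclidean_space d) S) euclideanreal f \<and>
     (\<forall>i<d. \<exists>g. (\<forall>x\<in>S. ((\<lambda>t. f (x(i := t))) has_real_derivative g x) (at (x i))) \<and> C_on k d g S)"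

definition smooth_map ::
  "'a topology \<Rightarrow> nat \<Rightarrow> ('a set \<times> ('a \<Rightarrow> nat \<Rightarrow> real)) set \<Rightarrow>
   'b topology \<Rightarrow> nat \<Rightarrow> ('b set \<times> ('b \<Rightarrow> nat \<Rightarrow> real)) set \<Rightarrow> ('a \<Rightarrow> 'b) \<Rightarrow> bool" where
  "smooth_map X d A Y e B f \<longleftrightarrow> continuous_map X Y f \<and>
     (\<forall>(W, \<phi>)\<in>A. \<forall>(V, \<psi>)\<in>B. \<forall>i<e. \<forall>k.
        C_on k d (\<lambda>x. \<psi> (f (inv_into W \<phi> x)) i) (\<phi> ` {x\<in>W. f x \<in> V}))"

text \<open>Smoothness of the identity with respect to \<open>A\<close> on both sides says that
  all transition maps between charts in \<open>A\<close> are smooth.\<close>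

definition smooth_atlas :: "'a topology \<Rightarrow> nat \<Rightarrow> ('a set \<times> ('a \<Rightarrow> nat \<Rightarrow> real)) set \<Rightarrow> bool" where
  "smooth_atlas X d A \<longleftrightarrow> (\<forall>c\<in>A. chart X d c) \<and> (\<Union>(fst ` A)) = topspace X \<and>
     smooth_map X d A X d A (\<lambda>x. x)"

definition prod_atlas ::
  "nat \<Rightarrow> ('a set \<times> ('a \<Rightarrow> nat \<Rightarrow> real)) set \<Rightarrow> ('b set \<times> ('b \<Rightarrow> nat \<Rightarrow> real)) set \<Rightarrow>
   (('a \<times> 'b) set \<times> ('a \<times> 'b \<Rightarrow> nat \<Rightarrow> real)) set" where
  "prod_atlas d A B =
     {(W \<times> V, \<lambda>(x, y) i. if i < d then \<phi> x i else \<psi> y (i - d)) | W \<phi> V \<psi>. (W, \<phi>) \<in> A \<and> (V, \<psi>) \<in> B}"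

definition second_countable_space :: "'a topology \<Rightarrow> bool" where
  "second_countable_space X \<longleftrightarrow> (\<exists>\<B>. countable \<B> \<and> (\<forall>V\<in>\<B>. openin X V) \<and>
     (\<forall>W x. openin X W \<and> x \<in> W \<longrightarrow> (\<exists>V\<in>\<B>. x \<in> V \<and> V \<subseteq> W)))"

definition lie_group :: "('g, 'h) monoid_scheme \<Rightarrow> 'g topology \<Rightarrow> bool" where
  "lie_group G X \<longleftrightarrow> group G \<and> topspace X = carrier G \<and>
     Hausdorff_space X \<and> second_countable_space X \<and>
     (\<exists>d A. smooth_atlas X d A \<and>
        smooth_map (prod_topology X X) (d + d) (prod_atlas d A A) X d A (\<lambda>(g, h). g \<otimes>\<^bsub>G\<^esub> h) \<and>
        smooth_map X d A X d A (\<lambda>g. inv\<^bsub>G\<^esub> g))"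

definition orthogonal_representation ::
  "('g, 'h) monoid_scheme \<Rightarrow> 'g topology \<Rightarrow> ('g \<Rightarrow> real^'n \<Rightarrow> real^'n) \<Rightarrow> bool" where
  "orthogonal_representation G X \<rho> \<longleftrightarrow> group_action G UNIV \<rho> \<and>
     (\<forall>g\<in>carrier G. orthogonal_transformation (\<rho> g)) \<and>
     continuous_map (prod_topology X euclidean) euclidean (\<lambda>(g, x). \<rho> g x)"

section \<open>Potentials\<close>

definition grad :: "(real^'n \<Rightarrow> real) \<Rightarrow> real^'n \<Rightarrow> real^'n" where
  "grad U x = (\<chi> i. frechet_derivative U (at x) (axis i 1))"

definition hessian :: "(real^'n \<Rightarrow> real) \<Rightarrow> real^'n \<Rightarrow> real^'n^'n" where
  "hessian U x = jacobian (grad U) (at x)"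

definition C2_on :: "(real^'n \<Rightarrow> real) \<Rightarrow> (real^'n) set \<Rightarrow> bool" where
  "C2_on U S \<longleftrightarrow> (\<forall>x\<in>S. U differentiable at x) \<and> (\<forall>x\<in>S. grad U differentiable at x) \<and>
     continuous_on S (hessian U)"

definition spectrum :: "real^'n^'n \<Rightarrow> real set" where
  "spectrum A = {c. \<exists>v. v \<noteq> 0 \<and> A *v v = c *\<^sub>R v}"

section \<open>Periodic solutions\<close>

definition newton_solution ::
  "(real^'n \<Rightarrow> real) \<Rightarrow> (real^'n) set \<Rightarrow> (real \<Rightarrow> real^'n) \<Rightarrow> bool" where
  "newton_solution U S q \<longleftrightarrow> (\<forall>t. q t \<in> S) \<and>
     (\<exists>p. \<forall>t. (q has_vector_derivative p t) (at t) \<and>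
              (p has_vector_derivative - grad U (q t)) (at t))"

definition is_period :: "(real \<Rightarrow> 'a) \<Rightarrow> real \<Rightarrow> bool" where
  "is_period q T \<longleftrightarrow> 0 < T \<and> (\<forall>t. q (t + T) = q t)"

definition minimal_period :: "(real \<Rightarrow> 'a) \<Rightarrow> real \<Rightarrow> bool" where
  "minimal_period q T \<longleftrightarrow> is_period q T \<and> (\<forall>S. is_period q S \<longrightarrow> T \<le> S)"

end

theory Submission
  imports Defs "HOL-Homology.Homology"
begin

text \<open>
  The solutions are found as brake orbits: paths that start at rest, come to rest again after half a
  period, and then retrace their way. Since the equation is reversible, such a path continues to an
  even periodic solution (\<open>even_periodic_extension\<close>), and it suffices to solve a boundary value
  problem with \<open>q' = 0\<close> at both ends of a half period. Rescaling space around the critical point \<open>q0\<close>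
  and time by the frequency makes the equation \<open>v'' = - m g(v)\<close> on \<open>{0..pi}\<close>, with \<open>g\<close> close to
  \<open>N = H / \<beta>\<^sup>2\<close> and \<open>m\<close> close to \<open>1\<close>.
  
  The linearised boundary value problem has two kinds of solutions: \<open>cos t z\<close> with \<open>N z = z\<close>, and
  constants in the kernel of the Hessian \<open>H\<close>. There are no others if no \<open>(k \<beta>)\<^sup>2\<close> with \<open>k \<ge> 2\<close> is an
  eigenvalue; this is the nonresonance condition on \<open>\<beta> = \<beta>\<^sub>j\<close>, and some frequency \<open>\<beta>\<close> always satisfies it
  (\<open>nonresonant_frequency_exists\<close>). By contraction (\<open>ls_solution_exists\<close>) one solves for every amplitude \<open>z\<close> the
  differential equation with \<open>v' 0 = 0\<close>, up to an error \<open>v' pi = e + k\<close> with \<open>N e = e\<close> and \<open>H k = 0\<close>.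
  
  The part \<open>k\<close> is controlled by the symmetry. The hypothesis on dimensions says that the kernel of \<open>H\<close>
  is the tangent space of the orbit. More precisely, every kernel vector is \<open>A q0\<close> for a skew matrix
  \<open>A\<close> that annihilates the gradient of \<open>U\<close> (\<open>infinitesimal_symmetry\<close>). To see this, note that orbit
  points are critical points, so near \<open>q0\<close> they project injectively to the kernel of \<open>H\<close>; as the
  dimensions agree, invariance of domain shows that the projection is onto a neighbourhood. Limits of
  difference quotients of the group action then give \<open>A\<close>. The angular momentum \<open>q' \<bullet> A q\<close> is a conserved
  quantity, zero at the start, and this gives \<open>|k| \<le> |e| / 3\<close> (\<open>kernel_part_small\<close>).
  
  The part \<open>e\<close> is removed by a variational argument that works for eigenvalues of any multiplicity.
  The factor \<open>m\<close>, that is, the period, is made a function of the potential energy of the path, so that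
  the equation is the Euler equation of a functional without constraints; along the reduced family
  its first variation is \<open>- v' pi \<bullet> \<delta>v pi\<close>, which is about \<open>e \<bullet> \<delta>z\<close> (\<open>psi_expansion\<close>). The functional has
  a maximum over an annulus of amplitudes. On the boundary of the annulus \<open>e\<close> points inwards, because
  large amplitudes oscillate too slowly and small ones too fast (\<open>radial_sign\<close>). So a small step along
  \<open>e\<close> is always possible, and at a maximum \<open>e = 0\<close> (\<open>brake_orbit_exists\<close>).
  
  The path stays uniformly close to \<open>cos t z\<close>, which gives that the period is minimal, and it is as
  close to \<open>q0\<close> as desired, which keeps all its translates by the group near the orbit.
\<close>

section \<open>Symmetric linear maps\<close>

text \<open>
  The first-order condition at a maximum, for functions of which only a one-sided quadratic expansion
  is known.
\<close>

lemma real_linear_le_quadratic_imp_zero: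
  fixes a b :: real
  assumes "0 \<le> a" and r: "0 < r" and le: "\<And>s. 0 < s \<Longrightarrow> s < r \<Longrightarrow> s * a \<le> s\<^sup>2 * b"
  shows "a = 0"
proof (rule ccontr)
  assume "a \<noteq> 0"
  then have a: "a > 0" using assms(1) by simp
  define s where "s = min (r/2) (a / (2 * (\<bar>b\<bar> + 1)))"
  have s: "0 < s" "s < r" using r a by (auto simp: s_def)
  have "s * a \<le> s * (s * b)" using le[OF s] by (simp add: power2_eq_square mult.assoc)
  then have "a \<le> s * b" using s(1) by simp
  also have "\<dots> \<le> s * (\<bar>b\<bar> + 1)" using s(1) by (intro mult_left_mono) auto
  also have "\<dots> \<le> a / (2 * (\<bar>b\<bar> + 1)) * (\<bar>b\<bar> + 1)"
    by (intro mult_right_mono) (auto simp: s_def)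
  also have "\<dots> = a / 2" by (simp add: field_simps)
  finally show False using a by simp
qed

text \<open>
  A maximum point of the quadratic form on the unit sphere is an eigenvector: moving it along the
  residual \<open>r = f v - c v\<close> would otherwise increase the form at first order.
\<close>

lemma symmetric_eigenvector_exists:
  fixes f :: "'a::euclidean_space \<Rightarrow> 'a"
  assumes lin: "linear f" and sym: "\<And>x y. x \<bullet> f y = f x \<bullet> y"
    and S: "subspace S" and inv: "f ` S \<subseteq> S" and ne: "\<exists>x\<in>S. x \<noteq> 0"
  obtains v c where "v \<in> S" "norm v = 1" "f v = c *\<^sub>R v"
proof -
  interpret linear f by (rule lin)
  have comp: "compact (sphere 0 1 \<inter> S)"
    using compact_Int_closed[OF compact_sphere closed_subspace[OF S]] .
  obtain x where x: "x \<in> S" "x \<noteq> 0" using ne by auto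
  then have "x /\<^sub>R norm x \<in> sphere 0 1 \<inter> S" using S by (auto simp: subspace_scale)
  then have nonempty: "sphere 0 1 \<inter> S \<noteq> {}" by blast
  have cont: "continuous_on (sphere 0 1 \<inter> S) (\<lambda>x. x \<bullet> f x)"
    by (intro continuous_intros linear_continuous_on linear_conv_bounded_linear[THEN iffD1] lin)
  obtain v where v: "v \<in> sphere 0 1 \<inter> S" and max: "\<And>y. y \<in> sphere 0 1 \<inter> S \<Longrightarrow> y \<bullet> f y \<le> v \<bullet> f v"
    using continuous_attains_sup[OF comp nonempty cont] by blast
  define c where "c = v \<bullet> f v"
  define r where "r = f v - c *\<^sub>R v"
  have vS: "v \<in> S" and v1: "norm v = 1" using v by auto
  have rS: "r \<in> S" unfolding r_def using S inv vS by (auto intro!: subspace_diff subspace_scale)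
  have vv: "v \<bullet> v = 1" using v1 by (simp add: dot_square_norm)
  have rv: "r \<bullet> v = 0"
    by (simp add: r_def inner_diff_left c_def vv inner_commute[of "f v" v])
  have rf: "r \<bullet> f v = r \<bullet> r"
  proof -
    have "f v = r + c *\<^sub>R v" by (simp add: r_def)
    then show ?thesis by (simp add: inner_add_right rv)
  qed
  \<comment> \<open>homogeneity turns the maximum on the sphere into an inequality on all of \<open>S\<close>\<close>
  have hom: "y \<bullet> f y \<le> c * (y \<bullet> y)" if "y \<in> S" for y
  proof (cases "y = 0")
    case False
    then have "y /\<^sub>R norm y \<in> sphere 0 1 \<inter> S" using S that by (auto simp: subspace_scale)
    from max[OF this] have "(y \<bullet> f y) / (norm y)\<^sup>2 \<le> c"
      by (simp add: c_def scale divide_inverse power2_eq_square mult_ac)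
    then show ?thesis using False by (simp add: divide_le_eq dot_square_norm)
  qed (simp add: zero)
  have "(2 * (r \<bullet> r)) = 0"
  proof (rule real_linear_le_quadratic_imp_zero[where r = 1 and b = "c * (r \<bullet> r) - r \<bullet> f r"])
    fix s :: real
    have "v + s *\<^sub>R r \<in> S" using S vS rS by (auto intro: subspace_add subspace_scale)
    from hom[OF this] show "s * (2 * (r \<bullet> r)) \<le> s\<^sup>2 * (c * (r \<bullet> r) - r \<bullet> f r)"
      using rv rf sym[of v r]
      by (simp add: add scale inner_add_left inner_add_right vv c_def[symmetric] inner_commute
          power2_eq_square algebra_simps)
  qed auto
  then have "f v = c *\<^sub>R v" by (simp add: r_def)
  with vS v1 show ?thesis by (rule that)
qed

lemma symmetric_orthonormal_eigenbasis_subspace: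
  fixes f :: "'a::euclidean_space \<Rightarrow> 'a"
  assumes lin: "linear f" and sym: "\<And>x y. x \<bullet> f y = f x \<bullet> y"
  shows "subspace S \<Longrightarrow> f ` S \<subseteq> S \<Longrightarrow>
    \<exists>B. pairwise orthogonal B \<and> (\<forall>b\<in>B. norm b = 1 \<and> (\<exists>c. f b = c *\<^sub>R b)) \<and> B \<subseteq> S \<and> span B = S"
proof (induction "dim S" arbitrary: S rule: less_induct)
  case less
  show ?case
  proof (cases "\<exists>x\<in>S. x \<noteq> 0")
    case False
    then have "S = {0}" using less.prems(1) subspace_0 by blast
    then show ?thesis by (intro exI[of _ "{}"]) auto
  next
    case True
    obtain v c where v: "v \<in> S" "norm v = 1" "f v = c *\<^sub>R v"
      by (rule symmetric_eigenvector_exists[OF lin sym less.prems True])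
    define T where "T = {x\<in>S. v \<bullet> x = 0}"
    have T: "subspace T" using less.prems(1)
      by (auto simp: T_def subspace_def inner_add_right)
    have Tinv: "f ` T \<subseteq> T" using less.prems(2) sym[of v] by (auto simp: T_def v(3))
    have vv: "v \<bullet> v = 1" using v(2) by (simp add: dot_square_norm)
    have "v \<notin> T" using vv by (simp add: T_def)
    then have "T \<noteq> S" using v(1) by blast
    then have "T \<subset> S" by (auto simp: T_def)
    then have "dim T < dim S"
      using T less.prems(1) by (metis dim_psubset span_eq_iff)
    from less.hyps[OF this T Tinv] obtain B where B: "pairwise orthogonal B"
      "\<forall>b\<in>B. norm b = 1 \<and> (\<exists>c. f b = c *\<^sub>R b)" "B \<subseteq> T" "span B = T" by auto
    have "x \<in> span (insert v B)" if "x \<in> S" for x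
    proof -
      have "x - (v \<bullet> x) *\<^sub>R v \<in> T"
        using that v(1) less.prems(1) vv
        by (auto simp: T_def inner_diff_right intro!: subspace_diff subspace_scale)
      then show ?thesis by (subst span_breakdown_eq) (auto simp: B(4))
    qed
    moreover have "span (insert v B) \<subseteq> S"
      using v(1) B(3) less.prems(1) by (intro span_minimal) (auto simp: T_def)
    ultimately have "span (insert v B) = S" by blast
    moreover have "pairwise orthogonal (insert v B)"
      using B(1,3) by (auto simp: pairwise_insert orthogonal_def T_def inner_commute)
    ultimately show ?thesis using B v by (intro exI[of _ "insert v B"]) (auto simp: T_def)
  qed
qed

text \<open>
  The expansion is stated with an explicit sum so that vector-valued linear equations with a
  symmetric coefficient can be solved one scalar equation at a time.
\<close>

theorem symmetric_orthonormal_eigenbasis: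
  fixes f :: "'a::euclidean_space \<Rightarrow> 'a"
  assumes lin: "linear f" and sym: "\<And>x y. x \<bullet> f y = f x \<bullet> y"
  obtains B l where "finite B" "\<And>b. b \<in> B \<Longrightarrow> norm b = 1"
    "\<And>b b'. b \<in> B \<Longrightarrow> b' \<in> B \<Longrightarrow> b \<noteq> b' \<Longrightarrow> b \<bullet> b' = 0"
    "\<And>b. b \<in> B \<Longrightarrow> f b = l b *\<^sub>R b" "\<And>x. (\<Sum>b\<in>B. (b \<bullet> x) *\<^sub>R b) = x"
proof -
  obtain B where B: "pairwise orthogonal B"
      "\<forall>b\<in>B. norm b = 1 \<and> (\<exists>c. f b = c *\<^sub>R b)" "span B = UNIV"
    using symmetric_orthonormal_eigenbasis_subspace[OF lin sym, of UNIV] by auto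
  obtain l where l: "\<forall>b\<in>B. f b = l b *\<^sub>R b" using B(2) by metis
  have fin: "finite B" using B(1) by (rule pairwise_orthogonal_imp_finite)
  have exp: "x = (\<Sum>b\<in>B. (b \<bullet> x) *\<^sub>R b)" for x
  proof -
    have "x = (\<Sum>b\<in>B. (b \<bullet> x) *\<^sub>R b)" if "x \<in> span B"
      using that
    proof (induction rule: span_induct_alt)
      case (step c y z)
      have "(\<Sum>b\<in>B. (b \<bullet> y) *\<^sub>R b) = (\<Sum>b\<in>B. if b = y then y else 0)"
        using B(1,2) step(1) by (intro sum.cong) (auto simp: pairwise_def orthogonal_def dot_square_norm)
      also have "\<dots> = y" using fin step(1) by simp
      finally show ?case
        by (subst step(2)) (simp add: inner_add_right scaleR_add_left sum.distrib
            flip: scaleR_scaleR scaleR_right.sum)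
    qed simp
    then show ?thesis using B(3) by auto
  qed
  show ?thesis
  proof (rule that[of B l])
    show "b \<bullet> b' = 0" if "b \<in> B" "b' \<in> B" "b \<noteq> b'" for b b'
      using B(1) that by (auto simp: pairwise_def orthogonal_def)
  qed (use fin B(2) l exp[symmetric] in auto)
qed

section \<open>The linear oscillator on a half period\<close>

text \<open>
  The solutions \<open>c\<close>, \<open>s\<close> of \<open>y'' + \<nu> y = 0\<close> with initial data \<open>(1, 0)\<close> and \<open>(0, 1)\<close>. Up to scaling they
  are trigonometric, affine or hyperbolic according to the sign of \<open>\<nu>\<close>. The number \<open>\<nu> * s pi = - c' pi\<close>
  decides whether the Neumann problem on \<open>{0..pi}\<close> is uniquely solvable.
\<close>

lemma fundamental_system:
  fixes \<nu> :: real
  obtains c s :: "real \<Rightarrow> real" where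
    "\<And>t. (c has_real_derivative - \<nu> * s t) (at t)" "\<And>t. (s has_real_derivative c t) (at t)"
    "c 0 = 1" "s 0 = 0" "\<And>t. (c t)\<^sup>2 + \<nu> * (s t)\<^sup>2 = 1"
    "\<nu> * s pi = 0 \<Longrightarrow> \<exists>k::nat. \<nu> = (real k)\<^sup>2"
proof -
  consider "\<nu> = 0" | "\<nu> > 0" | "\<nu> < 0" by linarith
  then show ?thesis
  proof cases
    case 1
    show ?thesis
      by (rule that[of "\<lambda>_. 1" "\<lambda>t. t"]) (auto simp: 1 intro!: derivative_eq_intros exI[of _ 0])
  next
    case 2
    define w where "w = sqrt \<nu>"
    have w: "w > 0" "\<nu> = w * w" using 2 by (auto simp: w_def)
    show ?thesis
    proof (rule that[of "\<lambda>t. cos (w * t)" "\<lambda>t. sin (w * t) / w"])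
      show "(cos (w * t))\<^sup>2 + \<nu> * (sin (w * t) / w)\<^sup>2 = 1" for t
        using w by (simp add: power_divide power2_eq_square[of w])
      assume "\<nu> * (sin (w * pi) / w) = 0"
      then have "sin (w * pi) = 0" using w by simp
      then obtain i :: int where i: "w * pi = of_int i * pi" by (auto simp: sin_zero_iff_int2)
      then have wi: "w = of_int i" by simp
      then have "i \<ge> 0" using w by simp
      then have "w = real (nat i)" using wi by simp
      then show "\<exists>k::nat. \<nu> = (real k)\<^sup>2" using w(2) by (auto simp: power2_eq_square)
    qed (use w in \<open>auto intro!: derivative_eq_intros simp: field_simps\<close>)
  next
    case 3
    define w where "w = sqrt (- \<nu>)"
    have w: "w > 0" "\<nu> = - (w * w)" using 3 by (auto simp: w_def)
    show ?thesis
    proof (rule that[of "\<lambda>t. cosh (w * t)" "\<lambda>t. sinh (w * t) / w"])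
      show "(cosh (w * t))\<^sup>2 + \<nu> * (sinh (w * t) / w)\<^sup>2 = 1" for t
        using w by (simp add: power_divide power2_eq_square[of w] cosh_square_eq)
      assume "\<nu> * (sinh (w * pi) / w) = 0"
      then show "\<exists>k::nat. \<nu> = (real k)\<^sup>2" using w by simp
    qed (use w in \<open>auto intro!: derivative_eq_intros simp: field_simps\<close>)
  qed
qed

lemma indefinite_integral_has_real_derivative:
  fixes h :: "real \<Rightarrow> real"
  assumes "continuous_on {0..pi} h" "t \<in> {0..pi}"
  shows "((\<lambda>t. integral {0..t} h) has_real_derivative h t) (at t within {0..pi})"
  using integral_has_real_derivative[OF assms(1), of t] assms(2) by auto

lemma integral_abs_bound:
  fixes h :: "real \<Rightarrow> real"
  assumes "continuous_on {0..pi} h" "\<And>t. t \<in> {0..pi} \<Longrightarrow> \<bar>h t\<bar> \<le> M" "t \<in> {0..pi}"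
  shows "\<bar>integral {0..t} h\<bar> \<le> M * pi"
proof -
  have "M \<ge> 0" using assms(2)[of 0] by auto
  have "norm (integral {0..t} h) \<le> M * (t - 0)"
    using assms by (intro integral_bound) (auto intro: continuous_on_subset)
  also have "\<dots> \<le> M * pi" using \<open>M \<ge> 0\<close> assms(3) by (auto intro: mult_left_mono)
  finally show ?thesis by simp
qed

text \<open>
  \<open>Y f\<close> is a solution of \<open>y'' + N y = f\<close> on \<open>{0..pi}\<close> with \<open>y' 0 = 0\<close>, and \<open>Y' f\<close> is its derivative. The
  second Neumann condition \<open>y' pi = 0\<close> can only be reached up to the resonant eigenspaces: the
  eigenvalue \<open>1\<close>, where \<open>cos\<close> solves the homogeneous problem, and the eigenvalue \<open>0\<close>, where constants
  do. Both operators are bounded in the supremum norm, which is what a contraction argument needs.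
\<close>

definition neumann_green :: "('a::euclidean_space \<Rightarrow> 'a) \<Rightarrow> ((real \<Rightarrow> 'a) \<Rightarrow> real \<Rightarrow> 'a) \<Rightarrow>
    ((real \<Rightarrow> 'a) \<Rightarrow> real \<Rightarrow> 'a) \<Rightarrow> real \<Rightarrow> bool" where
  "neumann_green N Y Y' C \<longleftrightarrow> 0 < C \<and>
    (\<forall>f. continuous_on {0..pi} f \<longrightarrow>
      (\<forall>t\<in>{0..pi}. (Y f has_vector_derivative Y' f t) (at t within {0..pi}) \<and>
                   (Y' f has_vector_derivative f t - N (Y f t)) (at t within {0..pi})) \<and>
      Y' f 0 = 0 \<and> (\<exists>e k. Y' f pi = e + k \<and> N e = e \<and> N k = 0) \<and>
      (\<forall>M. (\<forall>t\<in>{0..pi}. norm (f t) \<le> M) \<longrightarrow>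
        (\<forall>t\<in>{0..pi}. norm (Y f t) \<le> C * M \<and> norm (Y' f t) \<le> C * M))) \<and>
    (\<forall>f g t. continuous_on {0..pi} f \<longrightarrow> continuous_on {0..pi} g \<longrightarrow> t \<in> {0..pi} \<longrightarrow>
        Y (\<lambda>t. f t - g t) t = Y f t - Y g t \<and> Y' (\<lambda>t. f t - g t) t = Y' f t - Y' g t)"

text \<open>
  Variation of constants gives \<open>y = a c + s (\<integral> c f) - c (\<integral> s f)\<close>; the free amplitude \<open>a\<close> is used to cancel
  \<open>y' pi\<close> whenever \<open>\<nu> * s pi \<noteq> 0\<close>.
\<close>

lemma scalar_neumann_green:
  fixes \<nu> :: real
  assumes nres: "\<And>k::nat. k \<ge> 2 \<Longrightarrow> \<nu> \<noteq> (real k)\<^sup>2"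
  shows "\<exists>Y Y' C. neumann_green (\<lambda>x::real. \<nu> * x) Y Y' C"
proof -
  obtain c s :: "real \<Rightarrow> real" where
    dc: "\<And>t. (c has_real_derivative - \<nu> * s t) (at t)" and ds: "\<And>t. (s has_real_derivative c t) (at t)"
    and c0: "c 0 = 1" and s0: "s 0 = 0" and cs: "\<And>t. (c t)\<^sup>2 + \<nu> * (s t)\<^sup>2 = 1"
    and res: "\<nu> * s pi = 0 \<Longrightarrow> \<exists>k::nat. \<nu> = (real k)\<^sup>2"
    using fundamental_system[of \<nu>] by blast
  have cc: "continuous_on A c" and sc: "continuous_on A s" for A
    using dc ds by (meson DERIV_isCont continuous_at_imp_continuous_on)+
  note [continuous_intros] = cc sc
  obtain M1 where M1: "\<And>t. t \<in> {0..pi} \<Longrightarrow> \<bar>c t\<bar> \<le> M1" "\<And>t. t \<in> {0..pi} \<Longrightarrow> \<bar>s t\<bar> \<le> M1"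
  proof -
    have "bounded (c ` {0..pi})" "bounded (s ` {0..pi})"
      by (auto intro!: compact_imp_bounded compact_continuous_image cc sc)
    then obtain a b where "\<forall>x\<in>{0..pi}. \<bar>c x\<bar> \<le> a" "\<forall>x\<in>{0..pi}. \<bar>s x\<bar> \<le> b"
      unfolding bounded_iff by auto
    then show ?thesis by (intro that[of "max a b"]) (auto simp: le_max_iff_disj)
  qed
  have M1pos: "M1 \<ge> 1" using M1(1)[of 0] c0 by auto
  \<comment> \<open>in the resonant cases the boundary value at \<open>pi\<close> cannot be corrected, and \<open>1 / 0 = 0\<close>\<close>
  define \<kappa> where "\<kappa> = 1 / (\<nu> * s pi)"
  define P where "P f t = integral {0..t} (\<lambda>x. c x * f x)" for f t
  define Q where "Q f t = integral {0..t} (\<lambda>x. s x * f x)" for f t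
  define a where "a f = \<kappa> * (c pi * P f pi + \<nu> * s pi * Q f pi)" for f
  define Y where "Y f t = a f * c t + s t * P f t - c t * Q f t" for f t
  define Y' where "Y' f t = - a f * \<nu> * s t + c t * P f t + \<nu> * s t * Q f t" for f t
  define C0 where "C0 = M1 * M1 * pi * (1 + \<bar>\<nu>\<bar>)"
  define C where "C = (\<bar>\<kappa>\<bar> * C0) * M1 * (1 + \<bar>\<nu>\<bar>) + 2 * C0 + 1"
  have dP: "(P f has_real_derivative c t * f t) (at t within {0..pi})"
    and dQ: "(Q f has_real_derivative s t * f t) (at t within {0..pi})"
    if "continuous_on {0..pi} f" "t \<in> {0..pi}" for f t
    unfolding P_def Q_def using that
    by (auto intro!: indefinite_integral_has_real_derivative continuous_intros)
  note dc' = DERIV_subset[OF dc subset_UNIV] and ds' = DERIV_subset[OF ds subset_UNIV]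
  have "neumann_green (\<lambda>x::real. \<nu> * x) Y Y' C"
    unfolding neumann_green_def
  proof (intro conjI allI impI ballI)
    have "C0 \<ge> 0" using M1pos by (simp add: C0_def)
    then show "0 < C" unfolding C_def using M1pos by (intro add_nonneg_pos add_nonneg_nonneg) auto
  next
    fix f :: "real \<Rightarrow> real" and t assume f: "continuous_on {0..pi} f" and t: "t \<in> {0..pi}"
    show "(Y f has_vector_derivative Y' f t) (at t within {0..pi})"
      unfolding has_real_derivative_iff_has_vector_derivative[symmetric] Y_def
      by (rule derivative_eq_intros dc' ds' dP dQ f t refl)+ (simp add: Y'_def algebra_simps)
    show "(Y' f has_vector_derivative f t - \<nu> * Y f t) (at t within {0..pi})"
      unfolding has_real_derivative_iff_has_vector_derivative[symmetric] Y'_def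
    proof (rule derivative_eq_intros dc' ds' dP dQ f t refl)+
      have "f t = ((c t)\<^sup>2 + \<nu> * (s t)\<^sup>2) * f t" by (simp add: cs)
      then show "0 * s t + c t * (- a f * \<nu>) + (- \<nu> * s t * P f t + c t * f t * c t) +
        ((0 * s t + c t * \<nu>) * Q f t + s t * f t * (\<nu> * s t)) = f t - \<nu> * Y f t"
        by (simp add: Y_def power2_eq_square algebra_simps)
    qed
  next
    fix f :: "real \<Rightarrow> real" assume f: "continuous_on {0..pi} f"
    show "Y' f 0 = 0" by (simp add: Y'_def P_def Q_def s0)
    show "\<exists>e k. Y' f pi = e + k \<and> \<nu> * e = e \<and> \<nu> * k = 0"
    proof (cases "\<nu> * s pi = 0")
      case True
      then obtain k :: nat where k: "\<nu> = (real k)\<^sup>2" using res by blast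
      then have "\<not> k \<ge> 2" using nres[of k] by auto
      then have "k = 0 \<or> k = 1" by linarith
      then have "\<nu> = 0 \<or> \<nu> = 1" using k by auto
      then show ?thesis by (metis add.left_neutral add.right_neutral mult_1 mult_zero_left mult_zero_right)
    next
      case False
      then have "Y' f pi = 0" by (simp add: Y'_def a_def \<kappa>_def)
      then show ?thesis by (intro exI[of _ 0]) auto
    qed
  next
    fix f :: "real \<Rightarrow> real" and M t
    assume f: "continuous_on {0..pi} f" and M: "\<forall>t\<in>{0..pi}. norm (f t) \<le> M" and t: "t \<in> {0..pi}"
    have M0: "M \<ge> 0" using M[rule_format, of 0] by auto
    have P: "\<bar>P f u\<bar> \<le> M1 * M * pi" and Q: "\<bar>Q f u\<bar> \<le> M1 * M * pi" if "u \<in> {0..pi}" for u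
      unfolding P_def Q_def using that M M1 M1pos
      by (auto intro!: integral_abs_bound continuous_intros f mult_mono simp: abs_mult)
    have CP: "\<bar>c u * P f u\<bar> \<le> M1 * (M1 * M * pi)" and CQ: "\<bar>c u * Q f u\<bar> \<le> M1 * (M1 * M * pi)"
      and SP: "\<bar>s u * P f u\<bar> \<le> M1 * (M1 * M * pi)" and SQ: "\<bar>s u * Q f u\<bar> \<le> M1 * (M1 * M * pi)"
      if "u \<in> {0..pi}" for u
      using M1[OF that] P[OF that] Q[OF that] M1pos by (auto intro!: mult_mono simp: abs_mult)
    have nSQ: "\<bar>\<nu> * s u * Q f u\<bar> \<le> \<bar>\<nu>\<bar> * (M1 * (M1 * M * pi))" if "u \<in> {0..pi}" for u
      using mult_left_mono[OF SQ[OF that], of "\<bar>\<nu>\<bar>"] by (simp add: abs_mult mult_ac)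
    have C0: "C0 * M = M1 * (M1 * M * pi) + \<bar>\<nu>\<bar> * (M1 * (M1 * M * pi))"
      by (simp add: C0_def algebra_simps)
    have pos: "M1 * (M1 * M * pi) \<ge> 0" "\<bar>\<nu>\<bar> * (M1 * (M1 * M * pi)) \<ge> 0" using M1pos M0 by auto
    have "\<bar>c pi * P f pi + \<nu> * s pi * Q f pi\<bar> \<le> C0 * M"
      using CP[of pi] nSQ[of pi] C0 by auto
    then have a: "\<bar>a f\<bar> \<le> \<bar>\<kappa>\<bar> * (C0 * M)"
      by (simp add: a_def abs_mult mult_left_mono)
    have K0: "0 \<le> \<bar>\<kappa>\<bar> * (C0 * M)" using a by linarith
    have ac: "\<bar>a f * c t\<bar> \<le> \<bar>\<kappa>\<bar> * (C0 * M) * M1"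
      using a M1(1)[OF t] K0 by (auto intro!: mult_mono simp: abs_mult)
    have "\<bar>a f * s t\<bar> \<le> \<bar>\<kappa>\<bar> * (C0 * M) * M1"
      using a M1(2)[OF t] K0 by (auto intro!: mult_mono simp: abs_mult)
    from mult_left_mono[OF this, of "\<bar>\<nu>\<bar>"]
    have as: "\<bar>- a f * \<nu> * s t\<bar> \<le> \<bar>\<kappa>\<bar> * (C0 * M) * M1 * \<bar>\<nu>\<bar>" by (simp add: abs_mult mult_ac)
    have CM: "C * M = \<bar>\<kappa>\<bar> * (C0 * M) * M1 + \<bar>\<kappa>\<bar> * (C0 * M) * M1 * \<bar>\<nu>\<bar> + 2 * (C0 * M) + M"
      by (simp add: C_def algebra_simps)
    have pos2: "0 \<le> \<bar>\<kappa>\<bar> * (C0 * M) * M1" "0 \<le> \<bar>\<kappa>\<bar> * (C0 * M) * M1 * \<bar>\<nu>\<bar>" using K0 M1pos by auto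
    show "norm (Y f t) \<le> C * M"
      using ac CP[OF t] CQ[OF t] SP[OF t] CM C0 pos pos2 M0
      unfolding Y_def real_norm_def by linarith
    show "norm (Y' f t) \<le> C * M"
      using as CP[OF t] nSQ[OF t] CM C0 pos pos2 M0
      unfolding Y'_def real_norm_def by linarith
  next
    fix f g :: "real \<Rightarrow> real" and t assume f: "continuous_on {0..pi} f" and g: "continuous_on {0..pi} g"
      and t: "t \<in> {0..pi}"
    have P: "P (\<lambda>t. f t - g t) u = P f u - P g u" and Q: "Q (\<lambda>t. f t - g t) u = Q f u - Q g u"
      if "u \<in> {0..pi}" for u
    proof -
      have sub: "{0..u} \<subseteq> {0..pi}" using that by auto
      have i: "(\<lambda>x. h x * k x) integrable_on {0..u}"
        if "continuous_on {0..pi} h" "continuous_on {0..pi} k" for h k :: "real \<Rightarrow> real"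
        by (intro integrable_continuous_interval continuous_intros continuous_on_subset[OF _ sub] that)
      show "P (\<lambda>t. f t - g t) u = P f u - P g u" "Q (\<lambda>t. f t - g t) u = Q f u - Q g u"
        unfolding P_def Q_def by (simp_all add: right_diff_distrib integral_diff i f g cc sc)
    qed
    show "Y (\<lambda>t. f t - g t) t = Y f t - Y g t" "Y' (\<lambda>t. f t - g t) t = Y' f t - Y' g t"
      using t by (simp_all add: Y_def Y'_def a_def P Q algebra_simps)
  qed
  then show ?thesis by blast
qed

lemma integral_cos_squared: "((\<lambda>t. cos t * cos t) has_integral pi / 2) {0..pi}"
proof -
  have "((\<lambda>t. cos t * cos t) has_integral (pi + sin pi * cos pi) / 2 - (0 + sin 0 * cos 0) / 2) {0..pi}"
  proof (rule fundamental_theorem_of_calculus)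
    fix t :: real
    have "((\<lambda>t. (t + sin t * cos t) / 2) has_real_derivative (1 + (cos t * cos t - sin t * sin t)) / 2) (at t within {0..pi})"
      by (auto intro!: derivative_eq_intros)
    also have "(1 + (cos t * cos t - sin t * sin t)) / 2 = cos t * cos t"
      using sin_cos_squared_add[of t] by (simp add: power2_eq_square)
    finally show "((\<lambda>t. (t + sin t * cos t) / 2) has_vector_derivative cos t * cos t) (at t within {0..pi})"
      by (simp add: has_real_derivative_iff_has_vector_derivative)
  qed simp
  then show ?thesis by simp
qed

text \<open>
  In an orthonormal eigenbasis of \<open>N\<close> the equation splits into scalar ones.
\<close>

lemma neumann_green_exists:
  fixes N :: "'a::euclidean_space \<Rightarrow> 'a"
  assumes lin: "linear N" and sym: "\<And>x y. x \<bullet> N y = N x \<bullet> y"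
    and nres: "\<And>(k::nat) x. k \<ge> 2 \<Longrightarrow> N x = (real k)\<^sup>2 *\<^sub>R x \<Longrightarrow> x = 0"
  shows "\<exists>Y Y' C. neumann_green N Y Y' C"
proof -
  interpret linear N by (rule lin)
  obtain B l where fin: "finite B" and nB: "\<And>b. b \<in> B \<Longrightarrow> norm b = 1"
    and orth: "\<And>b b'. b \<in> B \<Longrightarrow> b' \<in> B \<Longrightarrow> b \<noteq> b' \<Longrightarrow> b \<bullet> b' = 0"
    and eig: "\<And>b. b \<in> B \<Longrightarrow> N b = l b *\<^sub>R b" and ex: "\<And>x. (\<Sum>b\<in>B. (b \<bullet> x) *\<^sub>R b) = x"
    using symmetric_orthonormal_eigenbasis[OF lin sym] by blast
  have nz: "b \<noteq> 0" if "b \<in> B" for b using nB[OF that] by auto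
  have "\<exists>y y' c. neumann_green (\<lambda>x::real. l b * x) y y' c" if "b \<in> B" for b
  proof (rule scalar_neumann_green)
    fix k :: nat assume "k \<ge> 2"
    then show "l b \<noteq> (real k)\<^sup>2" using nres[of k b] eig[OF that] nz[OF that] by auto
  qed
  then obtain y y' c where G: "\<And>b. b \<in> B \<Longrightarrow> neumann_green (\<lambda>x::real. l b * x) (y b) (y' b) (c b)"
    by metis
  define Y where "Y f t = (\<Sum>b\<in>B. y b (\<lambda>s. b \<bullet> f s) t *\<^sub>R b)" for f t
  define Y' where "Y' f t = (\<Sum>b\<in>B. y' b (\<lambda>s. b \<bullet> f s) t *\<^sub>R b)" for f t
  define C where "C = (\<Sum>b\<in>B. c b) + 1"
  have cpos: "c b > 0" if "b \<in> B" for b using G[OF that] by (simp add: neumann_green_def)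
  have "neumann_green N Y Y' C"
    unfolding neumann_green_def
  proof (intro conjI allI impI ballI)
    show "0 < C" unfolding C_def using cpos by (intro add_nonneg_pos sum_nonneg) (auto intro: less_imp_le)
  next
    fix f :: "real \<Rightarrow> 'a" and t assume f: "continuous_on {0..pi} f" and t: "t \<in> {0..pi}"
    have fb: "continuous_on {0..pi} (\<lambda>s. b \<bullet> f s)" for b by (intro continuous_intros f)
    have d: "(y b (\<lambda>s. b \<bullet> f s) has_vector_derivative y' b (\<lambda>s. b \<bullet> f s) t) (at t within {0..pi})"
      "(y' b (\<lambda>s. b \<bullet> f s) has_vector_derivative b \<bullet> f t - l b * y b (\<lambda>s. b \<bullet> f s) t) (at t within {0..pi})"
      if "b \<in> B" for b
      using G[OF that] fb[of b] t by (auto simp: neumann_green_def)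
    show "(Y f has_vector_derivative Y' f t) (at t within {0..pi})"
      unfolding Y_def Y'_def
      by (intro has_vector_derivative_sum bounded_linear.has_vector_derivative[OF bounded_linear_scaleR_left] d)
    have "(Y' f has_vector_derivative (\<Sum>b\<in>B. (b \<bullet> f t - l b * y b (\<lambda>s. b \<bullet> f s) t) *\<^sub>R b)) (at t within {0..pi})"
      unfolding Y'_def
      by (intro has_vector_derivative_sum bounded_linear.has_vector_derivative[OF bounded_linear_scaleR_left] d)
    also have "(\<Sum>b\<in>B. (b \<bullet> f t - l b * y b (\<lambda>s. b \<bullet> f s) t) *\<^sub>R b) = f t - N (Y f t)"
      by (subst (3) ex[symmetric]) (simp add: Y_def sum scale eig sum_subtractf scaleR_diff_left mult.commute)
    finally show "(Y' f has_vector_derivative f t - N (Y f t)) (at t within {0..pi})" .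
  next
    fix f :: "real \<Rightarrow> 'a" assume f: "continuous_on {0..pi} f"
    have fb: "continuous_on {0..pi} (\<lambda>s. b \<bullet> f s)" for b by (intro continuous_intros f)
    show "Y' f 0 = 0" unfolding Y'_def using G fb by (auto simp: neumann_green_def intro!: sum.neutral)
    have "\<forall>b\<in>B. \<exists>e k. y' b (\<lambda>s. b \<bullet> f s) pi = e + k \<and> l b * e = e \<and> l b * k = 0"
      using G fb by (auto simp: neumann_green_def)
    then obtain e k where ek: "\<And>b. b \<in> B \<Longrightarrow> y' b (\<lambda>s. b \<bullet> f s) pi = e b + k b \<and> l b * e b = e b \<and> l b * k b = 0"
      by metis
    have "Y' f pi = (\<Sum>b\<in>B. e b *\<^sub>R b) + (\<Sum>b\<in>B. k b *\<^sub>R b)"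
      by (simp add: Y'_def ek scaleR_add_left sum.distrib)
    moreover have "N (\<Sum>b\<in>B. e b *\<^sub>R b) = (\<Sum>b\<in>B. e b *\<^sub>R b)"
    proof -
      have "N (\<Sum>b\<in>B. e b *\<^sub>R b) = (\<Sum>b\<in>B. (l b * e b) *\<^sub>R b)" by (simp add: sum scale eig mult.commute)
      also have "\<dots> = (\<Sum>b\<in>B. e b *\<^sub>R b)" using ek by (intro sum.cong refl) metis
      finally show ?thesis .
    qed
    moreover have "N (\<Sum>b\<in>B. k b *\<^sub>R b) = 0"
      using ek by (auto simp: sum scale eig mult.commute intro!: sum.neutral)
    ultimately show "\<exists>e k. Y' f pi = e + k \<and> N e = e \<and> N k = 0" by blast
  next
    fix f :: "real \<Rightarrow> 'a" and M t
    assume f: "continuous_on {0..pi} f" and M: "\<forall>t\<in>{0..pi}. norm (f t) \<le> M" and t: "t \<in> {0..pi}"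
    have fb: "continuous_on {0..pi} (\<lambda>s. b \<bullet> f s)" for b by (intro continuous_intros f)
    have M0: "M \<ge> 0" using M[rule_format, of 0] order_trans[OF norm_ge_zero[of "f 0"]] by auto
    have "\<forall>t\<in>{0..pi}. norm (b \<bullet> f t) \<le> M" if "b \<in> B" for b
      using M nB[OF that] order_trans[OF Cauchy_Schwarz_ineq2[of b]] by simp
    then have yb: "norm (y b (\<lambda>s. b \<bullet> f s) t) \<le> c b * M" "norm (y' b (\<lambda>s. b \<bullet> f s) t) \<le> c b * M"
      if "b \<in> B" for b
      using G[OF that] fb[of b] t that unfolding neumann_green_def by blast+
    have le: "(\<Sum>b\<in>B. c b * M) \<le> C * M" using M0 by (simp add: C_def sum_distrib_right distrib_right)
    show "norm (Y f t) \<le> C * M" unfolding Y_def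
      by (rule order_trans[OF sum_norm_le le]) (use yb nB in auto)
    show "norm (Y' f t) \<le> C * M" unfolding Y'_def
      by (rule order_trans[OF sum_norm_le le]) (use yb nB in auto)
  next
    fix f g :: "real \<Rightarrow> 'a" and t assume f: "continuous_on {0..pi} f" and g: "continuous_on {0..pi} g"
      and t: "t \<in> {0..pi}"
    have "continuous_on {0..pi} (\<lambda>s. b \<bullet> f s)" "continuous_on {0..pi} (\<lambda>s. b \<bullet> g s)" for b
      by (intro continuous_intros f g)+
    then have "y b (\<lambda>s. b \<bullet> f s - b \<bullet> g s) t = y b (\<lambda>s. b \<bullet> f s) t - y b (\<lambda>s. b \<bullet> g s) t"
      "y' b (\<lambda>s. b \<bullet> f s - b \<bullet> g s) t = y' b (\<lambda>s. b \<bullet> f s) t - y' b (\<lambda>s. b \<bullet> g s) t" if "b \<in> B" for b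
      using G[OF that] t unfolding neumann_green_def by blast+
    then show "Y (\<lambda>t. f t - g t) t = Y f t - Y g t" "Y' (\<lambda>t. f t - g t) t = Y' f t - Y' g t"
      by (simp_all add: Y_def Y'_def inner_diff_right scaleR_diff_left sum_subtractf)
  qed
  then show ?thesis by blast
qed

section \<open>Lyapunov--Schmidt reduction\<close>

text \<open>
  The rescaled Newton equation \<open>v'' = - m g(v)\<close>, where \<open>g\<close> is the gradient of \<open>G\<close> and is close to the
  symmetric linear map \<open>N\<close> on the ball of radius 3. The amplitude of the solution is normalised by the
  scaling, so the frequency enters as the unknown factor \<open>m\<close> near \<open>1\<close>.
  
  The factor \<open>m\<close> is prescribed as a function of the solution itself: \<open>m = h'(\<Phi>)\<close> with
  \<open>\<Phi> = \<integral> G(v)\<close> and \<open>h(x) = x - \<kappa> (x - pi/4)\<^sup>2 / 2\<close>. This makes the equation the Euler equation of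
  \<open>h(\<Phi>(v)) - \<integral> |v'|\<^sup>2 / 2\<close> without any side constraint. The number \<open>pi/4\<close> is the value of \<open>\<Phi>\<close> on
  \<open>cos t z\<close> with \<open>|z| = 1\<close> for the linear equation, so the solutions are forced to have amplitude
  near one.
  
  The smallness conditions on \<open>\<kappa>\<close> and \<open>\<delta>\<close> make the reduction below a contraction, with \<open>\<delta>\<close> small
  compared to \<open>\<kappa>\<close> so that the effect of \<open>\<kappa>\<close> on the amplitude dominates the nonlinearity. The two
  conditions with \<open>1 / (200 * L)\<close> add up to a contraction constant \<open>1 / (100 * L)\<close>.
  The last assumption is the trace left by a group of symmetries: \<open>v \<mapsto> k + A v\<close> is an infinitesimal
  isometry that leaves \<open>G\<close> invariant and whose translation part is a given kernel vector. Since paths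
  have norm at most 3, the factor \<open>1 / 12\<close> makes the linear part at most a quarter of \<open>|k|\<close>.
\<close>

locale near_linear_oscillator =
  fixes N g :: "'a::euclidean_space \<Rightarrow> 'a" and G :: "'a \<Rightarrow> real"
    and Y Y' :: "(real \<Rightarrow> 'a) \<Rightarrow> real \<Rightarrow> 'a" and C L \<kappa> \<delta> :: real
  assumes lin: "linear N" and sym: "\<And>x y. x \<bullet> N y = N x \<bullet> y"
    and green: "neumann_green N Y Y' C"
    and L1: "1 \<le> L" and L: "\<And>x. norm (N x) \<le> L * norm x"
    and g0: "g 0 = 0" and G0: "G 0 = 0"
    and g_near: "\<And>u v. norm u \<le> 3 \<Longrightarrow> norm v \<le> 3 \<Longrightarrow> norm (g u - g v - N (u - v)) \<le> \<delta> * norm (u - v)"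
    and G_deriv: "\<And>v. norm v \<le> 3 \<Longrightarrow> (G has_derivative (\<lambda>h. g v \<bullet> h)) (at v)"
    and kappa_pos: "0 < \<kappa>" and kappa1: "19 * pi * L * \<kappa> \<le> 1 / 2"
    and kappa2: "C * (74 * pi * L\<^sup>2 * \<kappa>) \<le> 1 / (200 * L)"
    and delta_nonneg: "0 \<le> \<delta>" and delta1: "\<delta> \<le> \<kappa> / 200" and delta2: "C * \<delta> \<le> 1 / (200 * L)"
    and symmetry: "\<And>k. N k = 0 \<Longrightarrow> \<exists>A. linear A \<and> (\<forall>x. x \<bullet> A x = 0) \<and>
        (\<forall>x. norm (A x) \<le> norm k / 12 * norm x) \<and> (\<forall>v. norm v \<le> 3 \<longrightarrow> g v \<bullet> (k + A v) = 0)"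
begin

sublocale N: linear N by (rule lin)

text \<open>
  Paths are only looked at on the half period \<open>{0..pi}\<close>; the bound 3 leaves room around the paths
  \<open>cos t z\<close> with \<open>|z| \<le> 2\<close>.
\<close>

definition admissible :: "(real \<Rightarrow> 'a) \<Rightarrow> bool" where
  "admissible u \<longleftrightarrow> continuous_on {0..pi} u \<and> (\<forall>t\<in>{0..pi}. norm (u t) \<le> 3)"

definition Phi :: "(real \<Rightarrow> 'a) \<Rightarrow> real" where
  "Phi u = integral {0..pi} (\<lambda>t. G (u t))"

definition multiplier :: "(real \<Rightarrow> 'a) \<Rightarrow> real" where
  "multiplier u = 1 - \<kappa> * (Phi u - pi / 4)"

text \<open>
  The difference between the equation \<open>v'' = - m g(v)\<close> and the linear equation \<open>v'' = - N v\<close>.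
\<close>

definition residual :: "(real \<Rightarrow> 'a) \<Rightarrow> real \<Rightarrow> 'a" where
  "residual u t = N (u t) - multiplier u *\<^sub>R g (u t)"

lemma kappa_small: "\<kappa> \<le> 1 / 100"
proof -
  have "19 * pi * 1 * \<kappa> \<le> 19 * pi * L * \<kappa>" using L1 kappa_pos by (intro mult_right_mono mult_left_mono) auto
  also have "\<dots> \<le> 1/2" by (rule kappa1)
  finally have "19 * pi * \<kappa> \<le> 1/2" by simp
  moreover have "19 * 3 * \<kappa> \<le> 19 * pi * \<kappa>" using kappa_pos pi_gt3 by (intro mult_right_mono) auto
  ultimately show ?thesis by simp
qed

lemma delta_le_1: "\<delta> \<le> 1" using delta1 kappa_small by simp

lemma g_lipschitz:
  assumes "norm u \<le> 3" "norm v \<le> 3"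
  shows "norm (g u - g v) \<le> 2 * L * norm (u - v)"
proof -
  have "norm (g u - g v) \<le> norm (g u - g v - N (u - v)) + norm (N (u - v))"
    by (metis add_diff_cancel_right' diff_add_cancel norm_triangle_ineq)
  also have "\<dots> \<le> \<delta> * norm (u - v) + L * norm (u - v)"
    by (intro add_mono g_near L assms)
  also have "\<dots> \<le> L * norm (u - v) + L * norm (u - v)"
    using delta_le_1 L1 by (intro add_mono mult_right_mono) auto
  finally show ?thesis by simp
qed

lemma g_bound: "norm u \<le> 3 \<Longrightarrow> norm (g u) \<le> 6 * L"
  using order_trans[OF g_lipschitz[of u 0] mult_left_mono[of _ 3 "2 * L"]] L1 by (simp add: g0)

lemma continuous_on_g: "continuous_on (cball 0 3) g"
  by (rule lipschitz_on_continuous_on[of "2 * L"])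
    (use g_lipschitz L1 in \<open>auto intro!: lipschitz_onI simp: dist_norm\<close>)

lemma continuous_on_G: "continuous_on (cball 0 3) G"
  by (rule has_derivative_continuous_on, rule has_derivative_at_withinI, rule G_deriv) simp

lemma G_lipschitz:
  assumes "norm u \<le> 3" "norm v \<le> 3"
  shows "\<bar>G u - G v\<bar> \<le> 6 * L * norm (u - v)"
proof -
  have "norm (G u - G v) \<le> 6 * L * norm (u - v)"
  proof (rule differentiable_bound[of "cball 0 3" G "\<lambda>v h. g v \<bullet> h"])
    fix x :: 'a assume x: "x \<in> cball 0 3"
    then show "(G has_derivative (\<lambda>h. g x \<bullet> h)) (at x within cball 0 3)"
      by (auto intro!: has_derivative_at_withinI G_deriv)
    show "onorm (\<lambda>h. g x \<bullet> h) \<le> 6 * L"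
    proof (rule onorm_bound)
      show "norm (g x \<bullet> h) \<le> 6 * L * norm h" for h
        using Cauchy_Schwarz_ineq2[of "g x" h] g_bound[of x] x
          mult_right_mono[of "norm (g x)" "6 * L" "norm h"] by auto
    qed (use L1 in simp)
  qed (use assms in auto)
  then show ?thesis by simp
qed

lemma G_expansion:
  assumes "norm u \<le> 3" "norm v \<le> 3"
  shows "\<bar>G u - G v - g v \<bullet> (u - v)\<bar> \<le> 2 * L * (norm (u - v))\<^sup>2"
proof -
  let ?r = "norm (u - v)"
  have seg: "norm x \<le> 3 \<and> norm (x - v) \<le> ?r" if "x \<in> closed_segment v u" for x
  proof
    have "closed_segment v u \<subseteq> cball 0 3" using assms by (intro closed_segment_subset) auto
    then show "norm x \<le> 3" using that by auto
    show "norm (x - v) \<le> ?r" using segment_bound(1)[of x v u] that by simp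
  qed
  have "norm ((\<lambda>x. G x - g v \<bullet> x) u - (\<lambda>x. G x - g v \<bullet> x) v) \<le> (2 * L * ?r) * norm (u - v)"
  proof (rule differentiable_bound[of "closed_segment v u" "\<lambda>x. G x - g v \<bullet> x" "\<lambda>x h. g x \<bullet> h - g v \<bullet> h"])
    fix x assume x: "x \<in> closed_segment v u"
    show "((\<lambda>x. G x - g v \<bullet> x) has_derivative (\<lambda>h. g x \<bullet> h - g v \<bullet> h)) (at x within closed_segment v u)"
      using seg[OF x] by (auto intro!: derivative_eq_intros has_derivative_at_withinI[OF G_deriv])
    show "onorm (\<lambda>h. g x \<bullet> h - g v \<bullet> h) \<le> 2 * L * ?r"
    proof (rule onorm_bound)
      fix h
      have "norm (g x \<bullet> h - g v \<bullet> h) \<le> norm (g x - g v) * norm h"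
        by (metis inner_diff_left Cauchy_Schwarz_ineq2 real_norm_def)
      also have "norm (g x - g v) \<le> 2 * L * norm (x - v)"
        using seg[OF x] assms by (intro g_lipschitz) auto
      also have "\<dots> \<le> 2 * L * ?r" using seg[OF x] L1 by (intro mult_left_mono) auto
      finally show "norm (g x \<bullet> h - g v \<bullet> h) \<le> 2 * L * ?r * norm h"
        by (simp add: mult_right_mono)
    qed (use L1 in simp)
  qed auto
  then show ?thesis by (simp add: inner_diff_right power2_eq_square algebra_simps)
qed

lemma G_near_quadratic:
  assumes "norm v \<le> 3"
  shows "\<bar>G v - v \<bullet> N v / 2\<bar> \<le> 9 * \<delta>"
proof -
  have "norm ((\<lambda>x. G x - x \<bullet> N x / 2) v - (\<lambda>x. G x - x \<bullet> N x / 2) 0) \<le> (3 * \<delta>) * norm (v - 0)"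
  proof (rule differentiable_bound[of "cball 0 3" _ "\<lambda>x h. g x \<bullet> h - N x \<bullet> h"])
    fix x :: 'a assume x: "x \<in> cball 0 3"
    have dN: "(N has_derivative N) (at x within cball 0 3)"
      using lin by (simp add: linear_imp_has_derivative)
    have "((\<lambda>x. G x - x \<bullet> N x * (1 / 2)) has_derivative
        (\<lambda>h. g x \<bullet> h - (x \<bullet> N h + h \<bullet> N x) * (1 / 2))) (at x within cball 0 3)"
      using x by (intro has_derivative_diff has_derivative_mult_left has_derivative_inner
          has_derivative_ident dN has_derivative_at_withinI[OF G_deriv]) auto
    then show "((\<lambda>x. G x - x \<bullet> N x / 2) has_derivative (\<lambda>h. g x \<bullet> h - N x \<bullet> h)) (at x within cball 0 3)"
      by (simp add: sym[of x] inner_commute[of _ "N x"])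
    show "onorm (\<lambda>h. g x \<bullet> h - N x \<bullet> h) \<le> 3 * \<delta>"
    proof (rule onorm_bound)
      fix h
      have "norm (g x \<bullet> h - N x \<bullet> h) \<le> norm (g x - N x) * norm h"
        by (metis inner_diff_left Cauchy_Schwarz_ineq2 real_norm_def)
      also have "norm (g x - N x) \<le> \<delta> * norm x"
        using g_near[of x 0] x by (simp add: g0)
      also have "\<dots> \<le> \<delta> * 3" using x delta_nonneg by (intro mult_left_mono) auto
      finally show "norm (g x \<bullet> h - N x \<bullet> h) \<le> 3 * \<delta> * norm h"
        by (simp add: mult_right_mono mult.commute)
    qed (use delta_nonneg in simp)
  qed (use assms in auto)
  also have "(3 * \<delta>) * norm (v - 0) \<le> 3 * \<delta> * 3" using assms delta_nonneg by (intro mult_left_mono) auto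
  finally show ?thesis by (simp add: G0)
qed

lemma admissible_continuous:
  assumes "admissible u"
  shows "continuous_on {0..pi} u" "continuous_on {0..pi} (\<lambda>t. g (u t))" "continuous_on {0..pi} (\<lambda>t. G (u t))"
    "continuous_on {0..pi} (\<lambda>t. N (u t))" "continuous_on {0..pi} (residual u)"
proof -
  show c: "continuous_on {0..pi} u" using assms by (simp add: admissible_def)
  show g: "continuous_on {0..pi} (\<lambda>t. g (u t))"
    by (rule continuous_on_compose2[OF continuous_on_g c]) (use assms in \<open>auto simp: admissible_def\<close>)
  show "continuous_on {0..pi} (\<lambda>t. G (u t))"
    by (rule continuous_on_compose2[OF continuous_on_G c]) (use assms in \<open>auto simp: admissible_def\<close>)
  show n: "continuous_on {0..pi} (\<lambda>t. N (u t))"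
    by (rule linear_continuous_on_compose[OF c lin])
  show "continuous_on {0..pi} (residual u)"
    unfolding residual_def by (intro continuous_intros n g)
qed

lemma Phi_lipschitz:
  assumes u: "admissible u" and v: "admissible v" and d: "\<And>t. t \<in> {0..pi} \<Longrightarrow> norm (u t - v t) \<le> d"
  shows "\<bar>Phi u - Phi v\<bar> \<le> 6 * pi * L * d"
proof -
  have "Phi u - Phi v = integral {0..pi} (\<lambda>t. G (u t) - G (v t))"
    unfolding Phi_def by (intro integral_diff[symmetric] integrable_continuous_interval admissible_continuous u v)
  also have "\<bar>\<dots>\<bar> \<le> (6 * L * d) * pi"
  proof (rule integral_abs_bound)
    fix t assume t: "t \<in> {0..pi}"
    have "\<bar>G (u t) - G (v t)\<bar> \<le> 6 * L * norm (u t - v t)"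
      using u v t by (intro G_lipschitz) (auto simp: admissible_def)
    also have "\<dots> \<le> 6 * L * d" using d[OF t] L1 by (intro mult_left_mono) auto
    finally show "\<bar>G (u t) - G (v t)\<bar> \<le> 6 * L * d" .
  qed (auto intro!: continuous_intros admissible_continuous u v)
  finally show ?thesis by (simp add: mult_ac)
qed

lemma admissible_zero: "admissible (\<lambda>t. 0)"
  by (simp add: admissible_def)

lemma Phi_zero: "Phi (\<lambda>t. 0) = 0" by (simp add: Phi_def G0)

lemma multiplier_near_1:
  assumes "admissible u"
  shows "\<bar>1 - multiplier u\<bar> \<le> 19 * pi * L * \<kappa>"
proof -
  have "\<bar>Phi u\<bar> \<le> 6 * pi * L * 3"
    using Phi_lipschitz[OF assms admissible_zero, of 3] assms by (auto simp: Phi_zero admissible_def)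
  moreover have "pi * 1 \<le> pi * L" using L1 by (intro mult_left_mono) auto
  ultimately have "\<bar>Phi u - pi / 4\<bar> \<le> 19 * pi * L" using pi_gt_zero by linarith
  then have "\<kappa> * \<bar>Phi u - pi / 4\<bar> \<le> \<kappa> * (19 * pi * L)" using kappa_pos by (intro mult_left_mono) auto
  then show ?thesis using kappa_pos by (simp add: multiplier_def abs_mult mult_ac)
qed

lemma multiplier_bounds:
  assumes "admissible u"
  shows "1/2 \<le> multiplier u" "multiplier u \<le> 3/2"
  using multiplier_near_1[OF assms] kappa1 by linarith+

text \<open>
  The residual depends on the path through the nonlinearity \<open>g - N\<close>, which costs \<open>\<delta>\<close>, and through the
  factor \<open>m\<close>, which costs a multiple of \<open>\<kappa>\<close>. Both can be made small.
\<close>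

lemma residual_lipschitz:
  assumes u: "admissible u" and v: "admissible v" and d: "\<And>t. t \<in> {0..pi} \<Longrightarrow> norm (u t - v t) \<le> d"
    and t: "t \<in> {0..pi}"
  shows "norm (residual u t - residual v t) \<le> (\<delta> + 74 * pi * L\<^sup>2 * \<kappa>) * d"
proof -
  have bu: "norm (u t) \<le> 3" and bv: "norm (v t) \<le> 3" using u v t by (auto simp: admissible_def)
  have d0: "d \<ge> 0" using d[OF t] norm_ge_zero[of "u t - v t"] by linarith
  have "residual u t - residual v t = - (g (u t) - g (v t) - N (u t - v t))
      + (1 - multiplier u) *\<^sub>R (g (u t) - g (v t)) + (multiplier v - multiplier u) *\<^sub>R g (v t)"
    by (simp add: residual_def N.diff algebra_simps)
  also have "norm \<dots> \<le> norm (g (u t) - g (v t) - N (u t - v t))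
      + \<bar>1 - multiplier u\<bar> * norm (g (u t) - g (v t)) + \<bar>multiplier v - multiplier u\<bar> * norm (g (v t))"
    by (intro norm_triangle_le add_mono) (auto simp: norm_minus_commute)
  also have "\<dots> \<le> \<delta> * d + (19 * pi * L * \<kappa>) * (2 * L * d) + (\<kappa> * (6 * pi * L * d)) * (6 * L)"
  proof (intro add_mono mult_mono)
    show "norm (g (u t) - g (v t) - N (u t - v t)) \<le> \<delta> * d"
      using g_near[OF bu bv] mult_left_mono[OF d[OF t] delta_nonneg] by linarith
    show "norm (g (u t) - g (v t)) \<le> 2 * L * d"
      using g_lipschitz[OF bu bv] mult_left_mono[OF d[OF t], of "2 * L"] L1 by linarith
    have "multiplier v - multiplier u = \<kappa> * (Phi u - Phi v)" by (simp add: multiplier_def algebra_simps)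
    then show "\<bar>multiplier v - multiplier u\<bar> \<le> \<kappa> * (6 * pi * L * d)"
      using Phi_lipschitz[OF u v d] kappa_pos by (simp add: abs_mult)
  qed (use kappa_pos L1 d0 multiplier_near_1[OF u] g_bound[OF bv] in auto)
  also have "\<dots> = (\<delta> + 74 * pi * L\<^sup>2 * \<kappa>) * d" by (simp add: power2_eq_square algebra_simps)
  finally show ?thesis .
qed

lemma residual_zero: "residual (\<lambda>t. 0) t = 0"
  by (simp add: residual_def g0)

lemma green_residual_lipschitz:
  assumes u: "admissible u" and v: "admissible v" and d: "\<And>t. t \<in> {0..pi} \<Longrightarrow> norm (u t - v t) \<le> d"
    and t: "t \<in> {0..pi}"
  shows "norm (Y (residual u) t - Y (residual v) t) \<le> d / (100 * L)"
    and "norm (Y' (residual u) t - Y' (residual v) t) \<le> d / (100 * L)"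
proof -
  let ?f = "\<lambda>t. residual u t - residual v t"
  let ?\<rho> = "\<delta> + 74 * pi * L\<^sup>2 * \<kappa>"
  have d0: "d \<ge> 0" using d[OF t] norm_ge_zero[of "u t - v t"] by linarith
  have cu: "continuous_on {0..pi} (residual u)" and cv: "continuous_on {0..pi} (residual v)"
    using admissible_continuous u v by auto
  have c: "continuous_on {0..pi} ?f" by (intro continuous_intros cu cv)
  have "\<forall>t\<in>{0..pi}. norm (?f t) \<le> ?\<rho> * d" using residual_lipschitz[OF u v d] by blast
  then have "norm (Y ?f t) \<le> C * (?\<rho> * d)" "norm (Y' ?f t) \<le> C * (?\<rho> * d)"
    using green c t unfolding neumann_green_def by blast+
  moreover have "Y ?f t = Y (residual u) t - Y (residual v) t" "Y' ?f t = Y' (residual u) t - Y' (residual v) t"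
    using green cu cv t unfolding neumann_green_def by blast+
  moreover have "C * (?\<rho> * d) \<le> d / (100 * L)"
  proof -
    have "C * ?\<rho> \<le> 1 / (200 * L) + 1 / (200 * L)" using kappa2 delta2 by (simp add: distrib_left)
    also have "\<dots> = 1 / (100 * L)" by (simp add: field_simps)
    finally have "C * ?\<rho> * d \<le> 1 / (100 * L) * d" using d0 by (rule mult_right_mono)
    then show ?thesis by (simp add: mult.assoc)
  qed
  ultimately show "norm (Y (residual u) t - Y (residual v) t) \<le> d / (100 * L)"
    and "norm (Y' (residual u) t - Y' (residual v) t) \<le> d / (100 * L)" by auto
qed

lemma green_zero:
  assumes t: "t \<in> {0..pi}"
  shows "Y (\<lambda>t. 0) t = 0 \<and> Y' (\<lambda>t. 0) t = 0"
proof -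
  have "continuous_on {0..pi} (\<lambda>t. 0 :: 'a)" by simp
  then have "Y (\<lambda>t. 0 - 0) t = Y (\<lambda>t. 0) t - Y (\<lambda>t. 0) t \<and> Y' (\<lambda>t. 0 - 0) t = Y' (\<lambda>t. 0) t - Y' (\<lambda>t. 0) t"
    using green t unfolding neumann_green_def by blast
  then show ?thesis by simp
qed

lemma green_residual_small:
  assumes u: "admissible u" and t: "t \<in> {0..pi}"
  shows "norm (Y (residual u) t) \<le> 3 / (100 * L)" and "norm (Y' (residual u) t) \<le> 3 / (100 * L)"
proof -
  have z: "residual (\<lambda>t. 0) = (\<lambda>t. 0)" using residual_zero by blast
  show "norm (Y (residual u) t) \<le> 3 / (100 * L)" "norm (Y' (residual u) t) \<le> 3 / (100 * L)"
    using green_residual_lipschitz[OF u admissible_zero _ t, of 3] u green_zero[OF t]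
    by (auto simp: z admissible_def)
qed

lemma L_small: "0 \<le> d \<Longrightarrow> d / (100 * L) \<le> d / 100"
  using L1 by (intro divide_left_mono) auto

lemma continuous_on_green:
  assumes "continuous_on {0..pi} f"
  shows "continuous_on {0..pi} (Y f)" "continuous_on {0..pi} (Y' f)"
proof -
  have "\<forall>t\<in>{0..pi}. (Y f has_vector_derivative Y' f t) (at t within {0..pi}) \<and>
      (Y' f has_vector_derivative f t - N (Y f t)) (at t within {0..pi})"
    using green assms unfolding neumann_green_def by blast
  then show "continuous_on {0..pi} (Y f)" "continuous_on {0..pi} (Y' f)"
    unfolding continuous_on_eq_continuous_within using has_vector_derivative_continuous by blast+
qed

text \<open>
  For a prescribed amplitude \<open>z\<close> in the eigenspace \<open>N z = z\<close>, the equation is solved up to an error in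
  the resonant eigenspaces: the path satisfies the differential equation and \<open>v' 0 = 0\<close> exactly, and
  only \<open>v' pi\<close> may fail to vanish, with value in the eigenspaces of \<open>1\<close> and \<open>0\<close>.
\<close>

definition ls_solution :: "'a \<Rightarrow> (real \<Rightarrow> 'a) \<Rightarrow> bool" where
  "ls_solution z v \<longleftrightarrow> admissible v \<and> (\<forall>t\<in>{0..pi}. v t = cos t *\<^sub>R z + Y (residual v) t)"

definition velocity :: "'a \<Rightarrow> (real \<Rightarrow> 'a) \<Rightarrow> real \<Rightarrow> 'a" where
  "velocity z v t = - sin t *\<^sub>R z + Y' (residual v) t"

lemma norm_cos_scaleR_le: "norm (cos t *\<^sub>R z) \<le> norm z" "norm (sin t *\<^sub>R z) \<le> norm z"
  by (auto intro!: mult_left_le_one_le)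

text \<open>
  Banach's fixed point theorem on the ball of radius 3 in the space of bounded continuous functions;
  paths on \<open>{0..pi}\<close> are extended constantly to the whole line.
\<close>

lemma ls_solution_exists:
  assumes z: "norm z \<le> 2"
  shows "\<exists>v. ls_solution z v"
proof -
  define cl where "cl t = max 0 (min pi t)" for t :: real
  have cl: "cl t \<in> {0..pi}" "t \<in> {0..pi} \<Longrightarrow> cl t = t" for t by (auto simp: cl_def)
  have ccl: "continuous_on UNIV cl" unfolding cl_def by (intro continuous_intros)
  define S where "S = (cball 0 3 :: (real \<Rightarrow>\<^sub>C 'a) set)"
  define T where "T u t = cos (cl t) *\<^sub>R z + Y (residual (apply_bcontfun u)) (cl t)" for u :: "real \<Rightarrow>\<^sub>C 'a" and t
  have adm: "admissible (apply_bcontfun u)" if "u \<in> S" for u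
    unfolding admissible_def using norm_bounded[of u] that
    by (auto simp: S_def intro: order_trans)
  have Tb: "norm (T u t) \<le> 3" if "u \<in> S" for u t
    using norm_triangle_ineq[of "cos (cl t) *\<^sub>R z" "Y (residual (apply_bcontfun u)) (cl t)"]
      norm_cos_scaleR_le(1)[of "cl t" z] z green_residual_small(1)[OF adm[OF that] cl(1)[of t]] L_small[of 3]
    unfolding T_def by linarith
  have Tc: "T u \<in> bcontfun" if "u \<in> S" for u
  proof (rule bcontfun_normI)
    have "continuous_on {0..pi} (Y (residual (apply_bcontfun u)))"
      by (intro continuous_on_green admissible_continuous adm that)
    then have "continuous_on UNIV (\<lambda>t. Y (residual (apply_bcontfun u)) (cl t))"
      by (rule continuous_on_compose2[OF _ ccl]) (use cl(1) in auto)
    then show "continuous_on UNIV (T u)" unfolding T_def by (intro continuous_intros ccl)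
  qed (rule Tb[OF that])
  have ap: "apply_bcontfun (Bcontfun (T u)) = T u" if "u \<in> S" for u
    using Tc[OF that] by (rule Bcontfun_inverse)
  have "\<exists>!u. u \<in> S \<and> Bcontfun (T u) = u"
  proof (rule Banach_fix[where c = "1/100"])
    show "complete S" unfolding S_def by (simp add: complete_eq_closed)
    show "(\<lambda>u. Bcontfun (T u)) ` S \<subseteq> S"
    proof (clarify)
      fix u assume u: "u \<in> S"
      have "norm (Bcontfun (T u)) \<le> 3" by (rule norm_bound) (simp add: ap[OF u] Tb[OF u])
      then show "Bcontfun (T u) \<in> S" by (simp add: S_def)
    qed
    fix u v assume u: "u \<in> S" and v: "v \<in> S"
    show "dist (Bcontfun (T u)) (Bcontfun (T v)) \<le> 1/100 * dist u v"
    proof (rule dist_bound)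
      fix t
      have "dist (Bcontfun (T u) t) (Bcontfun (T v) t) =
          norm (Y (residual (apply_bcontfun u)) (cl t) - Y (residual (apply_bcontfun v)) (cl t))"
        by (simp add: ap u v T_def dist_norm)
      also have "\<dots> \<le> dist u v / (100 * L)"
        using dist_bounded[of u _ v] by (intro green_residual_lipschitz adm u v cl) (simp add: dist_norm)
      finally show "dist (Bcontfun (T u) t) (Bcontfun (T v) t) \<le> 1/100 * dist u v"
        using L_small[of "dist u v"] by simp
    qed
  qed (auto simp: S_def)
  then obtain u where u: "u \<in> S" "Bcontfun (T u) = u" by blast
  then have "apply_bcontfun u t = T u t" for t using ap by metis
  then have "ls_solution z (apply_bcontfun u)"
    unfolding ls_solution_def using adm[OF u(1)] cl(2) by (auto simp: T_def)
  then show ?thesis by blast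
qed

lemma ls_solution_ode:
  assumes E: "N z = z" and v: "ls_solution z v" and t: "t \<in> {0..pi}"
  shows "(v has_vector_derivative velocity z v t) (at t within {0..pi})"
    and "(velocity z v has_vector_derivative - multiplier v *\<^sub>R g (v t)) (at t within {0..pi})"
proof -
  have adm: "admissible v" using v by (simp add: ls_solution_def)
  have YY: "(Y (residual v) has_vector_derivative Y' (residual v) t) (at t within {0..pi})"
    "(Y' (residual v) has_vector_derivative residual v t - N (Y (residual v) t)) (at t within {0..pi})"
    using green admissible_continuous(5)[OF adm] t unfolding neumann_green_def by blast+
  have "((\<lambda>t. cos t *\<^sub>R z + Y (residual v) t) has_vector_derivative velocity z v t) (at t within {0..pi})"
    unfolding velocity_def using YY(1) by (auto intro!: derivative_eq_intros)
  then show "(v has_vector_derivative velocity z v t) (at t within {0..pi})"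
    by (rule has_vector_derivative_transform[rotated 2]) (use v t in \<open>auto simp: ls_solution_def\<close>)
  have "(velocity z v has_vector_derivative (- cos t *\<^sub>R z + (residual v t - N (Y (residual v) t)))) (at t within {0..pi})"
    unfolding velocity_def using YY(2) by (auto intro!: derivative_eq_intros)
  also have "- cos t *\<^sub>R z + (residual v t - N (Y (residual v) t)) = - multiplier v *\<^sub>R g (v t)"
    using v t by (simp add: ls_solution_def residual_def N.add N.scale E)
  finally show "(velocity z v has_vector_derivative - multiplier v *\<^sub>R g (v t)) (at t within {0..pi})" .
qed

lemma ls_solution_close:
  assumes "ls_solution z v" "t \<in> {0..pi}"
  shows "norm (v t - cos t *\<^sub>R z) \<le> 3 / (100 * L)" "norm (velocity z v t) \<le> norm z + 3 / 100"
proof -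
  have adm: "admissible v" using assms by (simp add: ls_solution_def)
  show "norm (v t - cos t *\<^sub>R z) \<le> 3 / (100 * L)"
    using green_residual_small(1)[OF adm assms(2)] assms by (simp add: ls_solution_def)
  show "norm (velocity z v t) \<le> norm z + 3 / 100"
    using green_residual_small(2)[OF adm assms(2)] norm_cos_scaleR_le(2)[of t z] L_small[of 3]
      norm_triangle_ineq[of "- sin t *\<^sub>R z" "Y' (residual v) t"]
    unfolding velocity_def by simp
qed

text \<open>
  Solutions depend on the amplitude in a Lipschitz way, and their difference is \<open>cos t (z2 - z1)\<close> up
  to a small fraction. This replaces differentiability in \<open>z\<close> in the variational argument.
\<close>

lemma ls_solution_lipschitz:
  assumes v1: "ls_solution z1 v1" and v2: "ls_solution z2 v2" and t: "t \<in> {0..pi}"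
  shows "norm (v2 t - v1 t) \<le> 2 * norm (z2 - z1)"
    and "norm (v2 t - v1 t - cos t *\<^sub>R (z2 - z1)) \<le> norm (z2 - z1) / 50"
    and "norm (velocity z2 v2 t - velocity z1 v1 t) \<le> 2 * norm (z2 - z1)"
proof -
  have adm: "admissible v1" "admissible v2" using v1 v2 by (auto simp: ls_solution_def)
  have "continuous_on {0..pi} (\<lambda>t. norm (v2 t - v1 t))"
    by (intro continuous_intros admissible_continuous adm)
  \<comment> \<open>the largest distance \<open>d\<close> satisfies \<open>d \<le> |z2 - z1| + d / 100\<close>\<close>
  from continuous_attains_sup[OF compact_Icc _ this]
  obtain t0 where t0: "t0 \<in> {0..pi}" and max: "\<And>t. t \<in> {0..pi} \<Longrightarrow> norm (v2 t - v1 t) \<le> norm (v2 t0 - v1 t0)"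
    by auto
  define d where "d = norm (v2 t0 - v1 t0)"
  have d0: "d \<ge> 0" by (simp add: d_def)
  have Yd: "norm (Y (residual v2) s - Y (residual v1) s) \<le> d / 100"
    "norm (Y' (residual v2) s - Y' (residual v1) s) \<le> d / 100" if "s \<in> {0..pi}" for s
    using green_residual_lipschitz[OF adm(2,1) max that] L_small[of d] by (auto simp: d_def)
  have diff: "v2 s - v1 s - cos s *\<^sub>R (z2 - z1) = Y (residual v2) s - Y (residual v1) s" if "s \<in> {0..pi}" for s
    using v1 v2 that by (simp add: ls_solution_def algebra_simps)
  have "d \<le> norm (cos t0 *\<^sub>R (z2 - z1)) + norm (Y (residual v2) t0 - Y (residual v1) t0)"
    unfolding d_def diff[OF t0, symmetric] using norm_triangle_ineq[of "cos t0 *\<^sub>R (z2 - z1)" "v2 t0 - v1 t0 - cos t0 *\<^sub>R (z2 - z1)"]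
    by simp
  with norm_cos_scaleR_le(1)[of t0 "z2 - z1"] Yd(1)[OF t0]
  have d: "d \<le> 2 * norm (z2 - z1)" using norm_ge_zero[of "z2 - z1"] by linarith
  show "norm (v2 t - v1 t) \<le> 2 * norm (z2 - z1)" using max[OF t] d by (simp add: d_def)
  show "norm (v2 t - v1 t - cos t *\<^sub>R (z2 - z1)) \<le> norm (z2 - z1) / 50"
    using Yd(1)[OF t] d unfolding diff[OF t] by simp
  have "velocity z2 v2 t - velocity z1 v1 t = - (sin t *\<^sub>R (z2 - z1)) + (Y' (residual v2) t - Y' (residual v1) t)"
    by (simp add: velocity_def algebra_simps)
  then have "norm (velocity z2 v2 t - velocity z1 v1 t)
      \<le> norm (sin t *\<^sub>R (z2 - z1)) + norm (Y' (residual v2) t - Y' (residual v1) t)"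
    by (metis norm_minus_cancel norm_triangle_ineq)
  with norm_cos_scaleR_le(2)[of t "z2 - z1"] Yd(2)[OF t] d norm_ge_zero[of "z2 - z1"]
  show "norm (velocity z2 v2 t - velocity z1 v1 t) \<le> 2 * norm (z2 - z1)" by linarith
qed

end

section \<open>Maximising the action over the amplitudes\<close>

text \<open>
  On the boundary the first-order change of the squared norm decides; inside, continuity.
\<close>

lemma annulus_step:
  fixes z e :: "'a::real_inner"
  assumes z: "1 / 2 \<le> norm z" "norm z \<le> 2"
    and out: "norm z = 2 \<Longrightarrow> e \<bullet> z < 0" and inn: "norm z = 1 / 2 \<Longrightarrow> e \<bullet> z > 0"
  shows "\<exists>r>0. \<forall>s. 0 < s \<longrightarrow> s < r \<longrightarrow> 1 / 2 \<le> norm (z + s *\<^sub>R e) \<and> norm (z + s *\<^sub>R e) \<le> 2"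
proof -
  have sq: "(norm (z + s *\<^sub>R e))\<^sup>2 = (norm z)\<^sup>2 + 2 * s * (e \<bullet> z) + s\<^sup>2 * (norm e)\<^sup>2" for s
    unfolding power2_norm_eq_inner
    by (simp add: inner_add_left inner_add_right inner_commute power2_eq_square algebra_simps)
  have lim: "((\<lambda>s. norm (z + s *\<^sub>R e)) \<longlongrightarrow> norm z) (at_right 0)"
    by (auto intro!: tendsto_eq_intros)
  have upper: "\<forall>\<^sub>F s in at_right 0. norm (z + s *\<^sub>R e) \<le> 2"
  proof (cases "norm z = 2")
    case True
    have "((\<lambda>s. 2 * (e \<bullet> z) + s * (norm e)\<^sup>2) \<longlongrightarrow> 2 * (e \<bullet> z)) (at_right 0)"
      by (auto intro!: tendsto_eq_intros)
    then have "\<forall>\<^sub>F s in at_right 0. 2 * (e \<bullet> z) + s * (norm e)\<^sup>2 < 0"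
      by (rule order_tendstoD) (use out[OF True] in simp)
    then show ?thesis using eventually_at_right_less[of 0]
    proof eventually_elim
      case (elim s)
      have "s * (2 * (e \<bullet> z) + s * (norm e)\<^sup>2) \<le> 0"
        using elim by (intro mult_nonneg_nonpos) auto
      then have "(norm (z + s *\<^sub>R e))\<^sup>2 \<le> 2\<^sup>2" unfolding sq by (simp add: True power2_eq_square algebra_simps)
      then show ?case by (rule power2_le_imp_le) simp
    qed
  next
    case False
    then have "\<forall>\<^sub>F s in at_right 0. norm (z + s *\<^sub>R e) < 2"
      using z by (intro order_tendstoD[OF lim]) auto
    then show ?thesis by eventually_elim simp
  qed
  have lower: "\<forall>\<^sub>F s in at_right 0. 1 / 2 \<le> norm (z + s *\<^sub>R e)"
  proof (cases "norm z = 1 / 2")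
    case True
    show ?thesis using eventually_at_right_less[of 0]
    proof eventually_elim
      case (elim s)
      have "(1 / 2)\<^sup>2 \<le> (norm (z + s *\<^sub>R e))\<^sup>2" unfolding sq using elim inn[OF True] by (simp add: True)
      then show ?case by (rule power2_le_imp_le) simp
    qed
  next
    case False
    then have "\<forall>\<^sub>F s in at_right 0. 1 / 2 < norm (z + s *\<^sub>R e)"
      using z by (intro order_tendstoD[OF lim]) auto
    then show ?thesis by eventually_elim simp
  qed
  from eventually_conj[OF lower upper] show ?thesis
    unfolding eventually_at_right_field by auto
qed

context near_linear_oscillator begin

lemma velocity_boundary:
  assumes v: "ls_solution z v"
  shows "velocity z v 0 = 0" "\<exists>e k. velocity z v pi = e + k \<and> N e = e \<and> N k = 0"
proof -
  have "continuous_on {0..pi} (residual v)" using v by (auto simp: ls_solution_def admissible_continuous)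
  then have "Y' (residual v) 0 = 0" "\<exists>e k. Y' (residual v) pi = e + k \<and> N e = e \<and> N k = 0"
    using green unfolding neumann_green_def by blast+
  then show "velocity z v 0 = 0" "\<exists>e k. velocity z v pi = e + k \<and> N e = e \<and> N k = 0"
    by (auto simp: velocity_def)
qed

lemma eigenspaces_orthogonal: "N e = e \<Longrightarrow> N k = 0 \<Longrightarrow> e \<bullet> k = 0"
  using sym[of e k] by simp

lemma velocity_continuous:
  assumes "N z = z" "ls_solution z v"
  shows "continuous_on {0..pi} (velocity z v)"
  unfolding continuous_on_eq_continuous_within
  using ls_solution_ode(2)[OF assms] has_vector_derivative_continuous by blast

text \<open>
  Noether's theorem: the momentum \<open>v' \<bullet> (k + A v)\<close> of the symmetry is constant, and it vanishes at \<open>0\<close>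
  because \<open>v' 0 = 0\<close>. Evaluated at \<open>pi\<close>, with \<open>k\<close> the kernel part of \<open>v' pi\<close>, it bounds this part by the
  part \<open>e\<close> in the eigenspace of \<open>1\<close>. So it is enough to make \<open>e\<close> vanish.
\<close>

lemma kernel_part_small:
  assumes E: "N z = z" and v: "ls_solution z v"
    and p: "velocity z v pi = e + k" and e: "N e = e" and k: "N k = 0"
  shows "norm k \<le> norm e / 3"
proof -
  let ?w = "velocity z v"
  obtain A where A: "linear A" "\<And>x. x \<bullet> A x = 0" "\<And>x. norm (A x) \<le> norm k / 12 * norm x"
      "\<And>v. norm v \<le> 3 \<Longrightarrow> g v \<bullet> (k + A v) = 0"
    using symmetry[OF k] by blast
  have bA: "bounded_linear A" using A(1) by (simp add: linear_conv_bounded_linear)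
  have adm: "\<And>t. t \<in> {0..pi} \<Longrightarrow> norm (v t) \<le> 3" using v by (auto simp: ls_solution_def admissible_def)
  have "((\<lambda>t. ?w t \<bullet> (k + A (v t))) has_vector_derivative 0) (at t within {0..pi})" if t: "t \<in> {0..pi}" for t
  proof -
    have dA: "((\<lambda>t. k + A (v t)) has_vector_derivative A (?w t)) (at t within {0..pi})"
      using bounded_linear.has_vector_derivative[OF bA ls_solution_ode(1)[OF E v t]]
      by (auto intro!: derivative_eq_intros)
    have "((\<lambda>t. ?w t \<bullet> (k + A (v t))) has_vector_derivative
        (?w t \<bullet> A (?w t) + (- multiplier v *\<^sub>R g (v t)) \<bullet> (k + A (v t)))) (at t within {0..pi})"
      by (rule bounded_bilinear.has_vector_derivative[OF bounded_bilinear_inner ls_solution_ode(2)[OF E v t] dA])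
    also have "?w t \<bullet> A (?w t) + (- multiplier v *\<^sub>R g (v t)) \<bullet> (k + A (v t)) = 0"
      using A(2,4) adm[OF t] by simp
    finally show ?thesis .
  qed
  then have "((\<lambda>t. 0) has_integral ?w pi \<bullet> (k + A (v pi)) - ?w 0 \<bullet> (k + A (v 0))) {0..pi}"
    by (intro fundamental_theorem_of_calculus) auto
  then have "?w pi \<bullet> (k + A (v pi)) - ?w 0 \<bullet> (k + A (v 0)) = 0"
    using has_integral_0 has_integral_unique by blast
  then have "(e + k) \<bullet> (k + A (v pi)) = 0"
    by (simp add: velocity_boundary(1)[OF v] p)
  then have "(norm k)\<^sup>2 = - ((e + k) \<bullet> A (v pi))"
    using eigenspaces_orthogonal[OF e k]
    by (simp add: inner_add_left inner_add_right power2_norm_eq_inner)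
  also have "\<dots> \<le> norm (e + k) * norm (A (v pi))"
    using Cauchy_Schwarz_ineq2[of "e + k" "A (v pi)"] by linarith
  also have "\<dots> \<le> (norm e + norm k) * (norm k / 12 * 3)"
    using adm[of pi] by (intro mult_mono norm_triangle_ineq order_trans[OF A(3)] mult_left_mono) auto
  finally have "norm k * norm k \<le> norm k * ((norm e + norm k) / 4)" by (simp add: power2_eq_square algebra_simps)
  then show ?thesis
    by (cases "norm k = 0") (auto simp: mult_le_cancel_left)
qed

lemma
  assumes E: "N z = z" and v: "ls_solution z v" and z2: "norm z \<le> 2"
  shows Phi_estimate: "\<bar>Phi v - pi * (norm z)\<^sup>2 / 4\<bar> \<le> 61 / 1000 * pi"
    and cos_moment_estimate: "\<bar>integral {0..pi} (\<lambda>t. cos t * (v t \<bullet> z)) - pi * (norm z)\<^sup>2 / 2\<bar> \<le> 3 / 100 * norm z * pi"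
proof -
  have adm: "admissible v" using v by (simp add: ls_solution_def)
  have small: "norm (v t - cos t *\<^sub>R z) \<le> 3 / (100 * L)" "norm (v t - cos t *\<^sub>R z) \<le> 3 / 100" if "t \<in> {0..pi}" for t
    using ls_solution_close(1)[OF v that] L_small[of 3] by auto
  have i2: "((\<lambda>t. c * (cos t * cos t)) has_integral c * (pi / 2)) {0..pi}" for c
    by (rule has_integral_mult_right[OF integral_cos_squared])
  have "\<bar>integral {0..pi} (\<lambda>t. G (v t) - (norm z)\<^sup>2 / 2 * (cos t * cos t))\<bar> \<le> 61 / 1000 * pi"
  proof (rule integral_abs_bound)
    show "continuous_on {0..pi} (\<lambda>t. G (v t) - (norm z)\<^sup>2 / 2 * (cos t * cos t))"
      by (intro continuous_intros admissible_continuous adm)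
    fix t assume t: "t \<in> {0..pi}"
    define r where "r = v t - cos t *\<^sub>R z"
    \<comment> \<open>the terms below contribute \<open>60\<close>, \<open>0.45\<close> and \<open>0.45\<close> thousandths\<close>
    have vr: "v t = cos t *\<^sub>R z + r" by (simp add: r_def)
    have "v t \<bullet> N (v t) / 2 = (norm z)\<^sup>2 / 2 * (cos t * cos t) + (cos t * (z \<bullet> r) + r \<bullet> N r / 2)"
      unfolding vr N.add N.scale E using sym[of z r]
      by (simp add: E inner_add_left inner_add_right power2_norm_eq_inner inner_commute[of r z] algebra_simps)
    moreover have "\<bar>cos t * (z \<bullet> r)\<bar> \<le> 6 / 100"
    proof -
      have "\<bar>cos t * (z \<bullet> r)\<bar> \<le> 1 * (norm z * norm r)"
        unfolding abs_mult by (intro mult_mono Cauchy_Schwarz_ineq2) auto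
      also have "\<dots> \<le> 1 * (2 * (3/100))" using small(2)[OF t] z2 by (intro mult_mono) (auto simp: r_def)
      finally show ?thesis by simp
    qed
    moreover have "\<bar>r \<bullet> N r / 2\<bar> \<le> 45 / 100000"
    proof -
      have "\<bar>r \<bullet> N r\<bar> \<le> norm r * norm (N r)" by (rule Cauchy_Schwarz_ineq2)
      also have "\<dots> \<le> 3 / 100 * (L * (3 / (100 * L)))"
        using small[OF t] L1 by (intro mult_mono order_trans[OF L] mult_left_mono) (auto simp: r_def)
      also have "\<dots> = 9 / 10000" using L1 by simp
      finally show ?thesis by simp
    qed
    moreover have "\<bar>G (v t) - v t \<bullet> N (v t) / 2\<bar> \<le> 9 * \<delta>"
      using adm t by (intro G_near_quadratic) (auto simp: admissible_def)
    moreover have "9 * \<delta> \<le> 45 / 100000" using delta1 kappa_small by simp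
    ultimately show "\<bar>G (v t) - (norm z)\<^sup>2 / 2 * (cos t * cos t)\<bar> \<le> 61 / 1000" by linarith
  qed simp
  moreover have "integral {0..pi} (\<lambda>t. G (v t) - (norm z)\<^sup>2 / 2 * (cos t * cos t)) = Phi v - pi * (norm z)\<^sup>2 / 4"
  proof -
    have "((\<lambda>t. G (v t) - (norm z)\<^sup>2 / 2 * (cos t * cos t)) has_integral Phi v - (norm z)\<^sup>2 / 2 * (pi / 2)) {0..pi}"
      unfolding Phi_def
      by (intro has_integral_diff i2 integrable_integral integrable_continuous_interval admissible_continuous adm)
    then show ?thesis by (simp add: integral_unique mult.commute)
  qed
  ultimately show "\<bar>Phi v - pi * (norm z)\<^sup>2 / 4\<bar> \<le> 61 / 1000 * pi" by simp
  have cvz: "continuous_on {0..pi} (\<lambda>t. cos t * (v t \<bullet> z))"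
    by (intro continuous_intros admissible_continuous adm)
  have "\<bar>integral {0..pi} (\<lambda>t. cos t * (v t \<bullet> z) - (norm z)\<^sup>2 * (cos t * cos t))\<bar> \<le> 3 / 100 * norm z * pi"
  proof (rule integral_abs_bound)
    show "continuous_on {0..pi} (\<lambda>t. cos t * (v t \<bullet> z) - (norm z)\<^sup>2 * (cos t * cos t))"
      by (intro continuous_intros cvz)
    fix t assume t: "t \<in> {0..pi}"
    have "cos t * (v t \<bullet> z) - (norm z)\<^sup>2 * (cos t * cos t) = cos t * ((v t - cos t *\<^sub>R z) \<bullet> z)"
      by (simp add: inner_diff_left power2_norm_eq_inner algebra_simps)
    also have "\<bar>\<dots>\<bar> \<le> 1 * (norm (v t - cos t *\<^sub>R z) * norm z)"
      unfolding abs_mult by (intro mult_mono Cauchy_Schwarz_ineq2) auto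
    also have "\<dots> \<le> 1 * (3 / 100 * norm z)" using small(2)[OF t] by (intro mult_mono) auto
    finally show "\<bar>cos t * (v t \<bullet> z) - (norm z)\<^sup>2 * (cos t * cos t)\<bar> \<le> 3 / 100 * norm z" by simp
  qed simp
  moreover have "integral {0..pi} (\<lambda>t. cos t * (v t \<bullet> z) - (norm z)\<^sup>2 * (cos t * cos t)) =
      integral {0..pi} (\<lambda>t. cos t * (v t \<bullet> z)) - pi * (norm z)\<^sup>2 / 2"
  proof -
    have "((\<lambda>t. cos t * (v t \<bullet> z) - (norm z)\<^sup>2 * (cos t * cos t)) has_integral
        integral {0..pi} (\<lambda>t. cos t * (v t \<bullet> z)) - (norm z)\<^sup>2 * (pi / 2)) {0..pi}"
      by (intro has_integral_diff i2 integrable_integral integrable_continuous_interval cvz)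
    then show ?thesis by (simp add: integral_unique mult.commute)
  qed
  ultimately show "\<bar>integral {0..pi} (\<lambda>t. cos t * (v t \<bullet> z)) - pi * (norm z)\<^sup>2 / 2\<bar> \<le> 3 / 100 * norm z * pi" by simp
qed

text \<open>
  Testing the equation with \<open>cos t z\<close>, a solution of the linear equation: integration by parts leaves
  only the boundary term at \<open>pi\<close>.
\<close>

lemma boundary_velocity_radial:
  assumes E: "N z = z" and v: "ls_solution z v"
  shows "\<bar>velocity z v pi \<bullet> z + (1 - multiplier v) * integral {0..pi} (\<lambda>t. cos t * (v t \<bullet> z))\<bar>
      \<le> 9 / 2 * \<delta> * norm z * pi"
proof -
  let ?w = "velocity z v" and ?m = "multiplier v"
  have adm: "admissible v" using v by (simp add: ls_solution_def)
  have "((\<lambda>t. cos t * (?w t \<bullet> z) + sin t * (v t \<bullet> z)) has_real_derivative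
      cos t * (residual v t \<bullet> z)) (at t within {0..pi})" if t: "t \<in> {0..pi}" for t
  proof -
    have dw: "((\<lambda>t. ?w t \<bullet> z) has_real_derivative (- ?m *\<^sub>R g (v t)) \<bullet> z) (at t within {0..pi})"
      and dv: "((\<lambda>t. v t \<bullet> z) has_real_derivative ?w t \<bullet> z) (at t within {0..pi})"
      unfolding has_real_derivative_iff_has_vector_derivative
      by (intro bounded_linear.has_vector_derivative[OF bounded_linear_inner_left] ls_solution_ode[OF E v t])+
    have "residual v t \<bullet> z = v t \<bullet> z + (- ?m *\<^sub>R g (v t)) \<bullet> z"
      using sym[of "v t" z] by (simp add: residual_def E inner_diff_left)
    then show ?thesis
      by (simp only:) (auto intro!: derivative_eq_intros dw dv simp: algebra_simps)
  qed
  then have "((\<lambda>t. cos t * (residual v t \<bullet> z)) has_integral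
      (cos pi * (?w pi \<bullet> z) + sin pi * (v pi \<bullet> z)) - (cos 0 * (?w 0 \<bullet> z) + sin 0 * (v 0 \<bullet> z))) {0..pi}"
    by (intro fundamental_theorem_of_calculus)
      (auto simp: has_real_derivative_iff_has_vector_derivative)
  then have I: "((\<lambda>t. cos t * (residual v t \<bullet> z)) has_integral - (?w pi \<bullet> z)) {0..pi}"
    by (simp add: velocity_boundary(1)[OF v])
  have cvz: "continuous_on {0..pi} (\<lambda>t. cos t * (v t \<bullet> z))"
    by (intro continuous_intros admissible_continuous adm)
  have "((\<lambda>t. cos t * (residual v t \<bullet> z) - (1 - ?m) * (cos t * (v t \<bullet> z))) has_integral
      - (?w pi \<bullet> z) - (1 - ?m) * integral {0..pi} (\<lambda>t. cos t * (v t \<bullet> z))) {0..pi}"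
    by (intro has_integral_diff I has_integral_mult_right integrable_integral integrable_continuous_interval cvz)
  then have "- (?w pi \<bullet> z) - (1 - ?m) * integral {0..pi} (\<lambda>t. cos t * (v t \<bullet> z)) =
      integral {0..pi} (\<lambda>t. cos t * (residual v t \<bullet> z) - (1 - ?m) * (cos t * (v t \<bullet> z)))"
    by (simp add: integral_unique)
  also have "\<bar>\<dots>\<bar> \<le> 9 / 2 * \<delta> * norm z * pi"
  proof (rule integral_abs_bound)
    show "continuous_on {0..pi} (\<lambda>t. cos t * (residual v t \<bullet> z) - (1 - ?m) * (cos t * (v t \<bullet> z)))"
      by (intro continuous_intros cvz admissible_continuous adm)
    fix t assume t: "t \<in> {0..pi}"
    have v3: "norm (v t) \<le> 3" using adm t by (auto simp: admissible_def)
    have "cos t * (residual v t \<bullet> z) - (1 - ?m) * (cos t * (v t \<bullet> z)) = - ?m * (cos t * ((g (v t) - N (v t)) \<bullet> z))"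
      using sym[of "v t" z] by (simp add: residual_def E inner_diff_left algebra_simps)
    also have "\<bar>\<dots>\<bar> \<le> 3 / 2 * (1 * (3 * \<delta> * norm z))"
      unfolding abs_mult
    proof (intro mult_mono)
      show "\<bar>- ?m\<bar> \<le> 3 / 2" using multiplier_bounds[OF adm] by simp
      have "norm (g (v t) - N (v t)) \<le> \<delta> * norm (v t)" using g_near[OF v3, of 0] by (simp add: g0)
      also have "\<dots> \<le> \<delta> * 3" using v3 delta_nonneg by (intro mult_left_mono)
      finally have "norm (g (v t) - N (v t)) * norm z \<le> \<delta> * 3 * norm z" by (intro mult_right_mono) auto
      then show "\<bar>(g (v t) - N (v t)) \<bullet> z\<bar> \<le> 3 * \<delta> * norm z"
        using Cauchy_Schwarz_ineq2[of "g (v t) - N (v t)" z] by (simp add: mult_ac)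
    qed auto
    finally show "\<bar>cos t * (residual v t \<bullet> z) - (1 - ?m) * (cos t * (v t \<bullet> z))\<bar> \<le> 9 / 2 * \<delta> * norm z" by simp
  qed simp
  finally show ?thesis by linarith
qed

text \<open>
  If the amplitude is too large then \<open>m < 1\<close>, the oscillation is slower than \<open>cos\<close>, and at \<open>pi\<close> the path
  is still moving towards \<open>- z\<close>; if it is too small, the path has already turned back. The numerical
  constants come from \<open>Phi_estimate\<close> and \<open>cos_moment_estimate\<close>.
\<close>

lemma radial_sign:
  assumes E: "N z = z" and v: "ls_solution z v"
  shows "norm z = 2 \<Longrightarrow> velocity z v pi \<bullet> z < 0" and "norm z = 1 / 2 \<Longrightarrow> velocity z v pi \<bullet> z > 0"
proof -
  let ?I = "integral {0..pi} (\<lambda>t. cos t * (v t \<bullet> z))"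
  have m: "1 - multiplier v = \<kappa> * (Phi v - pi / 4)" by (simp add: multiplier_def)
  have pk: "0 < pi * \<kappa>" using kappa_pos by simp
  have dp: "\<delta> * pi \<le> \<kappa> / 200 * pi" using delta1 by (intro mult_right_mono) auto
  have pi2: "3 * (\<kappa> * pi) < pi * (\<kappa> * pi)" using pi_gt3 kappa_pos by (intro mult_strict_right_mono) auto
  {
    assume z: "norm z = 2"
    have "\<bar>Phi v - pi\<bar> \<le> 61 / 1000 * pi" "\<bar>?I - 2 * pi\<bar> \<le> 6 / 100 * pi"
      using Phi_estimate[OF E v] cos_moment_estimate[OF E v] z by (simp_all add: mult.commute)
    then have "Phi v - pi / 4 \<ge> 6 / 10 * pi" "?I \<ge> 19 / 10 * pi"
      using pi_gt_zero by linarith+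
    then have "\<kappa> * (6 / 10 * pi) * (19 / 10 * pi) \<le> (1 - multiplier v) * ?I"
      unfolding m using kappa_pos
      by (intro mult_mono mult_left_mono mult_nonneg_nonneg) (use pi_gt_zero in linarith)+
    moreover have "\<kappa> * (6 / 10 * pi) * (19 / 10 * pi) = 57 / 50 * (pi * (\<kappa> * pi))" by simp
    moreover have "\<bar>velocity z v pi \<bullet> z + (1 - multiplier v) * ?I\<bar> \<le> 9 * (\<delta> * pi)"
      using boundary_velocity_radial[OF E v] z by (simp add: mult_ac)
    moreover have "0 < \<kappa> * pi" "\<kappa> / 200 * pi = \<kappa> * pi / 200" using pk by (simp_all add: mult.commute)
    ultimately show "velocity z v pi \<bullet> z < 0"
      using dp pi2 by linarith
  }
  {
    assume z: "norm z = 1 / 2"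
    have "\<bar>Phi v - pi / 16\<bar> \<le> 61 / 1000 * pi" "\<bar>?I - pi / 8\<bar> \<le> 3 / 200 * pi"
      using Phi_estimate[OF E v] cos_moment_estimate[OF E v] z by (simp_all add: power2_eq_square)
    then have "pi / 4 - Phi v \<ge> 12 / 100 * pi" "?I \<ge> 1 / 10 * pi"
      using pi_gt_zero by linarith+
    then have "\<kappa> * (12 / 100 * pi) * (1 / 10 * pi) \<le> \<kappa> * (pi / 4 - Phi v) * ?I"
      using kappa_pos
      by (intro mult_mono mult_left_mono mult_nonneg_nonneg) (use pi_gt_zero in linarith)+
    moreover have "\<kappa> * (pi / 4 - Phi v) * ?I = - ((1 - multiplier v) * ?I)" unfolding m by (simp add: algebra_simps)
    moreover have "\<kappa> * (12 / 100 * pi) * (1 / 10 * pi) = 12 / 1000 * (pi * (\<kappa> * pi))" by simp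
    moreover have "\<bar>velocity z v pi \<bullet> z + (1 - multiplier v) * ?I\<bar> \<le> 9 / 4 * (\<delta> * pi)"
      using boundary_velocity_radial[OF E v] z by (simp add: mult_ac)
    moreover have "0 < \<kappa> * pi" "\<kappa> / 200 * pi = \<kappa> * pi / 200" using pk by (simp_all add: mult.commute)
    ultimately show "velocity z v pi \<bullet> z > 0"
      using dp pi2 by linarith
  }
qed

text \<open>
  The functional whose Euler equation is \<open>v'' = - m g(v)\<close>.
\<close>

definition psi :: "'a \<Rightarrow> (real \<Rightarrow> 'a) \<Rightarrow> real" where
  "psi z v = Phi v - \<kappa> / 2 * (Phi v - pi / 4)\<^sup>2 - integral {0..pi} (\<lambda>t. velocity z v t \<bullet> velocity z v t) / 2"

definition psi_const :: real where
  "psi_const = 12 * pi * L + 72 * \<kappa> * pi\<^sup>2 * L\<^sup>2 + 2 * pi"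

lemma psi_const_nonneg: "0 \<le> psi_const"
  using L1 kappa_pos by (simp add: psi_const_def)

text \<open>
  First variation of the functional along the reduced family. The paths solve the Euler equation and
  have \<open>v' 0 = 0\<close>, so integration by parts leaves the boundary term at \<open>pi\<close> and a quadratic error.
\<close>

lemma psi_expansion:
  assumes E1: "N z1 = z1" and v1: "ls_solution z1 v1" and E2: "N z2 = z2" and v2: "ls_solution z2 v2"
  shows "psi z2 v2 - psi z1 v1 \<ge> - (velocity z1 v1 pi \<bullet> (v2 pi - v1 pi)) - psi_const * (norm (z2 - z1))\<^sup>2"
proof -
  let ?w1 = "velocity z1 v1" and ?w2 = "velocity z2 v2" and ?m = "multiplier v1" and ?r = "norm (z2 - z1)"
  have a1: "admissible v1" and a2: "admissible v2" using v1 v2 by (auto simp: ls_solution_def)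
  have D: "norm (v2 t - v1 t) \<le> 2 * ?r" "norm (?w2 t - ?w1 t) \<le> 2 * ?r" if "t \<in> {0..pi}" for t
    using ls_solution_lipschitz[OF v1 v2 that] by auto
  have cw1: "continuous_on {0..pi} ?w1" and cw2: "continuous_on {0..pi} ?w2"
    using velocity_continuous[OF E1 v1] velocity_continuous[OF E2 v2] .
  have cI: "continuous_on {0..pi} (\<lambda>t. g (v1 t) \<bullet> (v2 t - v1 t))"
    by (intro continuous_intros admissible_continuous a1 a2)
  define J where "J = integral {0..pi} (\<lambda>t. g (v1 t) \<bullet> (v2 t - v1 t))"
  have hJ: "((\<lambda>t. g (v1 t) \<bullet> (v2 t - v1 t)) has_integral J) {0..pi}"
    unfolding J_def by (intro integrable_integral integrable_continuous_interval cI)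
  have hPhi: "((\<lambda>t. G (v t)) has_integral Phi v) {0..pi}" if "admissible v" for v
    unfolding Phi_def by (intro integrable_integral integrable_continuous_interval admissible_continuous that)
  have "Phi v2 - Phi v1 - J = integral {0..pi} (\<lambda>t. G (v2 t) - G (v1 t) - g (v1 t) \<bullet> (v2 t - v1 t))"
    by (intro integral_unique[symmetric] has_integral_diff hPhi hJ a1 a2)
  also have "\<bar>\<dots>\<bar> \<le> 2 * L * (2 * ?r)\<^sup>2 * pi"
  proof (rule integral_abs_bound)
    show "continuous_on {0..pi} (\<lambda>t. G (v2 t) - G (v1 t) - g (v1 t) \<bullet> (v2 t - v1 t))"
      by (intro continuous_intros cI admissible_continuous a1 a2)
    fix t assume t: "t \<in> {0..pi}"
    have "\<bar>G (v2 t) - G (v1 t) - g (v1 t) \<bullet> (v2 t - v1 t)\<bar> \<le> 2 * L * (norm (v2 t - v1 t))\<^sup>2"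
      using a1 a2 t by (intro G_expansion) (auto simp: admissible_def)
    also have "\<dots> \<le> 2 * L * (2 * ?r)\<^sup>2"
      using D(1)[OF t] L1 by (intro mult_left_mono power_mono) auto
    finally show "\<bar>G (v2 t) - G (v1 t) - g (v1 t) \<bullet> (v2 t - v1 t)\<bar> \<le> 2 * L * (2 * ?r)\<^sup>2" .
  qed simp
  finally have P: "\<bar>Phi v2 - Phi v1 - J\<bar> \<le> 8 * pi * L * ?r\<^sup>2" by (simp add: power_mult_distrib mult_ac)
  have "?m * \<bar>Phi v2 - Phi v1 - J\<bar> \<le> 3 / 2 * (8 * pi * L * ?r\<^sup>2)"
    using multiplier_bounds[OF a1] P by (intro mult_mono) auto
  moreover have "- (?m * \<bar>Phi v2 - Phi v1 - J\<bar>) \<le> ?m * (Phi v2 - Phi v1 - J)"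
    using multiplier_bounds[OF a1] abs_ge_minus_self[of "Phi v2 - Phi v1 - J"]
      mult_left_mono[of "- \<bar>Phi v2 - Phi v1 - J\<bar>" "Phi v2 - Phi v1 - J" ?m] by linarith
  moreover have "?m * (Phi v2 - Phi v1 - J) = ?m * (Phi v2 - Phi v1) - ?m * J"
    by (rule right_diff_distrib)
  moreover have "3 / 2 * (8 * pi * L * ?r\<^sup>2) = 12 * pi * L * ?r\<^sup>2" by simp
  ultimately have mP: "?m * (Phi v2 - Phi v1) \<ge> ?m * J - 12 * pi * L * ?r\<^sup>2" by linarith
  have "\<bar>Phi v2 - Phi v1\<bar> \<le> 6 * pi * L * (2 * ?r)"
    using Phi_lipschitz[OF a2 a1 D(1)] .
  then have "\<bar>Phi v2 - Phi v1\<bar>\<^sup>2 \<le> (6 * pi * L * (2 * ?r))\<^sup>2" by (intro power_mono) auto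
  then have "\<kappa> / 2 * (Phi v2 - Phi v1)\<^sup>2 \<le> \<kappa> / 2 * (6 * pi * L * (2 * ?r))\<^sup>2"
    using kappa_pos by (intro mult_left_mono) auto
  also have "\<dots> = 72 * \<kappa> * pi\<^sup>2 * L\<^sup>2 * ?r\<^sup>2" by (simp add: power_mult_distrib)
  finally have P2: "\<kappa> / 2 * (Phi v2 - Phi v1)\<^sup>2 \<le> 72 * \<kappa> * pi\<^sup>2 * L\<^sup>2 * ?r\<^sup>2" .
  have pot: "(Phi v2 - \<kappa> / 2 * (Phi v2 - pi / 4)\<^sup>2) - (Phi v1 - \<kappa> / 2 * (Phi v1 - pi / 4)\<^sup>2) =
      ?m * (Phi v2 - Phi v1) - \<kappa> / 2 * (Phi v2 - Phi v1)\<^sup>2"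
    by (simp add: multiplier_def power2_eq_square field_simps)
  have cK: "continuous_on {0..pi} (\<lambda>t. ?w1 t \<bullet> (?w2 t - ?w1 t))" by (intro continuous_intros cw1 cw2)
  define K where "K = integral {0..pi} (\<lambda>t. ?w1 t \<bullet> (?w2 t - ?w1 t))"
  have hK: "((\<lambda>t. ?w1 t \<bullet> (?w2 t - ?w1 t)) has_integral K) {0..pi}"
    unfolding K_def by (intro integrable_integral integrable_continuous_interval cK)
  \<comment> \<open>integration by parts; the boundary term at \<open>0\<close> vanishes\<close>
  have i1: "((\<lambda>t. ?w1 t \<bullet> (?w2 t - ?w1 t) + (- ?m *\<^sub>R g (v1 t)) \<bullet> (v2 t - v1 t)) has_integral
      ?w1 pi \<bullet> (v2 pi - v1 pi) - ?w1 0 \<bullet> (v2 0 - v1 0)) {0..pi}"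
  proof (rule fundamental_theorem_of_calculus)
    fix t assume t: "t \<in> {0..pi}"
    show "((\<lambda>t. ?w1 t \<bullet> (v2 t - v1 t)) has_vector_derivative
        ?w1 t \<bullet> (?w2 t - ?w1 t) + (- ?m *\<^sub>R g (v1 t)) \<bullet> (v2 t - v1 t)) (at t within {0..pi})"
      by (intro bounded_bilinear.has_vector_derivative[OF bounded_bilinear_inner]
          has_vector_derivative_diff ls_solution_ode E1 v1 E2 v2 t)
  qed simp
  have i2: "((\<lambda>t. ?w1 t \<bullet> (?w2 t - ?w1 t) + (- ?m) * (g (v1 t) \<bullet> (v2 t - v1 t))) has_integral
      K + (- ?m) * J) {0..pi}"
    by (intro has_integral_add hK has_integral_mult_right hJ)
  have parts: "K = ?w1 pi \<bullet> (v2 pi - v1 pi) + ?m * J"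
    using has_integral_unique[OF i2 i1[unfolded inner_scaleR_left]] velocity_boundary(1)[OF v1] by simp
  have hw: "((\<lambda>t. w t \<bullet> w t) has_integral integral {0..pi} (\<lambda>t. w t \<bullet> w t)) {0..pi}"
    if "continuous_on {0..pi} w" for w :: "real \<Rightarrow> 'a"
    by (intro integrable_integral integrable_continuous_interval continuous_intros that)
  have "integral {0..pi} (\<lambda>t. ?w2 t \<bullet> ?w2 t) - integral {0..pi} (\<lambda>t. ?w1 t \<bullet> ?w1 t) - 2 * K =
      integral {0..pi} (\<lambda>t. ?w2 t \<bullet> ?w2 t - ?w1 t \<bullet> ?w1 t - 2 * (?w1 t \<bullet> (?w2 t - ?w1 t)))"
    by (intro integral_unique[symmetric] has_integral_diff has_integral_mult_right hw hK cw1 cw2)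
  also have "(\<lambda>t. ?w2 t \<bullet> ?w2 t - ?w1 t \<bullet> ?w1 t - 2 * (?w1 t \<bullet> (?w2 t - ?w1 t))) =
      (\<lambda>t. (norm (?w2 t - ?w1 t))\<^sup>2)"
    by (rule ext) (simp add: power2_norm_eq_inner inner_diff_left inner_diff_right inner_commute)
  also have "\<bar>integral {0..pi} (\<lambda>t. (norm (?w2 t - ?w1 t))\<^sup>2)\<bar> \<le> (2 * ?r)\<^sup>2 * pi"
  proof (rule integral_abs_bound)
    show "\<bar>(norm (?w2 t - ?w1 t))\<^sup>2\<bar> \<le> (2 * ?r)\<^sup>2" if "t \<in> {0..pi}" for t
      using power_mono[OF D(2)[OF that], of 2] by simp
  qed (auto intro!: continuous_intros cw1 cw2)
  finally have kin: "integral {0..pi} (\<lambda>t. ?w2 t \<bullet> ?w2 t) / 2 - integral {0..pi} (\<lambda>t. ?w1 t \<bullet> ?w1 t) / 2 \<le> K + 2 * pi * ?r\<^sup>2"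
    by (simp add: power_mult_distrib abs_le_iff mult_ac)
  show ?thesis
    using pot mP P2 parts kin unfolding psi_def psi_const_def by (simp add: algebra_simps)
qed

text \<open>
  Maximise the functional over the annulus \<open>1/2 \<le> |z| \<le> 2\<close> in the eigenspace of \<open>1\<close>. At a maximum point
  \<open>z\<close> let \<open>e\<close> be the part of \<open>v' pi\<close> in this eigenspace. The step \<open>z + s e\<close> stays in the annulus by the
  signs on its boundary, by \<open>radial_sign\<close>. It moves the end point \<open>v pi\<close> by about \<open>- s e\<close>, so by the first variation it
  increases the functional by about \<open>s |e|\<^sup>2\<close>. Hence \<open>e = 0\<close>, and then \<open>v' pi = 0\<close>.
\<close>

theorem brake_orbit_exists:
  assumes "N x = x" "x \<noteq> 0"
  shows "\<exists>z v. N z = z \<and> 1 / 2 \<le> norm z \<and> norm z \<le> 2 \<and> ls_solution z v \<and> velocity z v pi = 0"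
proof -
  define S where "S = {z. N z = z} \<inter> (cball 0 2 \<inter> {z. 1 / 2 \<le> norm z})"
  define sol where "sol z = (SOME v. ls_solution z v)" for z
  have sol: "ls_solution z (sol z)" if "z \<in> S" for z
    unfolding sol_def using that by (intro someI_ex[of "ls_solution z"] ls_solution_exists) (auto simp: S_def)
  have SE: "N z = z" if "z \<in> S" for z using that by (simp add: S_def)
  have comp: "compact S"
  proof -
    have "closed {z. N z = z}"
      by (intro closed_Collect_eq continuous_intros linear_continuous_on linear_conv_bounded_linear[THEN iffD1] lin)
    moreover have "closed {z :: 'a. 1 / 2 \<le> norm z}"
      by (intro closed_Collect_le continuous_intros)
    ultimately show ?thesis
      unfolding S_def by (intro closed_Int_compact compact_Int_closed) auto
  qed
  have "x /\<^sub>R norm x \<in> S" using assms by (simp add: S_def N.scale)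
  then have ne: "S \<noteq> {}" by blast
  define \<psi> where "\<psi> z = psi z (sol z)" for z
  have low: "\<psi> z2 - \<psi> z1 \<ge> - ((6 + 4 * psi_const) * norm (z2 - z1))" if z: "z1 \<in> S" "z2 \<in> S" for z1 z2
  proof -
    have "\<bar>velocity z1 (sol z1) pi \<bullet> (sol z2 pi - sol z1 pi)\<bar> \<le>
        norm (velocity z1 (sol z1) pi) * norm (sol z2 pi - sol z1 pi)" by (rule Cauchy_Schwarz_ineq2)
    also have "\<dots> \<le> 3 * (2 * norm (z2 - z1))"
    proof (intro mult_mono)
      show "norm (velocity z1 (sol z1) pi) \<le> 3"
        using ls_solution_close(2)[OF sol[OF z(1)], of pi] z(1) by (auto simp: S_def)
    qed (use ls_solution_lipschitz(1)[OF sol[OF z(1)] sol[OF z(2)], of pi] in auto)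
    finally have 1: "velocity z1 (sol z1) pi \<bullet> (sol z2 pi - sol z1 pi) \<le> 6 * norm (z2 - z1)" by simp
    have "norm (z2 - z1) \<le> 4" using z norm_triangle_ineq4[of z2 z1] by (simp add: S_def)
    then have "(norm (z2 - z1))\<^sup>2 \<le> 4 * norm (z2 - z1)"
      unfolding power2_eq_square by (intro mult_right_mono) auto
    then have "psi_const * (norm (z2 - z1))\<^sup>2 \<le> psi_const * (4 * norm (z2 - z1))"
      by (intro mult_left_mono psi_const_nonneg)
    with 1 psi_expansion[OF SE[OF z(1)] sol[OF z(1)] SE[OF z(2)] sol[OF z(2)]] show ?thesis
      unfolding \<psi>_def by (simp add: algebra_simps)
  qed
  have "continuous_on S \<psi>"
  proof (rule lipschitz_on_continuous_on[of "6 + 4 * psi_const"], rule lipschitz_onI)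
    fix z1 z2 assume "z1 \<in> S" "z2 \<in> S"
    with low[of z1 z2] low[of z2 z1] show "dist (\<psi> z1) (\<psi> z2) \<le> (6 + 4 * psi_const) * dist z1 z2"
      by (simp add: dist_norm norm_minus_commute[of z1] abs_le_iff)
  qed (use psi_const_nonneg in simp)
  from continuous_attains_sup[OF comp ne this]
  obtain z where z: "z \<in> S" and max: "\<And>y. y \<in> S \<Longrightarrow> \<psi> y \<le> \<psi> z" by blast
  let ?v = "sol z"
  let ?p = "velocity z ?v pi"
  obtain e k where p: "?p = e + k" and e: "N e = e" and k: "N k = 0"
    using velocity_boundary(2)[OF sol[OF z]] by blast
  have ke: "norm k \<le> norm e / 3" by (rule kernel_part_small[OF SE[OF z] sol[OF z] p e k])
  have ek: "e \<bullet> k = 0" "k \<bullet> e = 0" "k \<bullet> z = 0"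
    using eigenspaces_orthogonal[OF e k] eigenspaces_orthogonal[OF SE[OF z] k]
    by (simp_all add: inner_commute[of k])
  have pz: "?p \<bullet> z = e \<bullet> z" by (simp add: p inner_add_left ek)
  obtain r where r: "r > 0" and step: "\<And>s. 0 < s \<Longrightarrow> s < r \<Longrightarrow> 1 / 2 \<le> norm (z + s *\<^sub>R e) \<and> norm (z + s *\<^sub>R e) \<le> 2"
    using annulus_step[of z e] radial_sign[OF SE[OF z] sol[OF z]] z by (auto simp: S_def pz)
  have "(norm e)\<^sup>2 / 2 = 0"
  proof (rule real_linear_le_quadratic_imp_zero[OF _ r])
    fix s assume s: "0 < s" "s < r"
    define y where "y = z + s *\<^sub>R e"
    have y: "y \<in> S" using step[OF s] by (simp add: S_def y_def N.add N.scale e SE[OF z])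
    have yz: "y - z = s *\<^sub>R e" and nyz: "norm (y - z) = s * norm e" using s by (auto simp: y_def)
    let ?d = "sol y pi - sol z pi"
    have "norm (?d - cos pi *\<^sub>R (y - z)) \<le> norm (y - z) / 50"
      using ls_solution_lipschitz(2)[OF sol[OF z] sol[OF y], of pi] by simp
    then have d: "norm (?d + s *\<^sub>R e) \<le> s * norm e / 50" using s by (simp add: yz)
    have pe: "norm ?p \<le> 2 * norm e" using ke norm_triangle_ineq[of e k] norm_ge_zero[of e] unfolding p by linarith
    have "?p \<bullet> ?d = ?p \<bullet> (?d + s *\<^sub>R e) - s * (norm e)\<^sup>2"
      by (simp add: p inner_add_right inner_add_left ek power2_norm_eq_inner)
    also have "\<dots> \<le> 2 * norm e * (s * norm e / 50) - s * (norm e)\<^sup>2"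
    proof -
      have "?p \<bullet> (?d + s *\<^sub>R e) \<le> norm ?p * norm (?d + s *\<^sub>R e)" by (rule norm_cauchy_schwarz)
      also have "\<dots> \<le> 2 * norm e * (s * norm e / 50)" by (intro mult_mono pe d) auto
      finally show ?thesis by simp
    qed
    also have "\<dots> \<le> - (s * ((norm e)\<^sup>2 / 2))"
    proof -
      have "0 \<le> s * (norm e)\<^sup>2" using s by simp
      then show ?thesis by (simp add: power2_eq_square algebra_simps)
    qed
    finally have "s * ((norm e)\<^sup>2 / 2) \<le> - (?p \<bullet> ?d)" by simp
    also have "\<dots> \<le> psi_const * (norm (y - z))\<^sup>2"
      using psi_expansion[OF SE[OF z] sol[OF z] SE[OF y] sol[OF y]] max[OF y] by (simp add: \<psi>_def)
    also have "\<dots> = s\<^sup>2 * (psi_const * (norm e)\<^sup>2)" by (simp add: nyz power_mult_distrib)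
    finally show "s * ((norm e)\<^sup>2 / 2) \<le> s\<^sup>2 * (psi_const * (norm e)\<^sup>2)" .
  qed simp
  then have "?p = 0" using ke by (simp add: p)
  with z sol[OF z] show ?thesis by (auto simp: S_def)
qed

end

section \<open>Periodic continuation and minimal periods\<close>

lemma has_vector_derivative_glue:
  assumes "(f has_vector_derivative d) (at x within {..x})" "(f has_vector_derivative d) (at x within {x..})"
  shows "(f has_vector_derivative d) (at (x::real))"
  using assms unfolding has_vector_derivative_def has_derivative_within
  by (auto intro: Lim_Un_univ)

lemma has_vector_derivative_reflect:
  assumes "(f has_vector_derivative d) (at (- t) within (uminus ` S))"
  shows "((\<lambda>t. f (- t)) has_vector_derivative - d) (at (t::real) within S)"
proof -
  have "(uminus has_vector_derivative (- 1 :: real)) (at t within S)"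
    by (auto intro!: derivative_eq_intros)
  from vector_diff_chain_within[OF this assms] show ?thesis by (simp add: o_def)
qed

text \<open>
  Even continuation across \<open>0\<close>. The condition \<open>w 0 = 0\<close> makes the one-sided derivatives of \<open>v \<bar>t\<bar>\<close> agree.
\<close>

lemma reflection_derivatives:
  fixes v w F :: "real \<Rightarrow> 'a::real_normed_vector" and a :: real
  assumes v: "\<And>t. t \<in> {0..a} \<Longrightarrow> (v has_vector_derivative w t) (at t within {0..a})"
    and w: "\<And>t. t \<in> {0..a} \<Longrightarrow> (w has_vector_derivative F t) (at t within {0..a})"
    and w0: "w 0 = 0" and t: "\<bar>t\<bar> < a"
  shows "((\<lambda>t. v \<bar>t\<bar>) has_vector_derivative (if 0 \<le> t then w t else - w (- t))) (at t)"
    and "((\<lambda>t. if 0 \<le> t then w t else - w (- t)) has_vector_derivative F \<bar>t\<bar>) (at t)"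
proof -
  have within: "(at t within {0..a}) = at t" if "0 < t" "t < a" for t
    using that by (intro at_within_interior) simp
  consider "t > 0" | "t < 0" | "t = 0" by linarith
  then have "((\<lambda>t. v \<bar>t\<bar>) has_vector_derivative (if 0 \<le> t then w t else - w (- t))) (at t) \<and>
    ((\<lambda>t. if 0 \<le> t then w t else - w (- t)) has_vector_derivative F \<bar>t\<bar>) (at t)"
  proof cases
    case 1
    then have "(v has_vector_derivative w t) (at t)" "(w has_vector_derivative F t) (at t)"
      using v[of t] w[of t] t within[of t] by auto
    then show ?thesis using 1
      by (auto intro: has_vector_derivative_transform_within_open[where S = "{0<..}"])
  next
    case 2
    then have "(v has_vector_derivative w (- t)) (at (- t) within (uminus ` UNIV))"
      "(w has_vector_derivative F (- t)) (at (- t) within (uminus ` UNIV))"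
      using v[of "- t"] w[of "- t"] t within[of "- t"] by auto
    note this[THEN has_vector_derivative_reflect]
    then have "((\<lambda>t. v (- t)) has_vector_derivative - w (- t)) (at t)"
      "((\<lambda>t. - w (- t)) has_vector_derivative F (- t)) (at t)"
      using has_vector_derivative_minus by force+
    then show ?thesis using 2
      by (auto intro: has_vector_derivative_transform_within_open[where S = "{..<0}"])
  next
    case 3
    have a: "a > 0" using t 3 by simp
    have 0: "(v has_vector_derivative w 0) (at 0 within {0..a})" "(w has_vector_derivative F 0) (at 0 within {0..a})"
      using v[of 0] w[of 0] a by auto
    have eq: "(at 0 within {0..a}) = (at 0 within {0..})"
      by (rule at_within_nhd[of _ "{..<a}"]) (use a in auto)
    have r: "(v has_vector_derivative 0) (at 0 within {0..})" "(w has_vector_derivative F 0) (at 0 within {0..})"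
      using 0 eq w0 by simp_all
    have im: "uminus ` {..0} = {0::real..}" by (auto simp: image_iff intro: bexI[of _ "- x" for x])
    have l: "((\<lambda>t. v (- t)) has_vector_derivative 0) (at 0 within {..0})"
      "((\<lambda>t. - w (- t)) has_vector_derivative F 0) (at 0 within {..0})"
      using has_vector_derivative_reflect[of v 0 0 "{..0}"]
        has_vector_derivative_minus[OF has_vector_derivative_reflect[of w "F 0" 0 "{..0}"]] r im by auto
    have "((\<lambda>t. v \<bar>t\<bar>) has_vector_derivative 0) (at 0)"
      by (rule has_vector_derivative_glue)
        (auto intro: has_vector_derivative_transform[OF _ _ r(1)] has_vector_derivative_transform[OF _ _ l(1)])
    moreover have "((\<lambda>t. if 0 \<le> t then w t else - w (- t)) has_vector_derivative F 0) (at 0)"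
      by (rule has_vector_derivative_glue)
        (auto simp: w0 intro: has_vector_derivative_transform[OF _ _ r(2)] has_vector_derivative_transform[OF _ _ l(2)])
    ultimately show ?thesis using 3 w0 by simp
  qed
  then show "((\<lambda>t. v \<bar>t\<bar>) has_vector_derivative (if 0 \<le> t then w t else - w (- t))) (at t)"
    and "((\<lambda>t. if 0 \<le> t then w t else - w (- t)) has_vector_derivative F \<bar>t\<bar>) (at t)" by auto
qed

lemma cos_sin_shift_int_pi:
  "cos (of_int j * pi + s) = (if even j then cos s else - cos s)"
  "sin (of_int j * pi + s) = (if even j then sin s else - sin s)"
  by (simp_all add: cos_add sin_add mult.commute[of _ pi])

lemma arccos_cos_shift:
  assumes "\<bar>s\<bar> < pi"
  shows "arccos (cos (of_int j * pi + s)) = (if even j then \<bar>s\<bar> else pi - \<bar>s\<bar>)"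
proof -
  have c: "cos s = cos \<bar>s\<bar>" by simp
  have "arccos (cos \<bar>s\<bar>) = \<bar>s\<bar>" using assms by (intro arccos_cos) auto
  moreover have "arccos (- cos \<bar>s\<bar>) = pi - \<bar>s\<bar>"
    using assms arccos_minus[of "cos \<bar>s\<bar>"] arccos_cos[of "\<bar>s\<bar>"] by simp
  ultimately show ?thesis unfolding cos_sin_shift_int_pi using c by presburger
qed

text \<open>
  The map \<open>t \<mapsto> arccos (cos t)\<close> is the triangle wave that folds the line onto \<open>{0..pi}\<close>. It is a
  reflection at each multiple of \<open>pi\<close>, and the velocity vanishes at both ends, so a solution on
  the half period continues to a solution of period \<open>2 pi\<close> on the whole line.
\<close>

theorem even_periodic_extension:
  fixes v w :: "real \<Rightarrow> 'a::real_normed_vector" and F :: "'a \<Rightarrow> 'a"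
  assumes v: "\<And>t. t \<in> {0..pi} \<Longrightarrow> (v has_vector_derivative w t) (at t within {0..pi})"
    and w: "\<And>t. t \<in> {0..pi} \<Longrightarrow> (w has_vector_derivative F (v t)) (at t within {0..pi})"
    and w0: "w 0 = 0" and wpi: "w pi = 0"
  shows "\<exists>p. \<forall>t. ((\<lambda>t. v (arccos (cos t))) has_vector_derivative p t) (at t) \<and>
    (p has_vector_derivative F (v (arccos (cos t)))) (at t)"
proof -
  \<comment> \<open>the triangle wave is rising where \<open>sin\<close> is positive and falling where it is negative\<close>
  define p where "p t = (if 0 \<le> sin t then w (arccos (cos t)) else - w (arccos (cos t)))" for t
  have "((\<lambda>t. v (arccos (cos t))) has_vector_derivative p t) (at t) \<and>
    (p has_vector_derivative F (v (arccos (cos t)))) (at t)" for t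
  proof -
    define j where "j = \<lfloor>t / pi + 1 / 2\<rfloor>"
    define c where "c = of_int j * pi"
    have "of_int j \<le> t / pi + 1 / 2" "t / pi + 1 / 2 < of_int j + 1"
      unfolding j_def by linarith+
    then have tc: "\<bar>t - c\<bar> < pi" using pi_gt_zero by (simp add: c_def field_simps abs_less_iff)
    let ?v = "if even j then v else (\<lambda>s. v (pi - s))"
    let ?w = "if even j then w else (\<lambda>s. - w (pi - s))"
    let ?P = "\<lambda>s. if 0 \<le> s then ?w s else - ?w (- s)"
    have dv: "(?v has_vector_derivative ?w s) (at s within {0..pi}) \<and>
      (?w has_vector_derivative F (?v s)) (at s within {0..pi})" if s: "s \<in> {0..pi}" for s
    proof (cases "even j")
      case False
      have d: "((\<lambda>s. pi - s) has_vector_derivative - 1) (at s within {0..pi})"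
        by (auto intro!: derivative_eq_intros)
      have im: "(\<lambda>s. pi - s) ` {0..pi} = {0..pi}" by (auto simp: image_iff intro!: bexI[of _ "pi - x" for x])
      have s': "pi - s \<in> {0..pi}" using s by auto
      have "((\<lambda>s. v (pi - s)) has_vector_derivative - w (pi - s)) (at s within {0..pi})"
        "((\<lambda>s. w (pi - s)) has_vector_derivative - F (v (pi - s))) (at s within {0..pi})"
        using vector_diff_chain_within[OF d, of v "w (pi - s)"] v[OF s']
          vector_diff_chain_within[OF d, of w "F (v (pi - s))"] w[OF s'] im by (auto simp: o_def)
      then show ?thesis using False has_vector_derivative_minus by fastforce
    qed (use v w s in auto)
    have w0': "?w 0 = 0" using w0 wpi by simp
    have R: "((\<lambda>s. ?v \<bar>s\<bar>) has_vector_derivative ?P s) (at s)" "(?P has_vector_derivative F (?v \<bar>s\<bar>)) (at s)"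
      if "\<bar>s\<bar> < pi" for s
      using reflection_derivatives[of pi ?v ?w "\<lambda>s. F (?v s)" s] dv w0' that by blast+
    have qeq: "v (arccos (cos (c + s))) = ?v \<bar>s\<bar>" if "\<bar>s\<bar> < pi" for s
      unfolding c_def using arccos_cos_shift[OF that, of j] by simp
    have peq: "p (c + s) = ?P s" if s: "\<bar>s\<bar> < pi" for s
    proof -
      have "s > 0 \<Longrightarrow> sin s > 0" using s by (intro sin_gt_zero) auto
      moreover have "s < 0 \<Longrightarrow> sin s < 0" using s sin_gt_zero[of "- s"] by auto
      ultimately show ?thesis
        unfolding p_def c_def arccos_cos_shift[OF s] cos_sin_shift_int_pi(2)
        by (cases "s = 0"; cases "s > 0") (auto simp: w0 wpi)
    qed
    have sh: "((\<lambda>x. x - c) has_vector_derivative 1) (at t within UNIV)"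
      by (auto intro!: derivative_eq_intros)
    have tr: "range (\<lambda>x. x - c) = UNIV" by (auto intro: surjI[of _ "\<lambda>x. x + c"])
    have "((\<lambda>x. ?v \<bar>x - c\<bar>) has_vector_derivative ?P (t - c)) (at t)"
      "((\<lambda>x. ?P (x - c)) has_vector_derivative F (?v \<bar>t - c\<bar>)) (at t)"
      using vector_diff_chain_within[OF sh, of "\<lambda>s. ?v \<bar>s\<bar>" "?P (t - c)"]
        vector_diff_chain_within[OF sh, of ?P "F (?v \<bar>t - c\<bar>)"] R[OF tc] tr by (simp_all add: o_def)
    note D = this
    have near: "\<bar>x - c\<bar> < pi" if "x \<in> {c - pi<..<c + pi}" for x using that by auto
    have t: "t \<in> {c - pi<..<c + pi}" using tc by (auto simp: abs_less_iff)
    have "((\<lambda>t. v (arccos (cos t))) has_vector_derivative ?P (t - c)) (at t)"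
    proof (rule has_vector_derivative_transform_within_open[OF D(1) _ t])
      show "?v \<bar>x - c\<bar> = v (arccos (cos x))" if "x \<in> {c - pi<..<c + pi}" for x
        using qeq[OF near[OF that]] by simp
    qed simp
    moreover have "(p has_vector_derivative F (?v \<bar>t - c\<bar>)) (at t)"
    proof (rule has_vector_derivative_transform_within_open[OF D(2) _ t])
      show "?P (x - c) = p x" if "x \<in> {c - pi<..<c + pi}" for x
        using peq[OF near[OF that]] by simp
    qed simp
    moreover have "?P (t - c) = p t" "?v \<bar>t - c\<bar> = v (arccos (cos t))"
      using qeq[OF tc] peq[OF tc] by simp_all
    ultimately show ?thesis by simp
  qed
  then show ?thesis by blast
qed

text \<open>
  No number in \<open>{pi / 2..3 * pi / 2}\<close> can be a period, since \<open>cos\<close> is nonpositive there while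
  \<open>q 0\<close> is close to \<open>z\<close>. Any period below \<open>2 pi\<close> has a multiple in this interval, or its difference
  to \<open>2 pi\<close> does.
\<close>

lemma minimal_period_near_cosine:
  fixes q :: "real \<Rightarrow> 'a::real_normed_vector"
  assumes close: "\<And>t. norm (q t - cos t *\<^sub>R z) \<le> e" and e: "2 * e < norm z"
    and per: "\<And>t. q (t + 2 * pi) = q t"
  shows "minimal_period q (2 * pi)"
proof -
  have no: "q R \<noteq> q 0" if "pi / 2 \<le> R" "R \<le> 3 * pi / 2" for R
  proof
    assume eq: "q R = q 0"
    have "cos (R - pi) \<ge> 0" using that by (intro cos_ge_zero) auto
    then have c: "cos R \<le> 0" by (simp add: cos_diff)
    have "norm z * 1 \<le> norm z * (1 - cos R)" using c by (intro mult_left_mono) auto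
    also have "\<dots> = norm ((1 - cos R) *\<^sub>R z)" using c by simp
    also have "(1 - cos R) *\<^sub>R z = (q R - cos R *\<^sub>R z) - (q 0 - cos 0 *\<^sub>R z)"
      by (simp add: eq algebra_simps)
    also have "norm \<dots> \<le> e + e" by (rule order_trans[OF norm_triangle_ineq4 add_mono[OF close close]])
    finally show False using e by simp
  qed
  have small: False if S: "0 < S" "S < pi / 2" and p: "\<And>t. q (t + S) = q t" for S
  proof -
    have mult: "q (real n * S) = q 0" for n
    proof (induction n)
      case (Suc n)
      then show ?case using p[of "real n * S"] by (simp add: distrib_right add.commute)
    qed simp
    obtain n where n: "pi / 2 < real n * S" using S(1) reals_Archimedean3 by blast
    define m where "m = (LEAST n. pi / 2 \<le> real n * S)"
    have m: "pi / 2 \<le> real m * S" unfolding m_def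
      by (rule LeastI[of "\<lambda>n. pi / 2 \<le> real n * S" n]) (use n in simp)
    have "m \<noteq> 0"
    proof
      assume "m = 0"
      with m have "pi / 2 \<le> 0" by simp
      then show False using pi_half_gt_zero by linarith
    qed
    then obtain k where k: "m = Suc k" by (cases m) auto
    have "\<not> pi / 2 \<le> real k * S"
      using not_less_Least[of k "\<lambda>n. pi / 2 \<le> real n * S"] k unfolding m_def[symmetric] by simp
    then have "real m * S \<le> 3 * pi / 2" using S k by (simp add: distrib_right)
    then show False using no[OF m] mult by simp
  qed
  show ?thesis
    unfolding minimal_period_def is_period_def
  proof (intro conjI allI impI)
    fix S assume S: "0 < S \<and> (\<forall>t. q (t + S) = q t)"
    show "2 * pi \<le> S"
    proof (rule ccontr)
      assume "\<not> 2 * pi \<le> S"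
      then consider "S < pi / 2" | "pi / 2 \<le> S" "S \<le> 3 * pi / 2" | "3 * pi / 2 < S" "S < 2 * pi" by linarith
      then show False
      proof cases
        case 1
        then show ?thesis using small S by blast
      next
        case 2
        then show ?thesis using no[of S] S by (metis add_0)
      next
        case 3
        have "q (t + (2 * pi - S)) = q t" for t
          using S per[of t] by (metis add.assoc diff_add_cancel)
        then show ?thesis using small[of "2 * pi - S"] 3 by simp
      qed
    qed
  qed (use per in auto)
qed

section \<open>Potentials of class C2\<close>

lemma C2_on_has_derivative_grad:
  assumes "C2_on U S" "x \<in> S"
  shows "(U has_derivative (\<lambda>h. grad U x \<bullet> h)) (at x)"
proof -
  have d: "(U has_derivative frechet_derivative U (at x)) (at x)"
    using assms frechet_derivative_works by (auto simp: C2_on_def)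
  interpret linear "frechet_derivative U (at x)" using d by (rule has_derivative_linear)
  have "frechet_derivative U (at x) h = grad U x \<bullet> h" for h
  proof -
    have "frechet_derivative U (at x) (\<Sum>i\<in>UNIV. (h $ i) *\<^sub>R axis i 1) = grad U x \<bullet> h"
      by (simp add: sum scale grad_def inner_vec_def mult.commute)
    then show ?thesis by (simp flip: scalar_mult_eq_scaleR add: basis_expansion)
  qed
  then show ?thesis using d by presburger
qed

lemma C2_on_has_derivative_hessian:
  assumes "C2_on U S" "x \<in> S"
  shows "(grad U has_derivative (\<lambda>h. hessian U x *v h)) (at x)"
  using assms jacobian_works by (auto simp: C2_on_def hessian_def)

text \<open>
  Strict differentiability of the gradient. It gives both the smallness of the nonlinearity after
  rescaling and the injectivity of the projection of critical points to the kernel of the Hessian.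
\<close>

lemma C2_on_grad_near_linear:
  assumes C2: "C2_on U S" and "open S" and q: "q \<in> S" and e: "0 < e"
  shows "\<exists>r>0. ball q r \<subseteq> S \<and> (\<forall>a\<in>ball q r. \<forall>b\<in>ball q r.
    norm (grad U a - grad U b - hessian U q *v (a - b)) \<le> e * norm (a - b))"
proof -
  let ?H = "hessian U q"
  define n where "n = real CARD('a)"
  have n: "n > 0" by (simp add: n_def)
  obtain r1 where r1: "r1 > 0" "ball q r1 \<subseteq> S" using assms(2) q open_contains_ball by blast
  have "continuous_on S (hessian U)" using C2 by (simp add: C2_on_def)
  then obtain r2 where r2: "r2 > 0" "\<And>x. x \<in> S \<Longrightarrow> dist x q < r2 \<Longrightarrow> dist (hessian U x) ?H < e / (n * n)"
    using q e n unfolding continuous_on_iff by (metis divide_pos_pos mult_pos_pos)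
  define r where "r = min r1 r2"
  have sub: "ball q r \<subseteq> S" using r1 by (auto simp: r_def)
  have on: "onorm (\<lambda>h. hessian U x *v h - ?H *v h) \<le> e" if x: "x \<in> ball q r" for x
  proof -
    have "\<bar>(hessian U x - ?H) $ i $ j\<bar> \<le> e / (n * n)" for i j
    proof -
      have "\<bar>(hessian U x - ?H) $ i $ j\<bar> \<le> norm ((hessian U x - ?H) $ i)" by (rule component_le_norm_cart)
      also have "\<dots> \<le> norm (hessian U x - ?H)" by (rule Finite_Cartesian_Product.norm_nth_le)
      also have "\<dots> \<le> e / (n * n)"
      proof -
        have "x \<in> S" "dist x q < r2" using x sub by (auto simp: r_def dist_commute)
        then show ?thesis using r2(2)[of x] by (simp add: dist_norm)
      qed
      finally show ?thesis .
    qed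
    from onorm_le_matrix_component[OF this]
    have "onorm ((*v) (hessian U x - ?H)) \<le> n * n * (e / (n * n))" by (simp add: n_def)
    also have "\<dots> = e" using n by simp
    finally have "onorm ((*v) (hessian U x - ?H)) \<le> e" .
    moreover have "(*v) (hessian U x - ?H) = (\<lambda>h. hessian U x *v h - ?H *v h)"
      by (rule ext) (rule matrix_vector_mult_diff_rdistrib)
    ultimately show ?thesis by simp
  qed
  have "norm (grad U a - grad U b - ?H *v (a - b)) \<le> e * norm (a - b)"
    if ab: "a \<in> ball q r" "b \<in> ball q r" for a b
  proof -
    have "norm ((\<lambda>x. grad U x - ?H *v x) a - (\<lambda>x. grad U x - ?H *v x) b) \<le> e * norm (a - b)"
    proof (rule differentiable_bound[of "ball q r" _ "\<lambda>x h. hessian U x *v h - ?H *v h"])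
      fix x assume x: "x \<in> ball q r"
      show "((\<lambda>x. grad U x - ?H *v x) has_derivative (\<lambda>h. hessian U x *v h - ?H *v h)) (at x within ball q r)"
        using x sub
        by (intro has_derivative_diff has_derivative_at_withinI[OF C2_on_has_derivative_hessian[OF C2]]
            bounded_linear_imp_has_derivative matrix_vector_mul_bounded_linear) auto
    qed (use on ab in auto)
    then show ?thesis by (simp add: matrix_vector_mult_diff_distrib algebra_simps)
  qed
  then show ?thesis using sub r1(1) r2(1) by (intro exI[of _ r]) (auto simp: r_def)
qed

lemma second_difference_estimate:
  assumes C2: "C2_on U S" and sub: "ball q r \<subseteq> S"
    and near: "\<And>a b. a \<in> ball q r \<Longrightarrow> b \<in> ball q r \<Longrightarrow>
        norm (grad U a - grad U b - H *v (a - b)) \<le> e * norm (a - b)"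
    and ab: "norm a + norm b < r"
  shows "\<bar>U (q + a + b) - U (q + b) - U (q + a) + U q - (H *v b) \<bullet> a\<bar> \<le> e * norm b * norm a"
proof -
  let ?\<phi> = "\<lambda>x. U (x + b) - U x - (H *v b) \<bullet> x"
  have seg: "x \<in> ball q r \<and> x + b \<in> ball q r" if "x \<in> closed_segment q (q + a)" for x
  proof -
    have "norm (x - q) \<le> norm a" using segment_bound(1)[OF that] by simp
    moreover have "norm (x + b - q) \<le> norm (x - q) + norm b"
      using norm_triangle_ineq[of "x - q" b] by (simp add: algebra_simps)
    ultimately have "norm (x - q) < r" "norm (x + b - q) < r" using ab norm_ge_zero[of b] by linarith+
    then show ?thesis by (simp add: dist_norm norm_minus_commute[of q])
  qed
  have "norm (?\<phi> (q + a) - ?\<phi> q) \<le> (e * norm b) * norm (q + a - q)"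
  proof (rule differentiable_bound[of "closed_segment q (q + a)" ?\<phi>
        "\<lambda>x h. grad U (x + b) \<bullet> h - grad U x \<bullet> h - (H *v b) \<bullet> h"])
    fix x assume x: "x \<in> closed_segment q (q + a)"
    have d: "(U has_derivative (\<lambda>h. grad U x \<bullet> h)) (at x)"
      and d1: "(U has_derivative (\<lambda>h. grad U (x + b) \<bullet> h)) (at (x + b))"
      using seg[OF x] sub by (auto intro!: C2_on_has_derivative_grad[OF C2])
    have sh: "((\<lambda>x. x + b) has_derivative (\<lambda>h. h)) (at x)" by (auto intro!: derivative_eq_intros)
    have d2: "((\<lambda>x. U (x + b)) has_derivative (\<lambda>h. grad U (x + b) \<bullet> h)) (at x)"
      using has_derivative_compose[OF sh d1] by simp
    show "(?\<phi> has_derivative (\<lambda>h. grad U (x + b) \<bullet> h - grad U x \<bullet> h - (H *v b) \<bullet> h))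
        (at x within closed_segment q (q + a))"
      by (rule has_derivative_at_withinI)
        (intro has_derivative_diff d d2 bounded_linear_imp_has_derivative[OF bounded_linear_inner_right])
    show "onorm (\<lambda>h. grad U (x + b) \<bullet> h - grad U x \<bullet> h - (H *v b) \<bullet> h) \<le> e * norm b"
    proof (rule onorm_bound)
      have n: "norm (grad U (x + b) - grad U x - H *v b) \<le> e * norm b"
        using near[of "x + b" x] seg[OF x] by simp
      then show "0 \<le> e * norm b" using norm_ge_zero order_trans by blast
      fix h
      have "norm (grad U (x + b) \<bullet> h - grad U x \<bullet> h - (H *v b) \<bullet> h) \<le>
          norm (grad U (x + b) - grad U x - H *v b) * norm h"
        using Cauchy_Schwarz_ineq2[of "grad U (x + b) - grad U x - H *v b" h] by (simp add: inner_diff_left)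
      also have "\<dots> \<le> e * norm b * norm h" using n by (intro mult_right_mono) auto
      finally show "norm (grad U (x + b) \<bullet> h - grad U x \<bullet> h - (H *v b) \<bullet> h) \<le> e * norm b * norm h" .
    qed
  qed auto
  then show ?thesis by (simp add: inner_add_right algebra_simps)
qed

text \<open>
  The second difference \<open>U (q + a + b) - U (q + b) - U (q + a) + U q\<close> is symmetric in \<open>a\<close> and \<open>b\<close>,
  and it is approximated by the Hessian in both orders.
\<close>

lemma hessian_symmetric:
  assumes C2: "C2_on U S" and "open S" and q: "q \<in> S"
  shows "(hessian U q *v b) \<bullet> a = (hessian U q *v a) \<bullet> b"
proof (rule ccontr)
  let ?H = "hessian U q"
  define d where "d = \<bar>(?H *v b) \<bullet> a - (?H *v a) \<bullet> b\<bar>"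
  assume "(?H *v b) \<bullet> a \<noteq> (?H *v a) \<bullet> b"
  then have d: "d > 0" by (simp add: d_def)
  \<comment> \<open>then the two approximations differ by at most \<open>2 * e * norm a * norm b \<le> d / 2\<close>\<close>
  define e where "e = d / (4 * (norm a * norm b + 1))"
  have p: "norm a * norm b + 1 > 0" by (intro add_nonneg_pos) auto
  then have e: "e > 0" using d by (simp add: e_def)
  obtain r where r: "r > 0" "ball q r \<subseteq> S" and near: "\<And>a b. a \<in> ball q r \<Longrightarrow> b \<in> ball q r \<Longrightarrow>
      norm (grad U a - grad U b - ?H *v (a - b)) \<le> e * norm (a - b)"
    using C2_on_grad_near_linear[OF assms e] by blast
  define s where "s = r / (2 * (norm a + norm b + 1))"
  have p2: "norm a + norm b + 1 > 0" by (intro add_nonneg_pos) auto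
  then have s: "s > 0" using r by (simp add: s_def)
  have "norm a + norm b < 2 * (norm a + norm b + 1)"
    using norm_ge_zero[of a] norm_ge_zero[of b] by (simp add: distrib_left add_nonneg_pos)
  then have "s * (norm a + norm b) < s * (2 * (norm a + norm b + 1))" using s by (rule mult_strict_left_mono)
  also have "\<dots> = r" using p2 by (simp add: s_def)
  finally have sr: "norm (s *\<^sub>R a) + norm (s *\<^sub>R b) < r" using s by (simp add: distrib_left)
  then have sr': "norm (s *\<^sub>R b) + norm (s *\<^sub>R a) < r" by simp
  have D1: "\<bar>U (q + s *\<^sub>R a + s *\<^sub>R b) - U (q + s *\<^sub>R b) - U (q + s *\<^sub>R a) + U q - (?H *v (s *\<^sub>R b)) \<bullet> (s *\<^sub>R a)\<bar>
      \<le> e * norm (s *\<^sub>R b) * norm (s *\<^sub>R a)"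
    by (rule second_difference_estimate[OF C2 r(2) _ sr]) (rule near)
  have D2: "\<bar>U (q + s *\<^sub>R b + s *\<^sub>R a) - U (q + s *\<^sub>R a) - U (q + s *\<^sub>R b) + U q - (?H *v (s *\<^sub>R a)) \<bullet> (s *\<^sub>R b)\<bar>
      \<le> e * norm (s *\<^sub>R a) * norm (s *\<^sub>R b)"
    by (rule second_difference_estimate[OF C2 r(2) _ sr']) (rule near)
  have comm: "q + s *\<^sub>R b + s *\<^sub>R a = q + s *\<^sub>R a + s *\<^sub>R b" by simp
  have "\<bar>(?H *v (s *\<^sub>R b)) \<bullet> (s *\<^sub>R a) - (?H *v (s *\<^sub>R a)) \<bullet> (s *\<^sub>R b)\<bar> \<le>
      e * norm (s *\<^sub>R b) * norm (s *\<^sub>R a) + e * norm (s *\<^sub>R a) * norm (s *\<^sub>R b)"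
    using D1 D2[unfolded comm] by linarith
  also have "(?H *v (s *\<^sub>R b)) \<bullet> (s *\<^sub>R a) - (?H *v (s *\<^sub>R a)) \<bullet> (s *\<^sub>R b) =
      (s * s) * ((?H *v b) \<bullet> a - (?H *v a) \<bullet> b)"
    by (simp add: matrix_vector_mult_scaleR algebra_simps)
  finally have "(s * s) * d \<le> (s * s) * (2 * e * (norm a * norm b))"
    unfolding abs_mult d_def[symmetric] using s by (simp add: algebra_simps)
  then have "d \<le> 2 * e * (norm a * norm b)" using s by simp
  also have "\<dots> \<le> 2 * e * (norm a * norm b + 1)" using e by (intro mult_left_mono) auto
  also have "\<dots> = d / 2"
  proof -
    have "2 * (d / (4 * x)) * x = d / 2" if "x > 0" for x using that by simp
    from this[OF p] show ?thesis by (simp only: e_def)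
  qed
  finally show False using d by simp
qed

lemma has_derivative_along_sequence:
  fixes f :: "'a::real_normed_vector \<Rightarrow> real"
  assumes f: "(f has_derivative f') (at x)" and t: "\<And>n::nat. t n > 0" "t \<longlonglongrightarrow> 0"
    and y: "y \<longlonglongrightarrow> l" and c: "\<And>n. f (x + t n *\<^sub>R y n) = f x"
  shows "f' l = 0"
proof (rule ccontr)
  assume nz: "f' l \<noteq> 0"
  have bl: "bounded_linear f'" using f by (rule has_derivative_bounded_linear)
  interpret bounded_linear f' by (rule bl)
  define e where "e = \<bar>f' l\<bar> / (2 * (norm l + 1))"
  have p: "norm l + 1 > 0" by (intro add_nonneg_pos) auto
  have e: "e > 0" using nz p by (simp add: e_def)
  obtain d where d: "d > 0" "\<And>z. norm (z - x) < d \<Longrightarrow> norm (f z - f x - f' (z - x)) \<le> e * norm (z - x)"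
    using f e unfolding has_derivative_at_alt by blast
  have "(\<lambda>n. norm (t n *\<^sub>R y n)) \<longlonglongrightarrow> norm ((0::real) *\<^sub>R l)" by (intro tendsto_intros t y)
  then have "\<forall>\<^sub>F n in sequentially. norm (t n *\<^sub>R y n) < d" using d(1) by (intro order_tendstoD(2)) auto
  then have "\<forall>\<^sub>F n in sequentially. \<bar>f' (y n)\<bar> \<le> e * norm (y n)"
  proof eventually_elim
    case (elim n)
    then have "\<bar>f' (t n *\<^sub>R y n)\<bar> \<le> e * norm (t n *\<^sub>R y n)" using d(2)[of "x + t n *\<^sub>R y n"] c by simp
    then show ?case using t(1)[of n] by (simp add: scaleR abs_mult)
  qed
  moreover have "(\<lambda>n. \<bar>f' (y n)\<bar>) \<longlonglongrightarrow> \<bar>f' l\<bar>" by (intro tendsto_intros tendsto y)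
  moreover have "(\<lambda>n. e * norm (y n)) \<longlonglongrightarrow> e * norm l" by (intro tendsto_intros y)
  ultimately have "\<bar>f' l\<bar> \<le> e * norm l"
    by (intro tendsto_le[of sequentially "\<lambda>n. e * norm (y n)" _ "\<lambda>n. \<bar>f' (y n)\<bar>"]) auto
  also have "\<dots> \<le> e * (norm l + 1)" using e by simp
  also have "\<dots> = \<bar>f' l\<bar> / 2" 
  proof -
    have "d / (2 * x) * x = d / 2" if "x > 0" for d x :: real using that by simp
    from this[OF p] show ?thesis by (simp only: e_def)
  qed
  finally show False using nz by simp
qed

section \<open>Dimension of locally Euclidean spaces\<close>

lemma chart_homeomorphic_image:
  assumes h: "homeomorphic_maps X Y f g" and c: "chart X d (W, \<phi>)"
  shows "chart Y d (f ` W, \<phi> \<circ> g)"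
proof -
  have W: "openin X W" and P: "openin (Euclidean_space d) (\<phi> ` W)"
    and hp: "homeomorphic_map (subtopology X W) (subtopology (Euclidean_space d) (\<phi> ` W)) \<phi>"
    using c by (auto simp: chart_def)
  have f: "homeomorphic_map X Y f" and g: "homeomorphic_map Y X g"
    and gf: "\<And>x. x \<in> topspace X \<Longrightarrow> g (f x) = x" and fg: "\<And>y. y \<in> topspace Y \<Longrightarrow> f (g y) = y"
    using h by (auto simp: homeomorphic_maps_map)
  have WX: "W \<subseteq> topspace X" using W openin_subset by blast
  have fW: "openin Y (f ` W)" using homeomorphic_map_openness[OF f WX] W by simp
  have gW: "g ` (f ` W) = W" using gf WX by (force simp: image_iff)
  have im: "(\<phi> \<circ> g) ` (f ` W) = \<phi> ` W" by (metis gW image_comp)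
  have "homeomorphic_map (subtopology Y (f ` W)) (subtopology X W) g"
  proof (rule homeomorphic_map_subtopologies[OF g])
    show "g ` (topspace Y \<inter> f ` W) = topspace X \<inter> W"
      using gW openin_subset[OF fW] WX by (simp add: inf.absorb2)
  qed
  from homeomorphic_map_compose[OF this hp] show ?thesis
    unfolding chart_def using fW P im by simp
qed

lemma locally_euclidean_homeomorphic:
  assumes "X homeomorphic_space Y" "locally_euclidean d X"
  shows "locally_euclidean d Y"
  unfolding locally_euclidean_def
proof
  fix y assume y: "y \<in> topspace Y"
  obtain f g where h: "homeomorphic_maps X Y f g" using assms(1) by (auto simp: homeomorphic_space_def)
  then have "g y \<in> topspace X" "f (g y) = y" using y
    by (auto simp: homeomorphic_maps_def continuous_map_def Pi_iff)
  moreover from this obtain W \<phi> where "chart X d (W, \<phi>)" "g y \<in> W"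
    using assms(2) by (auto simp: locally_euclidean_def)
  ultimately show "\<exists>W \<phi>. chart Y d (W, \<phi>) \<and> y \<in> W"
    using chart_homeomorphic_image[OF h] by (metis image_eqI)
qed

lemma chart_parametrization:
  assumes "chart X d (W, \<phi>)"
  obtains \<theta> where "homeomorphic_maps (subtopology X W) (subtopology (Euclidean_space d) (\<phi> ` W)) \<phi> \<theta>"
    "\<And>x. x \<in> W \<Longrightarrow> \<theta> (\<phi> x) = x"
proof -
  have W: "W \<subseteq> topspace X" and hp: "homeomorphic_map (subtopology X W) (subtopology (Euclidean_space d) (\<phi> ` W)) \<phi>"
    using assms openin_subset by (auto simp: chart_def)
  then obtain \<theta> where t: "homeomorphic_maps (subtopology X W) (subtopology (Euclidean_space d) (\<phi> ` W)) \<phi> \<theta>"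
    by (auto simp: homeomorphic_map_maps)
  then show ?thesis using that W by (auto simp: homeomorphic_maps_def inf.absorb2)
qed

text \<open>
  Brouwer's invariance of domain, transported through a chart.
\<close>

lemma invariance_of_domain_chart:
  assumes c: "chart X d (W, \<phi>)" and V: "openin X V" "V \<subseteq> W"
    and f: "continuous_map (subtopology X V) (Euclidean_space d) f" and inj: "inj_on f V"
  shows "openin (Euclidean_space d) (f ` V)"
proof -
  obtain \<theta> where h: "homeomorphic_maps (subtopology X W) (subtopology (Euclidean_space d) (\<phi> ` W)) \<phi> \<theta>"
    and t: "\<And>x. x \<in> W \<Longrightarrow> \<theta> (\<phi> x) = x"
    using chart_parametrization[OF c] by blast
  have W: "openin X W" and P: "openin (Euclidean_space d) (\<phi> ` W)" using c by (auto simp: chart_def)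
  have hp: "homeomorphic_map (subtopology X W) (subtopology (Euclidean_space d) (\<phi> ` W)) \<phi>"
    using h homeomorphic_map_maps by blast
  have "openin (subtopology X W) V" using V openin_open_subtopology[OF W] by simp
  then have "openin (subtopology (Euclidean_space d) (\<phi> ` W)) (\<phi> ` V)"
    using homeomorphic_imp_open_map[OF hp] by (auto simp: open_map_def)
  then have T: "openin (Euclidean_space d) (\<phi> ` V)" using openin_open_subtopology[OF P] by simp
  have ct: "continuous_map (subtopology (Euclidean_space d) (\<phi> ` W)) (subtopology X W) \<theta>"
    using h by (simp add: homeomorphic_maps_def)
  have "continuous_map (subtopology (Euclidean_space d) (\<phi> ` V)) X \<theta>"
    by (rule continuous_map_from_subtopology_mono[OF continuous_map_into_fulltopology[OF ct]]) (use V in auto)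
  then have "continuous_map (subtopology (Euclidean_space d) (\<phi> ` V)) (subtopology X V) \<theta>"
    using t V by (auto simp: continuous_map_in_subtopology)
  from continuous_map_compose[OF this f]
  have "continuous_map (subtopology (Euclidean_space d) (\<phi> ` V)) (Euclidean_space d) (f \<circ> \<theta>)" .
  moreover have "inj_on (f \<circ> \<theta>) (\<phi> ` V)"
    using inj t V by (auto simp: inj_on_def subset_iff)
  ultimately have "openin (Euclidean_space d) ((f \<circ> \<theta>) ` (\<phi> ` V))"
    by (rule invariance_of_domain_Euclidean_space[OF T])
  moreover have "(f \<circ> \<theta>) ` (\<phi> ` V) = f ` V"
    using t V(2) by (force simp: image_iff)
  ultimately show ?thesis by simp
qed

lemma openin_Euclidean_space_line:
  assumes U: "openin (Euclidean_space d) U" and c: "(\<lambda>i. if i < d then a i else 0) \<in> U"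
  shows "\<exists>r>0. \<forall>t. \<bar>t\<bar> < r \<longrightarrow> (\<lambda>i. if i < d then a i + t * v i else 0) \<in> U"
proof -
  let ?l = "\<lambda>t i. if i < d then a i + t * v i else (0::real)"
  have "continuous_map euclideanreal (Euclidean_space d) ?l"
    unfolding continuous_map_componentwise_Euclidean_space
    by (auto intro!: continuous_intros)
  then have "open (?l -` U)"
    using openin_continuous_map_preimage[OF _ U, of euclideanreal ?l] by (simp add: vimage_def)
  moreover have "0 \<in> ?l -` U" using c by (simp cong: if_cong)
  ultimately obtain r where "r > 0" "ball 0 r \<subseteq> ?l -` U" using open_contains_ball by blast
  then show ?thesis by (intro exI[of _ r]) (auto simp: subset_iff dist_norm)
qed

text \<open>
  If \<open>d < e\<close>, a \<open>d\<close>-chart composed with an \<open>e\<close>-chart would give a nonempty open subset of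
  \<open>Euclidean_space e\<close> inside the hyperplane where coordinate \<open>d\<close> vanishes.
\<close>

lemma locally_euclidean_dim_le:
  assumes "locally_euclidean d X" "locally_euclidean e X" "topspace X \<noteq> {}"
  shows "e \<le> d"
proof (rule ccontr)
  assume "\<not> e \<le> d"
  then have de: "d < e" by simp
  obtain x where x: "x \<in> topspace X" using assms(3) by blast
  obtain W \<phi> V \<psi> where c: "chart X d (W, \<phi>)" "x \<in> W" and c': "chart X e (V, \<psi>)" "x \<in> V"
    using assms x unfolding locally_euclidean_def by metis
  have W: "openin X W" and V: "openin X V" using c c' by (auto simp: chart_def)
  have hp: "homeomorphic_map (subtopology X W) (subtopology (Euclidean_space d) (\<phi> ` W)) \<phi>"
    using c by (auto simp: chart_def)
  have inj: "inj_on \<phi> (W \<inter> V)"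
    using homeomorphic_imp_injective_map[OF hp] openin_subset[OF W] by (auto simp: inj_on_def inf.absorb2)
  have im: "\<phi> ` W \<subseteq> topspace (Euclidean_space d)" using c openin_subset by (auto simp: chart_def)
  have cd: "continuous_map (subtopology X (W \<inter> V)) (Euclidean_space d) \<phi>"
    using homeomorphic_imp_continuous_map[OF hp]
    by (metis continuous_map_from_subtopology_mono continuous_map_into_fulltopology inf_le1)
  have E: "Euclidean_space d = subtopology (Euclidean_space e) (topspace (Euclidean_space d))"
    using de by (auto simp: Euclidean_space_def subtopology_subtopology topspace_Euclidean_space intro: arg_cong)
  have "continuous_map (subtopology X (W \<inter> V)) (Euclidean_space e) \<phi>"
    using cd E by (metis continuous_map_into_fulltopology)
  then have op: "openin (Euclidean_space e) (\<phi> ` (W \<inter> V))"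
    using W V inj by (intro invariance_of_domain_chart[OF c'(1)]) auto
  have y: "\<phi> x \<in> topspace (Euclidean_space d)" using im c by auto
  then have "(\<lambda>i. if i < e then \<phi> x i else 0) = \<phi> x"
    using de by (auto simp: topspace_Euclidean_space)
  then obtain r where r: "r > 0" "\<And>t. \<bar>t\<bar> < r \<Longrightarrow>
      (\<lambda>i. if i < e then \<phi> x i + t * (if i = d then 1 else 0) else 0) \<in> \<phi> ` (W \<inter> V)"
    using openin_Euclidean_space_line[OF op, of "\<phi> x" "\<lambda>i. if i = d then 1 else 0"] c c' by auto
  have "(\<lambda>i. if i < e then \<phi> x i + (r / 2) * (if i = d then 1 else 0) else 0) \<in> topspace (Euclidean_space d)"
    using r(2)[of "r / 2"] r(1) im by auto
  then have "\<phi> x d + r / 2 = 0" using de by (auto simp: topspace_Euclidean_space)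
  moreover have "\<phi> x d = 0" using y by (auto simp: topspace_Euclidean_space)
  ultimately show False using r(1) by simp
qed

lemma manifold_dim_eq:
  assumes "locally_euclidean d X" "topspace X \<noteq> {}"
  shows "manifold_dim X = d"
  unfolding manifold_dim_def using assms locally_euclidean_dim_le
  by (intro the_equality) (auto intro: antisym)

lemma lie_group_locally_euclidean:
  assumes "lie_group \<Gamma> X"
  shows "\<exists>d. locally_euclidean d X"
proof -
  obtain d A where "smooth_atlas X d A" using assms by (auto simp: lie_group_def)
  then have ch: "\<forall>c\<in>A. chart X d c" and cov: "\<Union>(fst ` A) = topspace X" by (auto simp: smooth_atlas_def)
  have "locally_euclidean d X"
    unfolding locally_euclidean_def
  proof
    fix x assume "x \<in> topspace X"
    then have "x \<in> \<Union>(fst ` A)" using cov by simp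
    then obtain c where "c \<in> A" "x \<in> fst c" by blast
    then show "\<exists>W \<phi>. chart X d (W, \<phi>) \<and> x \<in> W" using ch by (cases c) auto
  qed
  then show ?thesis by blast
qed

section \<open>Infinitesimal symmetries at a critical orbit\<close>


lemma kernel_complement_bound:
  fixes H :: "real^'n^'n"
  shows "\<exists>m>0. \<forall>x. (\<forall>k. H *v k = 0 \<longrightarrow> k \<bullet> x = 0) \<longrightarrow> m * norm x \<le> norm (H *v x)"
proof -
  define S where "S = {x. \<forall>k. H *v k = 0 \<longrightarrow> k \<bullet> x = 0}"
  have S: "subspace S" by (auto simp: S_def subspace_def inner_add_right)
  have "\<forall>x\<in>S. H *v x = 0 \<longrightarrow> x = 0" by (auto simp: S_def)
  from injective_imp_isometric[OF closed_subspace[OF S] S matrix_vector_mul_bounded_linear this]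
  show ?thesis unfolding S_def by (simp add: mult.commute)
qed

text \<open>
  A critical point with trivial isotropy of an invariant potential, whose Hessian has a kernel of the
  dimension of the orbit. The results below turn this topological condition into infinitesimal
  information: every kernel vector is the velocity at \<open>q0\<close> of an infinitesimal isometry that preserves
  the potential.
\<close>

locale free_invariant_potential =
  fixes \<Gamma> :: "('g, 'h) monoid_scheme" and X :: "'g topology"
    and \<rho> :: "'g \<Rightarrow> real^'n \<Rightarrow> real^'n"
    and \<Omega> :: "(real^'n) set" and U :: "real^'n \<Rightarrow> real" and q0 :: "real^'n"
  assumes lie: "lie_group \<Gamma> X" and comp: "compact_space X"
    and rep: "orthogonal_representation \<Gamma> X \<rho>"
    and open_\<Omega>: "open \<Omega>" and \<Omega>_inv: "\<forall>\<gamma>\<in>carrier \<Gamma>. \<forall>x\<in>\<Omega>. \<rho> \<gamma> x \<in> \<Omega>"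
    and C2: "C2_on U \<Omega>" and U_inv: "\<forall>\<gamma>\<in>carrier \<Gamma>. \<forall>x\<in>\<Omega>. U (\<rho> \<gamma> x) = U x"
    and q0: "q0 \<in> \<Omega>" and crit: "grad U q0 = 0"
    and free: "stabilizer \<Gamma> \<rho> q0 = {\<one>\<^bsub>\<Gamma>\<^esub>}"
    and dim_ker: "dim {v. hessian U q0 *v v = 0} = manifold_dim (top_of_set (orbit \<Gamma> \<rho> q0))"
begin

sublocale \<Gamma>: group \<Gamma> using lie by (simp add: lie_group_def)

abbreviation H where "H \<equiv> hessian U q0"

lemma topspace_X: "topspace X = carrier \<Gamma>" using lie by (simp add: lie_group_def)

lemma action_mult: "g \<in> carrier \<Gamma> \<Longrightarrow> h \<in> carrier \<Gamma> \<Longrightarrow> \<rho> (g \<otimes>\<^bsub>\<Gamma>\<^esub> h) x = \<rho> g (\<rho> h x)"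
  using rep group_action.composition_rule[of \<Gamma> UNIV \<rho> x g h]
  by (simp add: orthogonal_representation_def)

lemma action_one: "\<rho> \<one>\<^bsub>\<Gamma>\<^esub> x = x"
  using rep group_action.id_eq_one[of \<Gamma> UNIV \<rho>]
  by (auto simp: orthogonal_representation_def restrict_def fun_eq_iff)

lemma action_orthogonal: "g \<in> carrier \<Gamma> \<Longrightarrow> orthogonal_transformation (\<rho> g)"
  using rep by (simp add: orthogonal_representation_def)

lemma action_linear: "g \<in> carrier \<Gamma> \<Longrightarrow> linear (\<rho> g)"
  using action_orthogonal by (simp add: orthogonal_transformation)

lemma action_norm: "g \<in> carrier \<Gamma> \<Longrightarrow> norm (\<rho> g x) = norm x"
  using action_orthogonal by (simp add: orthogonal_transformation)

lemma action_dist: "g \<in> carrier \<Gamma> \<Longrightarrow> norm (\<rho> g x - \<rho> g y) = norm (x - y)"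
  using action_norm[of g "x - y"] linear_diff[OF action_linear[of g]] by simp

lemma action_continuous: "continuous_map X euclidean (\<lambda>g. \<rho> g x)"
proof -
  have "continuous_map X (prod_topology X euclidean) (\<lambda>g. (g, x))"
    by (intro continuous_map_pairedI continuous_intros) auto
  from continuous_map_compose[OF this] rep show ?thesis
    by (fastforce simp: orthogonal_representation_def o_def)
qed

lemma orbit_eq: "orbit \<Gamma> \<rho> q0 = (\<lambda>g. \<rho> g q0) ` carrier \<Gamma>"
  by (auto simp: orbit_def)

lemma free_eq_one: "g \<in> carrier \<Gamma> \<Longrightarrow> \<rho> g q0 = q0 \<Longrightarrow> g = \<one>\<^bsub>\<Gamma>\<^esub>"
  using free by (auto simp: stabilizer_def)

lemma orbit_map_inj: "inj_on (\<lambda>g. \<rho> g q0) (carrier \<Gamma>)"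
proof (rule inj_onI)
  fix g h assume g: "g \<in> carrier \<Gamma>" and h: "h \<in> carrier \<Gamma>" and eq: "\<rho> g q0 = \<rho> h q0"
  have "\<rho> (inv\<^bsub>\<Gamma>\<^esub> h) (\<rho> h q0) = q0"
    using h action_mult[of "inv\<^bsub>\<Gamma>\<^esub> h" h q0] by (simp add: action_one)
  then have "\<rho> (inv\<^bsub>\<Gamma>\<^esub> h \<otimes>\<^bsub>\<Gamma>\<^esub> g) q0 = q0" using g h eq by (simp add: action_mult)
  then have "inv\<^bsub>\<Gamma>\<^esub> h \<otimes>\<^bsub>\<Gamma>\<^esub> g = \<one>\<^bsub>\<Gamma>\<^esub>" using g h by (intro free_eq_one) auto
  moreover have "h \<otimes>\<^bsub>\<Gamma>\<^esub> (inv\<^bsub>\<Gamma>\<^esub> h \<otimes>\<^bsub>\<Gamma>\<^esub> g) = g" using g h by (simp add: \<Gamma>.m_assoc[symmetric])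
  ultimately show "g = h" using h by simp
qed

lemma orbit_homeomorphic: "homeomorphic_map X (top_of_set (orbit \<Gamma> \<rho> q0)) (\<lambda>g. \<rho> g q0)"
proof (rule continuous_imp_homeomorphic_map)
  show "continuous_map X (top_of_set (orbit \<Gamma> \<rho> q0)) (\<lambda>g. \<rho> g q0)"
    using action_continuous[of q0] by (auto simp: continuous_map_in_subtopology orbit_eq topspace_X)
qed (use comp orbit_map_inj in \<open>auto simp: orbit_eq topspace_X Hausdorff_space_subtopology\<close>)

lemma q0_in_orbit: "q0 \<in> orbit \<Gamma> \<rho> q0"
  using action_one[of q0] by (force simp: orbit_eq)

lemma compact_orbit: "compact (orbit \<Gamma> \<rho> q0)"
proof -
  have "compactin euclidean ((\<lambda>g. \<rho> g q0) ` topspace X)"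
    using comp action_continuous[of q0] image_compactin unfolding compact_space_def by blast
  then show ?thesis by (simp add: orbit_eq topspace_X)
qed

text \<open>
  The group is compact and the isotropy trivial, so the orbit is homeomorphic to the group.
\<close>

lemma orbit_locally_euclidean:
  "locally_euclidean (dim {v. H *v v = 0}) (top_of_set (orbit \<Gamma> \<rho> q0))"
proof -
  obtain d where "locally_euclidean d X" using lie_group_locally_euclidean[OF lie] by blast
  moreover have "X homeomorphic_space top_of_set (orbit \<Gamma> \<rho> q0)"
    using orbit_homeomorphic homeomorphic_map_imp_homeomorphic_space by blast
  ultimately have d: "locally_euclidean d (top_of_set (orbit \<Gamma> \<rho> q0))"
    using locally_euclidean_homeomorphic by blast
  moreover have "manifold_dim (top_of_set (orbit \<Gamma> \<rho> q0)) = d"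
    using manifold_dim_eq[OF d] q0_in_orbit by auto
  ultimately show ?thesis by (simp add: dim_ker)
qed

lemma grad_equivariant:
  assumes g: "g \<in> carrier \<Gamma>" and x: "x \<in> \<Omega>"
  shows "grad U (\<rho> g x) \<bullet> \<rho> g h = grad U x \<bullet> h"
proof -
  have l: "(\<rho> g has_derivative \<rho> g) (at x)"
    using action_linear[OF g] by (simp add: linear_imp_has_derivative)
  have "(U has_derivative (\<lambda>h. grad U (\<rho> g x) \<bullet> h)) (at (\<rho> g x))"
    using \<Omega>_inv g x by (intro C2_on_has_derivative_grad[OF C2]) auto
  from has_derivative_compose[OF l this]
  have "((\<lambda>x. U (\<rho> g x)) has_derivative (\<lambda>h. grad U (\<rho> g x) \<bullet> \<rho> g h)) (at x)" .
  then have "(U has_derivative (\<lambda>h. grad U (\<rho> g x) \<bullet> \<rho> g h)) (at x)"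
    by (rule has_derivative_transform_within_open[OF _ open_\<Omega> x]) (use U_inv g in auto)
  from has_derivative_unique[OF this C2_on_has_derivative_grad[OF C2 x]] show ?thesis by meson
qed

lemma orbit_critical:
  assumes "a \<in> orbit \<Gamma> \<rho> q0"
  shows "grad U a = 0" and "a \<in> \<Omega>"
proof -
  obtain g where g: "g \<in> carrier \<Gamma>" "a = \<rho> g q0" using assms by (auto simp: orbit_eq)
  show "a \<in> \<Omega>" using g \<Omega>_inv q0 by auto
  have "surj (\<rho> g)" using action_orthogonal[OF g(1)] by (rule orthogonal_transformation_surj)
  then obtain h where "\<rho> g h = grad U a" by (metis surjD)
  then have "grad U a \<bullet> grad U a = grad U q0 \<bullet> h"
    using grad_equivariant[OF g(1) q0, of h] g(2) by simp
  then show "grad U a = 0" by (simp add: crit)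
qed

text \<open>
  The gradient vanishes at any two points of the orbit, so by strict differentiability the Hessian
  nearly annihilates their difference, which is therefore nearly a kernel vector.
\<close>

lemma orbit_near_kernel:
  assumes e: "0 < e" "e < 1"
  shows "\<exists>r>0. \<forall>a\<in>ball q0 r \<inter> orbit \<Gamma> \<rho> q0. \<forall>b\<in>ball q0 r \<inter> orbit \<Gamma> \<rho> q0.
    \<forall>y k. a - b = k + y \<longrightarrow> H *v k = 0 \<longrightarrow> (\<forall>k'. H *v k' = 0 \<longrightarrow> k' \<bullet> y = 0) \<longrightarrow> norm y \<le> e * norm (a - b)"
proof -
  obtain m where m: "m > 0" "\<And>x. (\<forall>k. H *v k = 0 \<longrightarrow> k \<bullet> x = 0) \<Longrightarrow> m * norm x \<le> norm (H *v x)"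
    using kernel_complement_bound[of H] by blast
  obtain r where r: "r > 0" and near: "\<forall>a\<in>ball q0 r. \<forall>b\<in>ball q0 r.
      norm (grad U a - grad U b - H *v (a - b)) \<le> (e * m) * norm (a - b)"
    using C2_on_grad_near_linear[OF C2 open_\<Omega> q0, of "e * m"] e m by auto
  have "norm y \<le> e * norm (a - b)"
    if a: "a \<in> ball q0 r \<inter> orbit \<Gamma> \<rho> q0" and b: "b \<in> ball q0 r \<inter> orbit \<Gamma> \<rho> q0"
      and eq: "a - b = k + y" and k: "H *v k = 0" and y: "\<forall>k'. H *v k' = 0 \<longrightarrow> k' \<bullet> y = 0" for a b k y
  proof -
    have "H *v (a - b) = H *v y" by (simp add: eq matrix_vector_right_distrib k)
    moreover have "norm (H *v (a - b)) \<le> (e * m) * norm (a - b)"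
      using near a b orbit_critical(1)[of a] orbit_critical(1)[of b] by fastforce
    ultimately have "m * norm y \<le> m * (e * norm (a - b))" using m(2)[of y] y by (simp add: mult_ac)
    then show ?thesis using m(1) by simp
  qed
  then show ?thesis using r by blast
qed

text \<open>
  Every kernel direction is tangent to the orbit. Near \<open>q0\<close> the orthogonal projection of the orbit to
  the kernel is injective. Both have the same dimension, so by invariance of domain the projection
  covers a neighbourhood of \<open>0\<close>, in particular a piece of the ray through \<open>v\<close>; and the points of the
  orbit differ from their projections by little.
\<close>

lemma kernel_tangent_orbit:
  assumes v: "H *v v = 0" and e: "0 < e" "e \<le> 1 / 2"
  shows "\<exists>g\<in>carrier \<Gamma>. \<exists>t. 0 < t \<and> t < e \<and> norm (\<rho> g q0 - q0 - t *\<^sub>R v) \<le> e * t * norm v"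
proof -
  define K where "K = {v. H *v v = 0}"
  define k where "k = dim K"
  let ?O = "orbit \<Gamma> \<rho> q0"
  let ?T = "top_of_set ?O"
  have K: "subspace K" by (auto simp: K_def subspace_def matrix_vector_right_distrib matrix_vector_mult_scaleR)
  obtain B where B: "B \<subseteq> K" "pairwise orthogonal B" "\<And>x. x \<in> B \<Longrightarrow> norm x = 1"
      "independent B" "card B = k" "span B = K"
    using orthonormal_basis_subspace[OF K] unfolding k_def by metis
  have finB: "finite B" using B(4) independent_imp_finite by blast
  then obtain b where b: "bij_betw b {..<k} B" using B(5) by (metis atLeast0LessThan ex_bij_betw_nat_finite)
  have bB: "b i \<in> B" if "i < k" for i using b that by (auto simp: bij_betw_def)
  define co where "co x i = (if i < k then b i \<bullet> x else 0)" for x i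
  have orth_K: "y \<bullet> x = 0" if x: "co x = co 0" and y: "y \<in> K" for x y
  proof -
    have "c \<bullet> x = 0" if cB: "c \<in> B" for c
    proof -
      obtain i where i: "i < k" "c = b i" using b cB by (auto simp: bij_betw_def)
      then show ?thesis using fun_cong[OF x, of i] by (simp add: co_def)
    qed
    then show ?thesis using y B(6)
      by (metis (mono_tags) orthogonal_def orthogonal_to_span inner_commute)
  qed
  have co_diff: "co (x - y) = (\<lambda>i. co x i - co y i)" for x y by (auto simp: co_def inner_diff_right)
  \<comment> \<open>near \<open>q0\<close> the orbit projects injectively to the kernel\<close>
  obtain r where r: "r > 0" and near: "\<And>a b y k'. a \<in> ball q0 r \<inter> ?O \<Longrightarrow> b \<in> ball q0 r \<inter> ?O \<Longrightarrow>
      a - b = k' + y \<Longrightarrow> H *v k' = 0 \<Longrightarrow> (\<forall>k'. H *v k' = 0 \<longrightarrow> k' \<bullet> y = 0) \<Longrightarrow> norm y \<le> (e / 2) * norm (a - b)"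
  proof -
    have "0 < e / 2" "e / 2 < 1" using e by auto
    from orbit_near_kernel[OF this] that show ?thesis by blast
  qed
  obtain W \<phi> where c: "chart ?T k (W, \<phi>)" and qW: "q0 \<in> W"
    using orbit_locally_euclidean q0_in_orbit unfolding locally_euclidean_def k_def K_def by auto
  define V where "V = W \<inter> ball q0 r"
  have W: "openin ?T W" using c by (auto simp: chart_def)
  have V: "openin ?T V" "V \<subseteq> W" "V \<subseteq> ball q0 r \<inter> ?O" "q0 \<in> V"
    using W qW r openin_subset[OF W] by (auto simp: V_def intro!: openin_Int_open)
  define f where "f a = co (a - q0)" for a
  have "continuous_map (subtopology ?T V) (Euclidean_space k) f"
    unfolding f_def co_def continuous_map_componentwise_Euclidean_space
    by (auto intro!: continuous_intros continuous_map_from_subtopology)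
  moreover have "inj_on f V"
  proof (rule inj_onI)
    fix a a' assume a: "a \<in> V" "a' \<in> V" and eq: "f a = f a'"
    have "co (a - a') = co 0"
      using eq unfolding f_def co_diff by (auto simp: fun_eq_iff co_def)
    moreover have "a \<in> ball q0 r \<inter> ?O" "a' \<in> ball q0 r \<inter> ?O" using a V(3) by blast+
    ultimately have "norm (a - a') \<le> (e / 2) * norm (a - a')"
      using near[of a a' 0 "a - a'"] orth_K by (auto simp: K_def)
    then show "a = a'" using e by (cases "norm (a - a') = 0") (auto simp: mult_le_cancel_right1)
  qed
  ultimately have op: "openin (Euclidean_space k) (f ` V)"
    by (rule invariance_of_domain_chart[OF c V(1,2)])
  have "(\<lambda>i. if i < k then 0 else 0) \<in> f ` V"
    using V(4) by (auto simp: f_def co_def image_iff intro!: bexI[of _ q0])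
  from openin_Euclidean_space_line[OF op this, of "co v"]
  obtain s where s: "s > 0" "\<And>t. \<bar>t\<bar> < s \<Longrightarrow> (\<lambda>i. if i < k then 0 + t * co v i else 0) \<in> f ` V" by blast
  define t where "t = min (s / 2) (e / 2)"
  have t: "0 < t" "t < s" "t < e" using s e by (auto simp: t_def)
  then obtain a where a: "a \<in> V" "(\<lambda>i. if i < k then 0 + t * co v i else 0) = f a" using s(2)[of t] by auto
  define y where "y = a - q0 - t *\<^sub>R v"
  have "co y = co 0"
  proof
    fix i
    show "co y i = co 0 i"
      using fun_cong[OF a(2), of i] unfolding y_def f_def
      by (cases "i < k") (simp_all add: co_def inner_diff_right)
  qed
  then have yK: "\<forall>k'. H *v k' = 0 \<longrightarrow> k' \<bullet> y = 0" using orth_K by (auto simp: K_def)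
  have "norm y \<le> (e / 2) * norm (a - q0)"
    by (rule near[of a q0 "t *\<^sub>R v" y])
      (use a V yK v in \<open>auto simp: y_def matrix_vector_mult_scaleR\<close>)
  also have "norm (a - q0) \<le> norm y + t * norm v"
    using norm_triangle_ineq[of y "t *\<^sub>R v"] t by (simp add: y_def)
  finally have "norm y \<le> (e / 2) * (norm y + t * norm v)" using e by simp
  moreover have "(e / 2) * norm y \<le> (1 / 2) * norm y" using e by (intro mult_right_mono) auto
  ultimately have "norm y \<le> e * t * norm v" by (simp add: distrib_left)
  moreover obtain g where "g \<in> carrier \<Gamma>" "a = \<rho> g q0" using a V(3) by (auto simp: orbit_eq)
  ultimately show ?thesis using t by (auto simp: y_def)
qed


text \<open>
  A distance to the identity that dominates the operator norm of \<open>\<rho> g - id\<close> and is evidently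
  continuous in \<open>g\<close>.
\<close>

definition displacement :: "'g \<Rightarrow> real" where
  "displacement g = (\<Sum>b\<in>Basis. norm (\<rho> g b - b))"

lemma displacement_nonneg: "0 \<le> displacement g"
  by (auto simp: displacement_def intro: sum_nonneg)

lemma norm_le_displacement:
  assumes g: "g \<in> carrier \<Gamma>"
  shows "norm (\<rho> g x - x) \<le> displacement g * norm x"
proof -
  interpret linear "\<rho> g" by (rule action_linear[OF g])
  have "\<rho> g x - x = (\<Sum>b\<in>Basis. (x \<bullet> b) *\<^sub>R (\<rho> g b - b))"
  proof -
    have "\<rho> g x = \<rho> g (\<Sum>b\<in>Basis. (x \<bullet> b) *\<^sub>R b)" by (simp add: euclidean_representation)
    also have "\<dots> = (\<Sum>b\<in>Basis. (x \<bullet> b) *\<^sub>R \<rho> g b)" by (simp add: sum scale)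
    finally show ?thesis by (simp add: scaleR_diff_right sum_subtractf euclidean_representation)
  qed
  also have "norm \<dots> \<le> (\<Sum>b\<in>Basis. norm (\<rho> g b - b) * norm x)"
    by (rule sum_norm_le) (auto simp: Basis_le_norm mult.commute[of _ "norm x"] intro!: mult_right_mono)
  finally show ?thesis by (simp add: displacement_def sum_distrib_right)
qed

lemma action_pow_telescope:
  assumes g: "g \<in> carrier \<Gamma>"
  shows "\<rho> (g [^]\<^bsub>\<Gamma>\<^esub> (k::nat)) x - x = (\<Sum>j<k. \<rho> (g [^]\<^bsub>\<Gamma>\<^esub> j) (\<rho> g x - x))"
proof (induction k)
  case (Suc k)
  have p: "g [^]\<^bsub>\<Gamma>\<^esub> k \<in> carrier \<Gamma>" using g by simp
  have "\<rho> (g [^]\<^bsub>\<Gamma>\<^esub> Suc k) x = \<rho> (g [^]\<^bsub>\<Gamma>\<^esub> k) (\<rho> g x)" using g by (simp add: action_mult)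
  then show ?case
    unfolding sum.lessThan_Suc linear_diff[OF action_linear[OF p]] Suc.IH[symmetric] by simp
qed (simp add: action_one)

text \<open>
  While the powers of \<open>g\<close> stay near the identity, they move away from it at linear speed: the sum in
  the telescoping identity consists of \<open>k\<close> nearly equal terms.
\<close>

lemma displacement_pow_lower:
  assumes g: "g \<in> carrier \<Gamma>" and small: "\<And>j. j < k \<Longrightarrow> displacement (g [^]\<^bsub>\<Gamma>\<^esub> j) \<le> 1 / 2"
  shows "real k * displacement g \<le> 2 * displacement (g [^]\<^bsub>\<Gamma>\<^esub> (k::nat))"
proof -
  have "real k * norm (\<rho> g b - b) \<le> 2 * norm (\<rho> (g [^]\<^bsub>\<Gamma>\<^esub> k) b - b)" for b
  proof -
    define w where "w = \<rho> g b - b"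
    have "norm (\<Sum>j<k. \<rho> (g [^]\<^bsub>\<Gamma>\<^esub> j) w - w) \<le> (\<Sum>j<k. 1 / 2 * norm w)"
    proof (rule sum_norm_le)
      fix j assume "j \<in> {..<k}"
      then have "displacement (g [^]\<^bsub>\<Gamma>\<^esub> j) * norm w \<le> 1 / 2 * norm w"
        using small by (intro mult_right_mono) auto
      then show "norm (\<rho> (g [^]\<^bsub>\<Gamma>\<^esub> j) w - w) \<le> 1 / 2 * norm w"
        using norm_le_displacement[of "g [^]\<^bsub>\<Gamma>\<^esub> j" w] g by simp
    qed
    moreover have "real k *\<^sub>R w = (\<rho> (g [^]\<^bsub>\<Gamma>\<^esub> k) b - b) - (\<Sum>j<k. \<rho> (g [^]\<^bsub>\<Gamma>\<^esub> j) w - w)"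
      unfolding action_pow_telescope[OF g, of k b] w_def[symmetric]
      by (simp only: sum_subtractf sum_constant_scaleR card_lessThan) simp
    then have "norm (real k *\<^sub>R w) \<le> norm (\<rho> (g [^]\<^bsub>\<Gamma>\<^esub> k) b - b) + norm (\<Sum>j<k. \<rho> (g [^]\<^bsub>\<Gamma>\<^esub> j) w - w)"
      by (metis norm_triangle_ineq4)
    ultimately show ?thesis by (simp add: w_def)
  qed
  then show ?thesis unfolding displacement_def sum_distrib_left by (intro sum_mono)
qed

lemma displacement_upper: "g \<in> carrier \<Gamma> \<Longrightarrow> displacement g \<le> 2 * real CARD('n)"
proof -
  assume g: "g \<in> carrier \<Gamma>"
  have "displacement g \<le> (\<Sum>b\<in>(Basis :: (real^'n) set). 2)"
    unfolding displacement_def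
  proof (rule sum_mono)
    fix b :: "real^'n" assume "b \<in> Basis"
    then show "norm (\<rho> g b - b) \<le> 2"
      using norm_triangle_ineq4[of "\<rho> g b" b] action_norm[OF g, of b] by simp
  qed
  then show ?thesis by (simp add: mult.commute)
qed

lemma displacement_continuous: "continuous_map X euclideanreal displacement"
  unfolding displacement_def
  by (intro continuous_map_sum continuous_map_norm continuous_map_diff action_continuous) auto

lemma far_elements_move_q0:
  "\<exists>\<mu>>0. \<forall>g\<in>carrier \<Gamma>. 1 / 2 \<le> displacement g \<longrightarrow> \<mu> \<le> norm (\<rho> g q0 - q0)"
proof -
  define Z where "Z = {g \<in> topspace X. displacement g \<in> {1 / 2..}}"
  have "closedin X Z" unfolding Z_def
    by (rule closedin_continuous_map_preimage[OF displacement_continuous]) simp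
  then have Z: "compactin X Z" using comp by (rule closedin_compact_space[rotated])
  have "continuous_map X euclideanreal (\<lambda>g. norm (\<rho> g q0 - q0))"
    by (intro continuous_map_norm continuous_map_diff action_continuous) auto
  from image_compactin[OF Z this]
  have c: "compact ((\<lambda>g. norm (\<rho> g q0 - q0)) ` Z)" by simp
  show ?thesis
  proof (cases "Z = {}")
    case True
    then show ?thesis by (intro exI[of _ 1]) (auto simp: Z_def topspace_X)
  next
    case False
    then obtain h where h: "h \<in> Z" "\<And>g. g \<in> Z \<Longrightarrow> norm (\<rho> h q0 - q0) \<le> norm (\<rho> g q0 - q0)"
      using compact_attains_inf[OF c] by auto
    have "\<rho> h q0 \<noteq> q0"
    proof
      assume "\<rho> h q0 = q0"
      then have "h = \<one>\<^bsub>\<Gamma>\<^esub>" using h(1) free_eq_one by (auto simp: Z_def topspace_X)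
      then have "displacement h = 0" by (simp add: displacement_def action_one)
      then show False using h(1) by (simp add: Z_def)
    qed
    then show ?thesis using h by (intro exI[of _ "norm (\<rho> h q0 - q0)"]) (auto simp: Z_def topspace_X)
  qed
qed

text \<open>
  A group element moves \<open>q0\<close> by at least a fixed fraction of its distance to the identity. Otherwise
  some \<open>g\<close> near the identity would barely move \<open>q0\<close>; take the first power \<open>g\<^sup>k\<close> that is at distance
  \<open>1/2\<close> from the identity. It moves \<open>q0\<close> by at most \<open>k\<close> times as much, with \<open>k\<close> bounded in terms of the
  distance of \<open>g\<close>, but by compactness and trivial isotropy it has to move \<open>q0\<close> by a definite amount.
\<close>

lemma displacement_le_motion:
  "\<exists>c>0. \<forall>g\<in>carrier \<Gamma>. c * displacement g \<le> norm (\<rho> g q0 - q0)"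
proof -
  obtain \<mu> where \<mu>: "\<mu> > 0" "\<And>g. g \<in> carrier \<Gamma> \<Longrightarrow> 1 / 2 \<le> displacement g \<Longrightarrow> \<mu> \<le> norm (\<rho> g q0 - q0)"
    using far_elements_move_q0 by blast
  define n where "n = real CARD('n)"
  have n: "n > 0" by (simp add: n_def)
  have "\<mu> / (4 * n) * displacement g \<le> norm (\<rho> g q0 - q0)" if g: "g \<in> carrier \<Gamma>" for g
  proof (cases "displacement g = 0")
    case False
    then have dg: "displacement g > 0" using displacement_nonneg[of g] by simp
    have gk: "g [^]\<^bsub>\<Gamma>\<^esub> k \<in> carrier \<Gamma>" for k :: nat using g by simp
    have "\<exists>k::nat. 1 / 2 \<le> displacement (g [^]\<^bsub>\<Gamma>\<^esub> k)"
    proof (rule ccontr)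
      assume "\<not> ?thesis"
      then have sm: "displacement (g [^]\<^bsub>\<Gamma>\<^esub> k) < 1 / 2" for k :: nat by (simp add: not_le)
      obtain k :: nat where k: "1 < real k * displacement g" using dg reals_Archimedean3 by blast
      have "real k * displacement g \<le> 2 * displacement (g [^]\<^bsub>\<Gamma>\<^esub> k)"
        using sm by (intro displacement_pow_lower[OF g]) (auto intro: less_imp_le)
      then show False using sm[of k] k by simp
    qed
    then obtain k :: nat where k: "1 / 2 \<le> displacement (g [^]\<^bsub>\<Gamma>\<^esub> k)"
      and least: "\<And>j. j < k \<Longrightarrow> \<not> 1 / 2 \<le> displacement (g [^]\<^bsub>\<Gamma>\<^esub> j)"
      using exists_least_iff[of "\<lambda>k. 1 / 2 \<le> displacement (g [^]\<^bsub>\<Gamma>\<^esub> (k::nat))"] by blast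
    have "real k * displacement g \<le> 2 * displacement (g [^]\<^bsub>\<Gamma>\<^esub> k)"
      using least by (intro displacement_pow_lower[OF g]) (auto simp: not_le intro: less_imp_le)
    then have kd: "real k * displacement g \<le> 4 * n"
      using displacement_upper[OF gk[of k]] by (simp add: n_def)
    have "\<mu> \<le> norm (\<rho> (g [^]\<^bsub>\<Gamma>\<^esub> k) q0 - q0)" by (rule \<mu>(2)[OF gk k])
    also have "\<dots> \<le> (\<Sum>j<k. norm (\<rho> g q0 - q0))"
      unfolding action_pow_telescope[OF g] by (rule sum_norm_le) (simp add: action_norm g)
    finally have "\<mu> \<le> real k * norm (\<rho> g q0 - q0)" by simp
    then have "\<mu> * displacement g \<le> real k * norm (\<rho> g q0 - q0) * displacement g"
      using dg by (intro mult_right_mono) auto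
    also have "\<dots> = (real k * displacement g) * norm (\<rho> g q0 - q0)" by simp
    also have "\<dots> \<le> 4 * n * norm (\<rho> g q0 - q0)" by (intro mult_right_mono kd) auto
    finally show ?thesis using n by (simp add: field_simps)
  qed simp
  then show ?thesis using \<mu>(1) n by (intro exI[of _ "\<mu> / (4 * n)"]) auto
qed

text \<open>
  Choose \<open>g n\<close> with \<open>\<rho> (g n) q0 = q0 + t v + o(t)\<close>, \<open>t = t n \<rightarrow> 0\<close>. By the previous bound the difference
  quotients \<open>(\<rho> (g n) - id) / t\<close> are bounded, and a limit point \<open>A\<close> of them has the required properties:
  it is skew because the \<open>\<rho> (g n)\<close> are isometries, and it annihilates the gradient because they
  preserve \<open>U\<close>.
\<close>

theorem infinitesimal_symmetry:
  assumes v: "H *v v = 0"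
  shows "\<exists>A. linear A \<and> A q0 = v \<and> (\<forall>x. x \<bullet> A x = 0) \<and> (\<forall>x\<in>\<Omega>. grad U x \<bullet> A x = 0)"
proof -
  define e where "e n = 1 / (real n + 2)" for n
  have e: "0 < e n" "e n \<le> 1 / 2" for n by (auto simp: e_def field_simps)
  have e0: "e \<longlonglongrightarrow> 0"
    using LIMSEQ_ignore_initial_segment[OF lim_inverse_n', of 2]
    unfolding e_def by (simp add: add.commute)
  have "\<exists>g t. g \<in> carrier \<Gamma> \<and> 0 < t \<and> t < e n \<and> norm (\<rho> g q0 - q0 - t *\<^sub>R v) \<le> e n * t * norm v" for n
    using kernel_tangent_orbit[OF v e] by blast
  then obtain g t where g: "\<And>n. g n \<in> carrier \<Gamma>" and t: "\<And>n. 0 < t n" "\<And>n. t n < e n"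
    and gt: "\<And>n. norm (\<rho> (g n) q0 - q0 - t n *\<^sub>R v) \<le> e n * t n * norm v"
    by metis
  have t0: "t \<longlonglongrightarrow> 0"
    by (rule tendsto_sandwich[OF _ _ tendsto_const e0]) (auto intro!: always_eventually less_imp_le t)
  define Q where "Q n x = (1 / t n) *\<^sub>R (\<rho> (g n) x - x)" for n x
  have lQ: "linear (Q n)" for n
    unfolding Q_def by (intro linear_compose_scale_right linear_compose_sub action_linear g linear_ident)
  obtain c where c: "c > 0" "\<And>g. g \<in> carrier \<Gamma> \<Longrightarrow> c * displacement g \<le> norm (\<rho> g q0 - q0)"
    using displacement_le_motion by blast
  define R where "R = 2 * norm v / c"
  have dR: "displacement (g n) \<le> R * t n" for n
  proof -
    have "norm (\<rho> (g n) q0 - q0) \<le> norm (\<rho> (g n) q0 - q0 - t n *\<^sub>R v) + norm (t n *\<^sub>R v)"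
      by (metis diff_add_cancel norm_triangle_ineq)
    also have "\<dots> \<le> 1 * t n * norm v + t n * norm v"
    proof -
      have "e n * (t n * norm v) \<le> 1 * (t n * norm v)" using e(2)[of n] t(1)[of n] by (intro mult_right_mono) auto
      then have "norm (\<rho> (g n) q0 - q0 - t n *\<^sub>R v) \<le> t n * norm v"
        using gt[of n] unfolding mult.assoc by linarith
      then show ?thesis using t(1)[of n] by (simp add: mult.commute[of _ "norm v"])
    qed
    finally have "c * displacement (g n) \<le> 2 * (t n * norm v)" using c(2)[OF g[of n]] by linarith
    then show ?thesis using c(1) by (simp add: R_def field_simps)
  qed
  have QR: "norm (Q n x) \<le> R * norm x" for n x
  proof -
    have "norm (\<rho> (g n) x - x) \<le> R * t n * norm x"
      using norm_le_displacement[OF g, of n x] mult_right_mono[OF dR[of n], of "norm x"] by simp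
    moreover have "norm (Q n x) = norm (\<rho> (g n) x - x) / t n"
      using t(1)[of n] unfolding Q_def norm_scaleR by simp
    ultimately show ?thesis using t(1)[of n] by (simp add: divide_le_eq mult_ac)
  qed
  define M where "M n = matrix (Q n)" for n
  have MQ: "M n *v x = Q n x" for n x unfolding M_def using lQ matrix_works[of "Q n"] linear_matrix_vector_mul_eq[of "Q n"] by simp
  have "norm (M n) \<le> real CARD('n) * (real CARD('n) * R)" for n
  proof -
    have "\<bar>M n $ i $ j\<bar> \<le> R" for i j
    proof -
      have "\<bar>Q n (axis j 1) $ i\<bar> \<le> norm (Q n (axis j 1))" by (rule component_le_norm_cart)
      also have "\<dots> \<le> R" using QR[of n "axis j 1"] by simp
      finally show ?thesis by (simp add: M_def matrix_def)
    qed
    then have "norm (M n $ i) \<le> (\<Sum>j\<in>(UNIV :: 'n set). R)" for i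
      by (intro order_trans[OF norm_le_l1_cart] sum_mono)
    then have "(\<Sum>i\<in>UNIV. norm (M n $ i)) \<le> (\<Sum>i\<in>(UNIV :: 'n set). \<Sum>j\<in>(UNIV :: 'n set). R)"
      by (intro sum_mono)
    then show ?thesis using norm_le_componentwise_cart L2_set_le_sum[of UNIV "\<lambda>i. norm (M n $ i)"]
      by (simp add: norm_vec_def)
  qed
  then have "bounded (range M)" by (auto simp: bounded_iff)
  then obtain A s where s: "strict_mono s" and A: "(M \<circ> s) \<longlonglongrightarrow> A"
    using bounded_imp_convergent_subsequence by blast
  have lim: "(\<lambda>n. Q (s n) x) \<longlonglongrightarrow> A *v x" for x
  proof -
    have "linear (\<lambda>A :: real^'n^'n. A *v x)"
      by (rule linearI) (simp_all add: matrix_vector_mult_add_rdistrib scaleR_matrix_vector_assoc)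
    then have "bounded_linear (\<lambda>A :: real^'n^'n. A *v x)" by (simp add: linear_conv_bounded_linear)
    from bounded_linear.tendsto[OF this A] have "(\<lambda>n. (M \<circ> s) n *v x) \<longlonglongrightarrow> A *v x" .
    then show ?thesis by (simp add: MQ)
  qed
  have ts: "(\<lambda>n. t (s n)) \<longlonglongrightarrow> 0" and es: "(\<lambda>n. e (s n)) \<longlonglongrightarrow> 0"
    using LIMSEQ_subseq_LIMSEQ[OF t0 s] LIMSEQ_subseq_LIMSEQ[OF e0 s] by (auto simp: o_def)
  have step: "\<rho> (g n) x = x + t n *\<^sub>R Q n x" for n x using t(1)[of n] by (simp add: Q_def)
  have "A *v q0 = v"
  proof (rule LIMSEQ_unique[OF lim])
    have "norm (Q n q0 - v) \<le> e n * norm v" for n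
    proof -
      have "Q n q0 - v = (1 / t n) *\<^sub>R (\<rho> (g n) q0 - q0 - t n *\<^sub>R v)"
        using t(1)[of n] by (simp add: Q_def scaleR_diff_right)
      then have "norm (Q n q0 - v) = norm (\<rho> (g n) q0 - q0 - t n *\<^sub>R v) / t n" using t(1)[of n] by simp
      then show ?thesis using gt[of n] t(1)[of n] by (simp add: divide_le_eq mult_ac)
    qed
    moreover have "(\<lambda>n. e (s n) * norm v) \<longlonglongrightarrow> 0" using es by (rule tendsto_mult_left_zero)
    ultimately have "(\<lambda>n. Q (s n) q0 - v) \<longlonglongrightarrow> 0"
      by (intro Lim_null_comparison[of "\<lambda>n. Q (s n) q0 - v" "\<lambda>n. e (s n) * norm v"]) auto
    then show "(\<lambda>n. Q (s n) q0) \<longlonglongrightarrow> v" by (simp add: LIM_zero_iff)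
  qed
  moreover have "x \<bullet> (A *v x) = 0" for x
  proof (rule LIMSEQ_unique)
    show "(\<lambda>n. x \<bullet> Q (s n) x) \<longlonglongrightarrow> x \<bullet> (A *v x)" by (intro tendsto_intros lim)
    have "x \<bullet> Q n x = - (t n * (Q n x \<bullet> Q n x) / 2)" for n
    proof -
      have "(x + t n *\<^sub>R Q n x) \<bullet> (x + t n *\<^sub>R Q n x) = x \<bullet> x"
        using action_norm[OF g, of n x] by (simp add: step norm_eq)
      then have "t n * (2 * (x \<bullet> Q n x) + t n * (Q n x \<bullet> Q n x)) = 0"
        by (simp add: inner_add_left inner_add_right inner_commute algebra_simps)
      then show ?thesis using t(1)[of n] by (simp add: mult.commute[of _ "norm v"])
    qed
    moreover have "(\<lambda>n. - (t (s n) * (Q (s n) x \<bullet> Q (s n) x) / 2)) \<longlonglongrightarrow> - (0 * ((A *v x) \<bullet> (A *v x)) / 2)"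
      by (intro tendsto_intros ts lim) simp
    ultimately show "(\<lambda>n. x \<bullet> Q (s n) x) \<longlonglongrightarrow> 0" by simp
  qed
  moreover have "grad U x \<bullet> (A *v x) = 0" if x: "x \<in> \<Omega>" for x
    by (rule has_derivative_along_sequence[OF C2_on_has_derivative_grad[OF C2 x] _ ts lim[of x]])
      (use t U_inv x g in \<open>auto simp flip: step\<close>)
  ultimately show ?thesis
    by (intro exI[of _ "(*v) A"]) (simp add: matrix_vector_mul_linear)
qed

end

section \<open>Periodic solutions near the orbit\<close>

lemma minimal_period_imp_not_constant:
  assumes "minimal_period q T"
  shows "\<not> q constant_on UNIV"
proof
  assume "q constant_on UNIV"
  then have "is_period q (T / 2)"
    using assms by (auto simp: minimal_period_def is_period_def constant_on_def)
  then have "T \<le> T / 2" using assms unfolding minimal_period_def by blast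
  then show False using assms by (simp add: minimal_period_def is_period_def)
qed

lemma is_period_rescale:
  fixes q :: "real \<Rightarrow> 'a::real_vector"
  assumes "\<epsilon> \<noteq> 0" "0 < \<omega>"
  shows "is_period (\<lambda>t. c + \<epsilon> *\<^sub>R q (\<omega> * t)) S \<longleftrightarrow> is_period q (\<omega> * S)"
proof -
  have "(\<forall>t. q (\<omega> * (t + S)) = q (\<omega> * t)) \<longleftrightarrow> (\<forall>t. q (t + \<omega> * S) = q t)"
  proof
    assume *: "\<forall>t. q (\<omega> * (t + S)) = q (\<omega> * t)"
    show "\<forall>t. q (t + \<omega> * S) = q t"
    proof
      fix t show "q (t + \<omega> * S) = q t" using *[rule_format, of "t / \<omega>"] assms by (simp add: distrib_left)
    qed
  qed (simp add: distrib_left)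
  then show ?thesis using assms by (simp add: is_period_def zero_less_mult_iff)
qed

lemma minimal_period_rescale:
  fixes q :: "real \<Rightarrow> 'a::real_vector"
  assumes "minimal_period q T" "\<epsilon> \<noteq> 0" "0 < \<omega>"
  shows "minimal_period (\<lambda>t. c + \<epsilon> *\<^sub>R q (\<omega> * t)) (T / \<omega>)"
  using assms unfolding minimal_period_def is_period_rescale[OF assms(2,3)]
  by (auto simp: divide_le_eq mult.commute)

context free_invariant_potential begin

text \<open>
  A norm bound that is uniform in the kernel vector, obtained by choosing the symmetries linearly from
  those of an orthonormal basis of the kernel.
\<close>

lemma bounded_infinitesimal_symmetry:
  "\<exists>a>0. \<forall>v. H *v v = 0 \<longrightarrow> (\<exists>A. linear A \<and> A q0 = v \<and> (\<forall>x. x \<bullet> A x = 0) \<and>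
      (\<forall>x. norm (A x) \<le> a * norm v * norm x) \<and> (\<forall>x\<in>\<Omega>. grad U x \<bullet> A x = 0))"
proof -
  define K where "K = {v. H *v v = 0}"
  have K: "subspace K" by (auto simp: K_def subspace_def matrix_vector_right_distrib matrix_vector_mult_scaleR)
  obtain B where B: "B \<subseteq> K" "pairwise orthogonal B" "\<And>x. x \<in> B \<Longrightarrow> norm x = 1"
      "independent B" "span B = K"
    using orthonormal_basis_subspace[OF K] by metis
  have finB: "finite B" using B(4) independent_imp_finite by blast
  have "\<forall>b\<in>B. \<exists>A. linear A \<and> A q0 = b \<and> (\<forall>x. x \<bullet> A x = 0) \<and> (\<forall>x\<in>\<Omega>. grad U x \<bullet> A x = 0)"
    using infinitesimal_symmetry B(1) by (auto simp: K_def)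
  then obtain A where A: "\<And>b. b \<in> B \<Longrightarrow> linear (A b)" "\<And>b. b \<in> B \<Longrightarrow> A b q0 = b"
      "\<And>b x. b \<in> B \<Longrightarrow> x \<bullet> A b x = 0" "\<And>b x. b \<in> B \<Longrightarrow> x \<in> \<Omega> \<Longrightarrow> grad U x \<bullet> A b x = 0"
    by metis
  have "\<forall>b\<in>B. \<exists>c>0. \<forall>x. norm (A b x) \<le> c * norm x"
    using linear_bounded_pos[OF A(1)] by metis
  then obtain c where c: "\<And>b. b \<in> B \<Longrightarrow> c b > 0" "\<And>b x. b \<in> B \<Longrightarrow> norm (A b x) \<le> c b * norm x" by metis
  define a where "a = (\<Sum>b\<in>B. c b) + 1"
  have a: "a > 0" unfolding a_def using c(1) by (intro add_nonneg_pos sum_nonneg) (auto intro: less_imp_le)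
  have "\<exists>A. linear A \<and> A q0 = v \<and> (\<forall>x. x \<bullet> A x = 0) \<and>
      (\<forall>x. norm (A x) \<le> a * norm v * norm x) \<and> (\<forall>x\<in>\<Omega>. grad U x \<bullet> A x = 0)" if v: "H *v v = 0" for v
  proof -
    define Av where "Av x = (\<Sum>b\<in>B. (b \<bullet> v) *\<^sub>R A b x)" for x
    have "linear Av" unfolding Av_def
      by (intro linear_compose_sum ballI linear_compose_scale_right A)
    moreover have "Av q0 = v"
    proof -
      have "Av q0 = (\<Sum>b\<in>B. (b \<bullet> v) *\<^sub>R b)" using A(2) by (simp add: Av_def)
      moreover have "v \<in> span B" using v B(5) by (simp add: K_def)
      ultimately show ?thesis
        using orthonormal_basis_expand[OF B(2,3) _ finB, of v] by (simp add: inner_commute)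
    qed
    moreover have "x \<bullet> Av x = 0" for x using A(3) by (simp add: Av_def inner_sum_right)
    moreover have "grad U x \<bullet> Av x = 0" if "x \<in> \<Omega>" for x using A(4) that by (simp add: Av_def inner_sum_right)
    moreover have "norm (Av x) \<le> a * norm v * norm x" for x
    proof -
      have "norm (Av x) \<le> (\<Sum>b\<in>B. norm v * (c b * norm x))"
        unfolding Av_def
      proof (rule sum_norm_le)
        fix b assume b: "b \<in> B"
        have "\<bar>b \<bullet> v\<bar> \<le> norm v" using Cauchy_Schwarz_ineq2[of b v] B(3)[OF b] by simp
        then show "norm ((b \<bullet> v) *\<^sub>R A b x) \<le> norm v * (c b * norm x)"
          using c(2)[OF b, of x] by (auto intro!: mult_mono)
      qed
      also have "\<dots> = (\<Sum>b\<in>B. c b) * (norm v * norm x)"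
        unfolding sum_distrib_right by (intro sum.cong refl) (simp add: mult_ac)
      also have "\<dots> \<le> a * (norm v * norm x)" unfolding a_def by (intro mult_right_mono) auto
      finally show ?thesis by (simp add: mult.assoc)
    qed
    ultimately show ?thesis by blast
  qed
  then show ?thesis using a by blast
qed

text \<open>
  The substitution \<open>q t = q0 + \<epsilon> v (\<omega> t)\<close> with \<open>\<omega> = \<beta> / sqrt m\<close> turns \<open>q'' = - grad U q\<close> into
  \<open>v'' = - m g v\<close> with \<open>g v = grad U (q0 + \<epsilon> v) / (\<epsilon> \<beta>\<^sup>2)\<close>, close to \<open>N = H / \<beta>\<^sup>2\<close> for small \<open>\<epsilon>\<close>. The
  nonresonance condition says that \<open>N\<close> has no eigenvalue \<open>k\<^sup>2\<close> with \<open>k \<ge> 2\<close>. The parameter \<open>\<kappa>\<close> controls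
  \<open>m - 1\<close> and hence the period; \<open>\<epsilon>\<close> is chosen after it and controls the distance to \<open>q0\<close>.
\<close>

theorem periodic_solutions_near_orbit:
  assumes \<beta>: "0 < \<beta>" and ev: "\<beta>\<^sup>2 \<in> spectrum H"
    and nres: "\<And>k::nat. k \<ge> 2 \<Longrightarrow> (real k * \<beta>)\<^sup>2 \<notin> spectrum H"
    and \<O>: "open \<O>" "orbit \<Gamma> \<rho> q0 \<subseteq> \<O>" and \<delta>: "0 < \<delta>"
  shows "\<exists>q T. newton_solution U \<Omega> q \<and> \<not> q constant_on UNIV \<and>
    (\<forall>\<gamma>\<in>carrier \<Gamma>. \<forall>t. \<rho> \<gamma> (q t) \<in> \<O>) \<and> minimal_period q T \<and> \<bar>T - 2 * pi / \<beta>\<bar> < \<delta>"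
proof -
  define N where "N x = (1 / \<beta>\<^sup>2) *\<^sub>R (H *v x)" for x
  have b2: "\<beta>\<^sup>2 > 0" using \<beta> by simp
  have linN: "linear N" unfolding N_def by (intro linear_compose_scale_right matrix_vector_mul_linear)
  have symN: "x \<bullet> N y = N x \<bullet> y" for x y
    using hessian_symmetric[OF C2 open_\<Omega> q0, of x y] by (simp add: N_def inner_commute)
  have HN: "H *v x = \<beta>\<^sup>2 *\<^sub>R N x" for x using b2 by (simp add: N_def)
  have nresN: "x = 0" if "k \<ge> 2" "N x = (real k)\<^sup>2 *\<^sub>R x" for k :: nat and x
  proof (rule ccontr)
    assume "x \<noteq> 0"
    moreover have "H *v x = (real k * \<beta>)\<^sup>2 *\<^sub>R x" unfolding HN that(2) by (simp add: power_mult_distrib mult.commute)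
    ultimately have "(real k * \<beta>)\<^sup>2 \<in> spectrum H" by (auto simp: spectrum_def)
    then show False using nres that(1) by blast
  qed
  obtain x0 where x0: "x0 \<noteq> 0" "N x0 = x0" using ev b2 by (auto simp: spectrum_def N_def)
  have "\<exists>Y Y' C. neumann_green N Y Y' C"
    by (rule neumann_green_exists[OF linN symN]) (rule nresN)
  then obtain Y Y' C where green: "neumann_green N Y Y' C" by blast
  have C: "C > 0" using green by (simp add: neumann_green_def)
  obtain L0 where L0: "\<And>x. norm (N x) \<le> L0 * norm x" using linear_bounded_pos[OF linN] by blast
  define L where "L = max 1 L0"
  have L1: "1 \<le> L" by (simp add: L_def)
  have LN: "norm (N x) \<le> L * norm x" for x
    using L0[of x] mult_right_mono[of L0 L "norm x"] by (simp add: L_def)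
  \<comment> \<open>the three bounds are for \<open>m \<ge> 1 / 2\<close>, for the contraction and for the period\<close>
  define \<kappa> where "\<kappa> = min (1 / (38 * pi * L)) (min (1 / (C * (74 * pi * L\<^sup>2) * (200 * L))) (\<delta> * \<beta> / (2 * (2 * pi * (19 * pi * L)))))"
  have pL: "pi * L > 0" using L1 by simp
  have \<kappa>: "0 < \<kappa>" using pL C L1 \<delta> \<beta> by (simp add: \<kappa>_def)
  have \<kappa>1: "19 * pi * L * \<kappa> \<le> 1 / 2"
  proof -
    have "19 * pi * L * \<kappa> \<le> 19 * pi * L * (1 / (38 * pi * L))"
      using L1 by (intro mult_left_mono) (auto simp: \<kappa>_def)
    also have "\<dots> = 1 / 2" using L1 by simp
    finally show ?thesis .
  qed
  have \<kappa>2: "C * (74 * pi * L\<^sup>2 * \<kappa>) \<le> 1 / (200 * L)"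
  proof -
    have "C * (74 * pi * L\<^sup>2) * \<kappa> \<le> C * (74 * pi * L\<^sup>2) * (1 / (C * (74 * pi * L\<^sup>2) * (200 * L)))"
      using L1 C by (intro mult_left_mono) (auto simp: \<kappa>_def)
    also have "\<dots> = 1 / (200 * L)" using L1 C by simp
    finally show ?thesis by (simp add: mult.assoc)
  qed
  have \<kappa>3: "2 * pi * (19 * pi * L * \<kappa>) / \<beta> < \<delta>"
  proof -
    have "2 * pi * (19 * pi * L) * \<kappa> \<le> 2 * pi * (19 * pi * L) * (\<delta> * \<beta> / (2 * (2 * pi * (19 * pi * L))))"
      using L1 by (intro mult_left_mono) (auto simp: \<kappa>_def)
    also have "\<dots> = \<delta> * \<beta> / 2" using L1 by simp
    also have "\<dots> < \<delta> * \<beta>" using \<delta> \<beta> by simp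
    finally show ?thesis using \<beta> by (simp add: divide_less_eq mult.assoc)
  qed
  define d where "d = min (\<kappa> / 200) (1 / (200 * L * C))"
  have d: "0 < d" using \<kappa> L1 C by (simp add: d_def)
  have d1: "d \<le> \<kappa> / 200" by (simp add: d_def)
  have d2: "C * d \<le> 1 / (200 * L)"
  proof -
    have "C * d \<le> C * (1 / (200 * L * C))" using C by (intro mult_left_mono) (auto simp: d_def)
    also have "\<dots> = 1 / (200 * L)" using C by simp
    finally show ?thesis .
  qed
  obtain a where a: "a > 0" and sym_a: "\<And>v. H *v v = 0 \<Longrightarrow> \<exists>A. linear A \<and> A q0 = v \<and> (\<forall>x. x \<bullet> A x = 0) \<and>
      (\<forall>x. norm (A x) \<le> a * norm v * norm x) \<and> (\<forall>x\<in>\<Omega>. grad U x \<bullet> A x = 0)"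
    using bounded_infinitesimal_symmetry by blast
  obtain r where r: "r > 0" "ball q0 r \<subseteq> \<Omega>" and near: "\<And>a b. a \<in> ball q0 r \<Longrightarrow> b \<in> ball q0 r \<Longrightarrow>
      norm (grad U a - grad U b - H *v (a - b)) \<le> (d * \<beta>\<^sup>2) * norm (a - b)"
    using C2_on_grad_near_linear[OF C2 open_\<Omega> q0, of "d * \<beta>\<^sup>2"] d b2 by auto
  obtain \<tau> where \<tau>: "\<tau> > 0" "(\<Union>x\<in>orbit \<Gamma> \<rho> q0. ball x \<tau>) \<subseteq> \<O>"
    using compact_subset_open_imp_ball_epsilon_subset[OF compact_orbit \<O>] by blast
  \<comment> \<open>paths of norm 3 then stay where the gradient is nearly linear and inside the tube around the
    orbit, and the rescaled symmetries \<open>\<epsilon> A\<close> satisfy the bound with \<open>1 / 12\<close>\<close>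
  define \<epsilon> where "\<epsilon> = min (r / 4) (min (\<tau> / 4) (1 / (12 * a)))"
  have \<epsilon>: "\<epsilon> > 0" "\<epsilon> \<le> r / 4" "\<epsilon> \<le> \<tau> / 4" "\<epsilon> \<le> 1 / (12 * a)" using r \<tau> a by (auto simp: \<epsilon>_def)
  have in_ball: "q0 + \<epsilon> *\<^sub>R v \<in> ball q0 r \<and> norm (\<epsilon> *\<^sub>R v) < \<tau>" if "norm v \<le> 3" for v
  proof -
    have "\<epsilon> * norm v \<le> \<epsilon> * 3" using that \<epsilon>(1) by (intro mult_left_mono) auto
    then have "\<epsilon> * norm v < r" "\<epsilon> * norm v < \<tau>" using \<epsilon> r(1) \<tau>(1) by linarith+
    then show ?thesis using \<epsilon>(1) by (simp add: dist_norm)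
  qed
  define g where "g v = (1 / (\<epsilon> * \<beta>\<^sup>2)) *\<^sub>R grad U (q0 + \<epsilon> *\<^sub>R v)" for v
  define G where "G v = (U (q0 + \<epsilon> *\<^sub>R v) - U q0) * (1 / (\<epsilon>\<^sup>2 * \<beta>\<^sup>2))" for v
  interpret osc: near_linear_oscillator N g G Y Y' C L \<kappa> d
  proof
    show "g 0 = 0" by (simp add: g_def crit)
    show "G 0 = 0" by (simp add: G_def)
    fix u v :: "real^'n" assume u: "norm u \<le> 3" and v: "norm v \<le> 3"
    have "g u - g v - N (u - v) = (1 / (\<epsilon> * \<beta>\<^sup>2)) *\<^sub>R
        (grad U (q0 + \<epsilon> *\<^sub>R u) - grad U (q0 + \<epsilon> *\<^sub>R v) - H *v ((q0 + \<epsilon> *\<^sub>R u) - (q0 + \<epsilon> *\<^sub>R v)))"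
    proof -
      have "H *v ((q0 + \<epsilon> *\<^sub>R u) - (q0 + \<epsilon> *\<^sub>R v)) = (\<epsilon> * \<beta>\<^sup>2) *\<^sub>R N (u - v)"
        using b2 by (simp add: N_def matrix_vector_mult_scaleR flip: scaleR_diff_right)
      then show ?thesis using \<epsilon>(1) \<beta> by (simp add: g_def scaleR_diff_right)
    qed
    also have "norm \<dots> \<le> (1 / (\<epsilon> * \<beta>\<^sup>2)) * ((d * \<beta>\<^sup>2) * norm ((q0 + \<epsilon> *\<^sub>R u) - (q0 + \<epsilon> *\<^sub>R v)))"
      using \<epsilon>(1) b2 near[of "q0 + \<epsilon> *\<^sub>R u" "q0 + \<epsilon> *\<^sub>R v"] in_ball[OF u] in_ball[OF v]
      unfolding norm_scaleR by (intro mult_mono) auto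
    also have "(q0 + \<epsilon> *\<^sub>R u) - (q0 + \<epsilon> *\<^sub>R v) = \<epsilon> *\<^sub>R (u - v)" by (simp add: scaleR_diff_right)
    also have "(1 / (\<epsilon> * \<beta>\<^sup>2)) * ((d * \<beta>\<^sup>2) * norm (\<epsilon> *\<^sub>R (u - v))) = d * norm (u - v)"
      using \<epsilon>(1) \<beta> by simp
    finally show "norm (g u - g v - N (u - v)) \<le> d * norm (u - v)" .
  next
    fix v :: "real^'n" assume v: "norm v \<le> 3"
    have sh: "((\<lambda>v. q0 + \<epsilon> *\<^sub>R v) has_derivative (\<lambda>h. \<epsilon> *\<^sub>R h)) (at v)"
      by (auto intro!: derivative_eq_intros)
    have "(U has_derivative (\<lambda>h. grad U (q0 + \<epsilon> *\<^sub>R v) \<bullet> h)) (at (q0 + \<epsilon> *\<^sub>R v))"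
      using in_ball[OF v] r(2) by (intro C2_on_has_derivative_grad[OF C2]) auto
    from has_derivative_compose[OF sh this]
    have "((\<lambda>v. U (q0 + \<epsilon> *\<^sub>R v)) has_derivative (\<lambda>h. grad U (q0 + \<epsilon> *\<^sub>R v) \<bullet> (\<epsilon> *\<^sub>R h))) (at v)" .
    from has_derivative_mult_left[OF has_derivative_diff[OF this has_derivative_const]]
    have "(G has_derivative (\<lambda>h. (grad U (q0 + \<epsilon> *\<^sub>R v) \<bullet> (\<epsilon> *\<^sub>R h) - 0) * (1 / (\<epsilon>\<^sup>2 * \<beta>\<^sup>2)))) (at v)"
      unfolding G_def .
    also have "(\<lambda>h. (grad U (q0 + \<epsilon> *\<^sub>R v) \<bullet> (\<epsilon> *\<^sub>R h) - 0) * (1 / (\<epsilon>\<^sup>2 * \<beta>\<^sup>2))) = (\<lambda>h. g v \<bullet> h)"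
      using \<epsilon>(1) by (simp add: g_def power2_eq_square fun_eq_iff)
    finally show "(G has_derivative (\<lambda>h. g v \<bullet> h)) (at v)" .
  next
    fix k assume "N k = 0"
    then have "H *v k = 0" by (simp add: HN)
    then obtain A where A: "linear A" "A q0 = k" "\<And>x. x \<bullet> A x = 0"
        "\<And>x. norm (A x) \<le> a * norm k * norm x" "\<And>x. x \<in> \<Omega> \<Longrightarrow> grad U x \<bullet> A x = 0"
      using sym_a by blast
    show "\<exists>A. linear A \<and> (\<forall>x. x \<bullet> A x = 0) \<and> (\<forall>x. norm (A x) \<le> norm k / 12 * norm x) \<and>
        (\<forall>v. norm v \<le> 3 \<longrightarrow> g v \<bullet> (k + A v) = 0)"
    proof (intro exI[of _ "\<lambda>x. \<epsilon> *\<^sub>R A x"] conjI allI impI)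
      show "linear (\<lambda>x. \<epsilon> *\<^sub>R A x)" by (intro linear_compose_scale_right A)
      show "x \<bullet> (\<epsilon> *\<^sub>R A x) = 0" for x using A(3) by simp
      fix x
      have "norm (\<epsilon> *\<^sub>R A x) \<le> \<epsilon> * (a * norm k * norm x)"
        using mult_left_mono[OF A(4)[of x], of \<epsilon>] \<epsilon>(1) by simp
      also have "\<dots> \<le> 1 / (12 * a) * (a * norm k * norm x)" using \<epsilon>(4) a by (intro mult_right_mono) auto
      also have "\<dots> = norm k / 12 * norm x" using a by simp
      finally show "norm (\<epsilon> *\<^sub>R A x) \<le> norm k / 12 * norm x" .
    next
      fix v :: "real^'n" assume v: "norm v \<le> 3"
      have "k + \<epsilon> *\<^sub>R A v = A (q0 + \<epsilon> *\<^sub>R v)" using A(1,2) by (simp add: linear_add linear_scale)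
      moreover have "q0 + \<epsilon> *\<^sub>R v \<in> \<Omega>" using in_ball[OF v] r(2) by blast
      ultimately show "g v \<bullet> (k + \<epsilon> *\<^sub>R A v) = 0" using A(5) by (simp add: g_def)
    qed
  qed (use linear_add[OF linN] linear_scale[OF linN] symN green L1 LN \<kappa> \<kappa>1 \<kappa>2 d d1 d2 in auto)
  obtain z v where z: "N z = z" "1 / 2 \<le> norm z" and v: "osc.ls_solution z v" and brake: "osc.velocity z v pi = 0"
    using osc.brake_orbit_exists[OF x0(2,1)] by blast
  define m where "m = osc.multiplier v"
  have adm: "osc.admissible v" using v by (simp add: osc.ls_solution_def)
  have m: "1 / 2 \<le> m" "\<bar>m - 1\<bar> \<le> 19 * pi * L * \<kappa>"
    using osc.multiplier_bounds(1)[OF adm] osc.multiplier_near_1[OF adm] by (auto simp: m_def abs_minus_commute)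
  define q1 where "q1 t = v (arccos (cos t))" for t
  have "\<exists>p. \<forall>t. ((\<lambda>t. v (arccos (cos t))) has_vector_derivative p t) (at t) \<and>
      (p has_vector_derivative - m *\<^sub>R g (v (arccos (cos t)))) (at t)"
    using even_periodic_extension[of v "osc.velocity z v" "\<lambda>x. - m *\<^sub>R g x"]
      osc.ls_solution_ode[OF z(1) v] osc.velocity_boundary(1)[OF v] brake
    unfolding m_def by blast
  then obtain p where p: "\<And>t. (q1 has_vector_derivative p t) (at t)"
      "\<And>t. (p has_vector_derivative - m *\<^sub>R g (q1 t)) (at t)"
    unfolding q1_def by blast
  have ac: "arccos (cos t) \<in> {0..pi}" for t by (auto intro: arccos_lbound arccos_ubound)
  have q13: "norm (q1 t) \<le> 3" for t using adm ac[of t] by (simp add: osc.admissible_def q1_def)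
  have min1: "minimal_period q1 (2 * pi)"
  proof (rule minimal_period_near_cosine[of q1 z "3 / 100"])
    fix t
    show "norm (q1 t - cos t *\<^sub>R z) \<le> 3 / 100"
      using osc.ls_solution_close(1)[OF v ac[of t]] osc.L_small[of 3] by (simp add: q1_def)
    show "q1 (t + 2 * pi) = q1 t" by (simp add: q1_def)
  qed (use z in auto)
  define \<omega> where "\<omega> = \<beta> / sqrt m"
  have \<omega>: "\<omega> > 0" using \<beta> m by (simp add: \<omega>_def)
  have \<omega>2: "\<omega> * \<omega> * m = \<beta>\<^sup>2" using m by (simp add: \<omega>_def power2_eq_square)
  define q where "q t = q0 + \<epsilon> *\<^sub>R q1 (\<omega> * t)" for t
  have minq: "minimal_period q (2 * pi / \<omega>)"
    unfolding q_def using \<epsilon>(1) \<omega> by (intro minimal_period_rescale min1) auto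
  have "newton_solution U \<Omega> q"
    unfolding newton_solution_def
  proof (intro conjI allI exI[of _ "\<lambda>t. (\<epsilon> * \<omega>) *\<^sub>R p (\<omega> * t)"])
    fix t
    show "q t \<in> \<Omega>" using in_ball[OF q13] r(2) by (auto simp: q_def)
    have l: "((\<lambda>t. \<omega> * t) has_vector_derivative \<omega>) (at t)" by (auto intro!: derivative_eq_intros)
    have "((\<lambda>t. q1 (\<omega> * t)) has_vector_derivative \<omega> *\<^sub>R p (\<omega> * t)) (at t)"
      "((\<lambda>t. p (\<omega> * t)) has_vector_derivative \<omega> *\<^sub>R (- m *\<^sub>R g (q1 (\<omega> * t)))) (at t)"
      using vector_diff_chain_at[OF l p(1)] vector_diff_chain_at[OF l p(2)] by (simp_all add: o_def)
    note D = this
    show "(q has_vector_derivative (\<epsilon> * \<omega>) *\<^sub>R p (\<omega> * t)) (at t)"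
      unfolding q_def using D(1) by (auto intro!: derivative_eq_intros)
    have "((\<lambda>t. (\<epsilon> * \<omega>) *\<^sub>R p (\<omega> * t)) has_vector_derivative (\<epsilon> * \<omega>) *\<^sub>R (\<omega> *\<^sub>R (- m *\<^sub>R g (q1 (\<omega> * t))))) (at t)"
      using D(2) by (auto intro!: derivative_eq_intros)
    also have "(\<epsilon> * \<omega>) *\<^sub>R (\<omega> *\<^sub>R (- m *\<^sub>R g (q1 (\<omega> * t)))) = - ((\<epsilon> * (\<omega> * \<omega> * m)) *\<^sub>R g (q1 (\<omega> * t)))"
      by (simp add: mult_ac)
    also have "\<dots> = - grad U (q t)" unfolding \<omega>2 using \<epsilon>(1) \<beta> by (simp add: g_def q_def)
    finally show "((\<lambda>t. (\<epsilon> * \<omega>) *\<^sub>R p (\<omega> * t)) has_vector_derivative - grad U (q t)) (at t)" .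
  qed
  moreover have "\<rho> \<gamma> (q t) \<in> \<O>" if \<gamma>: "\<gamma> \<in> carrier \<Gamma>" for \<gamma> t
  proof -
    have "norm (\<rho> \<gamma> (q t) - \<rho> \<gamma> q0) = norm (\<epsilon> *\<^sub>R q1 (\<omega> * t))"
      by (simp add: action_dist[OF \<gamma>] q_def)
    also have "\<dots> < \<tau>" using in_ball[OF q13] by blast
    finally have "\<rho> \<gamma> (q t) \<in> ball (\<rho> \<gamma> q0) \<tau>" by (simp add: dist_norm norm_minus_commute)
    moreover have "\<rho> \<gamma> q0 \<in> orbit \<Gamma> \<rho> q0" using \<gamma> by (auto simp: orbit_eq)
    ultimately show ?thesis using \<tau>(2) by blast
  qed
  moreover have "\<bar>2 * pi / \<omega> - 2 * pi / \<beta>\<bar> < \<delta>"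
  proof -
    have "(sqrt m - 1) * (sqrt m + 1) = m - 1" using m by (simp add: algebra_simps)
    then have "\<bar>sqrt m - 1\<bar> * (sqrt m + 1) = \<bar>m - 1\<bar>" using m by (metis abs_mult abs_of_pos add_pos_pos less_le_trans real_sqrt_gt_zero zero_less_one half_gt_zero)
    moreover have "\<bar>sqrt m - 1\<bar> * 1 \<le> \<bar>sqrt m - 1\<bar> * (sqrt m + 1)" using m by (intro mult_left_mono) auto
    ultimately have s: "\<bar>sqrt m - 1\<bar> \<le> 19 * pi * L * \<kappa>" using m by simp
    have "2 * pi / \<omega> - 2 * pi / \<beta> = 2 * pi * (sqrt m - 1) / \<beta>"
      using m \<beta> by (simp add: \<omega>_def field_simps)
    then have "\<bar>2 * pi / \<omega> - 2 * pi / \<beta>\<bar> = 2 * pi * \<bar>sqrt m - 1\<bar> / \<beta>" using \<beta> by (simp add: abs_mult)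
    also have "\<dots> \<le> 2 * pi * (19 * pi * L * \<kappa>) / \<beta>" using s \<beta> by (intro divide_right_mono mult_left_mono) auto
    also have "\<dots> < \<delta>" by (rule \<kappa>3)
    finally show ?thesis .
  qed
  ultimately show ?thesis using minq minimal_period_imp_not_constant by blast
qed

text \<open>
  Replace a positive frequency by its largest integer multiple that is still a frequency.
\<close>

lemma nonresonant_frequency_exists:
  assumes "c \<in> spectrum H" "0 < c"
  shows "\<exists>\<beta>>0. \<beta>\<^sup>2 \<in> spectrum H \<and> (\<forall>k::nat. k \<ge> 2 \<longrightarrow> (real k * \<beta>)\<^sup>2 \<notin> spectrum H)"
proof -
  define b where "b = sqrt c"
  have b: "b > 0" "b\<^sup>2 = c" using assms by (auto simp: b_def)
  obtain B where B: "\<And>x. norm (H *v x) \<le> B * norm x"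
    using linear_bounded_pos[OF matrix_vector_mul_linear[of H]] by blast
  have bound: "\<bar>e\<bar> \<le> B" if e: "e \<in> spectrum H" for e
  proof -
    obtain v where v: "v \<noteq> 0" "H *v v = e *\<^sub>R v" using e by (auto simp: spectrum_def)
    have "\<bar>e\<bar> * norm v \<le> B * norm v" using B[of v] v(2) by simp
    then show ?thesis using v(1) by simp
  qed
  define P where "P k \<longleftrightarrow> (real k * b)\<^sup>2 \<in> spectrum H" for k :: nat
  have P1: "P 1" using assms b by (simp add: P_def)
  obtain n :: nat where n: "B < real n * c" using reals_Archimedean3[OF assms(2)] by blast
  have le: "k \<le> n" if "P k" for k
  proof (rule ccontr)
    assume "\<not> k \<le> n"
    then have k: "real n \<le> real k" "1 \<le> real k" by auto
    have "real n * c \<le> (real k * real k) * c"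
    proof (intro mult_right_mono)
      have "1 * real n \<le> real k * real k" by (intro mult_mono) (use k in auto)
      then show "real n \<le> real k * real k" by simp
    qed (use assms in auto)
    also have "\<dots> = (real k * b)\<^sup>2" using b by (simp add: power2_eq_square power_mult_distrib mult_ac)
    also have "\<dots> \<le> B" using bound[of "(real k * b)\<^sup>2"] that by (simp add: P_def)
    finally show False using n by simp
  qed
  obtain k where k: "P k" "\<And>j. P j \<Longrightarrow> j \<le> k"
    using GreatestI_nat[of P 1 n] Greatest_le_nat[of P _ n] P1 le by metis
  have k1: "1 \<le> k" using k(2)[OF P1] .
  show ?thesis
  proof (intro exI[of _ "real k * b"] conjI allI impI)
    show "0 < real k * b" using k1 b by simp
    show "(real k * b)\<^sup>2 \<in> spectrum H" using k(1) by (simp add: P_def)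
    fix j :: nat assume j: "j \<ge> 2"
    show "(real j * (real k * b))\<^sup>2 \<notin> spectrum H"
    proof
      assume "(real j * (real k * b))\<^sup>2 \<in> spectrum H"
      then have "P (j * k)" by (simp add: P_def mult.assoc)
      then have "j * k \<le> k" by (rule k(2))
      then show False using j k1 by simp
    qed
  qed
qed

end

theorem theorem1p1:
  fixes \<Gamma> :: "('g, 'h) monoid_scheme" and X :: "'g topology"
    and \<rho> :: "'g \<Rightarrow> real^'n \<Rightarrow> real^'n"
    and \<Omega> :: "(real^'n) set" and U :: "real^'n \<Rightarrow> real" and q0 :: "real^'n"
  assumes "lie_group \<Gamma> X" and "compact_space X"
    and "orthogonal_representation \<Gamma> X \<rho>"
    and "open \<Omega>" and "\<forall>\<gamma>\<in>carrier \<Gamma>. \<forall>x\<in>\<Omega>. \<rho> \<gamma> x \<in> \<Omega>"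
    and "C2_on U \<Omega>" and "\<forall>\<gamma>\<in>carrier \<Gamma>. \<forall>x\<in>\<Omega>. U (\<rho> \<gamma> x) = U x"
    and "q0 \<in> \<Omega>" and "grad U q0 = 0"
    and "stabilizer \<Gamma> \<rho> q0 = {\<one>\<^bsub>\<Gamma>\<^esub>}"
    and "dim {v. hessian U q0 *v v = 0} = manifold_dim (top_of_set (orbit \<Gamma> \<rho> q0))"
    and "\<exists>c\<in>spectrum (hessian U q0). c > 0"
  shows "(\<forall>\<O>. open \<O> \<and> orbit \<Gamma> \<rho> q0 \<subseteq> \<O> \<and> \<O> \<subseteq> \<Omega> \<longrightarrow>
           (\<exists>q T. newton_solution U \<Omega> q \<and> is_period q T \<and> \<not> q constant_on UNIV \<and>
                  (\<forall>\<gamma>\<in>carrier \<Gamma>. \<forall>t. \<rho> \<gamma> (q t) \<in> \<O>)))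
       \<and> (\<forall>(m::nat) (\<beta> :: nat \<Rightarrow> real) j0.
           spectrum (hessian U q0) \<inter> {0<..} = {(\<beta> j)\<^sup>2 | j. j \<in> {1..m}} \<and>
           (\<forall>i\<in>{1..m}. \<forall>j\<in>{1..m}. i < j \<longrightarrow> \<beta> i > \<beta> j) \<and>
           (\<forall>j\<in>{1..m}. \<beta> j > 0) \<and>
           j0 \<in> {1..m} \<and> (\<forall>i\<in>{1..<j0}. \<beta> i / \<beta> j0 \<notin> \<nat>) \<longrightarrow>
           (\<forall>\<O> \<delta>. open \<O> \<and> orbit \<Gamma> \<rho> q0 \<subseteq> \<O> \<and> \<O> \<subseteq> \<Omega> \<and> \<delta> > 0 \<longrightarrow>
             (\<exists>q T. newton_solution U \<Omega> q \<and> \<not> q constant_on UNIV \<and>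
                    (\<forall>\<gamma>\<in>carrier \<Gamma>. \<forall>t. \<rho> \<gamma> (q t) \<in> \<O>) \<and>
                    minimal_period q T \<and> \<bar>T - 2 * pi / \<beta> j0\<bar> < \<delta>)))"
proof (intro conjI allI impI; (elim conjE)?)
  interpret free_invariant_potential \<Gamma> X \<rho> \<Omega> U q0
    by unfold_locales (fact assms)+
  {
    fix \<O> assume \<O>: "open \<O>" "orbit \<Gamma> \<rho> q0 \<subseteq> \<O>"
    obtain c where "c \<in> spectrum H" "0 < c" using assms(12) by blast
    from nonresonant_frequency_exists[OF this]
    obtain \<beta> where "\<beta> > 0" "\<beta>\<^sup>2 \<in> spectrum H"
      "\<And>k::nat. k \<ge> 2 \<Longrightarrow> (real k * \<beta>)\<^sup>2 \<notin> spectrum H" by blast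
    from periodic_solutions_near_orbit[OF this \<O> zero_less_one]
    show "\<exists>q T. newton_solution U \<Omega> q \<and> is_period q T \<and> \<not> q constant_on UNIV \<and>
        (\<forall>\<gamma>\<in>carrier \<Gamma>. \<forall>t. \<rho> \<gamma> (q t) \<in> \<O>)"
      by (auto simp: minimal_period_def)
  }
  fix m :: nat and \<beta> :: "nat \<Rightarrow> real" and j0 \<O> and \<delta> :: real
  assume sp: "spectrum H \<inter> {0<..} = {(\<beta> j)\<^sup>2 | j. j \<in> {1..m}}"
    and dec: "\<forall>i\<in>{1..m}. \<forall>j\<in>{1..m}. i < j \<longrightarrow> \<beta> i > \<beta> j"
    and pos: "\<forall>j\<in>{1..m}. \<beta> j > 0" and j0: "j0 \<in> {1..m}"
    and nres: "\<forall>i\<in>{1..<j0}. \<beta> i / \<beta> j0 \<notin> \<nat>"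
    and \<O>: "open \<O>" "orbit \<Gamma> \<rho> q0 \<subseteq> \<O>" and \<delta>: "\<delta> > 0"
  have b: "\<beta> j0 > 0" using pos j0 by blast
  have "(\<beta> j0)\<^sup>2 \<in> spectrum H \<inter> {0<..}" unfolding sp using j0 by blast
  then have ev: "(\<beta> j0)\<^sup>2 \<in> spectrum H" by blast
  have nr: "(real k * \<beta> j0)\<^sup>2 \<notin> spectrum H" if k: "k \<ge> 2" for k :: nat
  proof
    assume "(real k * \<beta> j0)\<^sup>2 \<in> spectrum H"
    then have "(real k * \<beta> j0)\<^sup>2 \<in> spectrum H \<inter> {0<..}" using k b by simp
    then obtain i where i: "i \<in> {1..m}" "(real k * \<beta> j0)\<^sup>2 = (\<beta> i)\<^sup>2" unfolding sp by blast
    have ki: "real k * \<beta> j0 = \<beta> i"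
      using i pos b by (intro power2_eq_imp_eq[OF i(2)]) (auto intro: less_imp_le)
    have "\<beta> j0 < real k * \<beta> j0" using k b by simp
    then have "\<beta> j0 < \<beta> i" using ki by simp
    then have "i < j0" using dec i(1) j0 by (metis less_asym linorder_neqE_nat less_irrefl)
    then have "\<beta> i / \<beta> j0 \<notin> \<nat>" using nres i(1) by auto
    moreover have "\<beta> i / \<beta> j0 = real k" using ki[symmetric] b by simp
    ultimately show False by simp
  qed
  show "\<exists>q T. newton_solution U \<Omega> q \<and> \<not> q constant_on UNIV \<and>
      (\<forall>\<gamma>\<in>carrier \<Gamma>. \<forall>t. \<rho> \<gamma> (q t) \<in> \<O>) \<and> minimal_period q T \<and> \<bar>T - 2 * pi / \<beta> j0\<bar> < \<delta>"
    by (rule periodic_solutions_near_orbit[OF b ev nr \<O> \<delta>])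
qed

end
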